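(* Let $\mathbb{K}$ be an algebraically closed field and let $q\in\mathbb{K}$ be a primitive $l$-th root of unity with $l\ge3$. Let $A=\mathbb{K}_q[X,Y]\rtimes U_q(\mathfrak{sl}_2)$ and let $B\subset A$ be the subalgebra generated by $K^{\pm1},X,Y,\phi,\psi$. Then the PI degree of $A$ equals the PI degree of $B$, and both are equal to $l^2$ if $l$ is odd and to $\frac{l^2}{2}$ if $l$ is even.
   Context: $A$ is the $\mathbb{K}$-algebra generated by $E,F,K,K^{-1},X,Y$ with relations ($K^{-1}$ the inverse of $K$) $$KEK^{-1}=q^2E,\ KFK^{-1}=q^{-2}F,\ EF-FE=\tfrac{K-K^{-1}}{q-q^{-1}},\ EX=qXE,\ EY=X+q^{-1}YE,$$ $$FX=YK^{-1}+XF,\ FY=YF,\ KXK^{-1}=qX,\ KYK^{-1}=q^{-1}Y,\ XY=qYX.$$ Here $\phi:=EY-qYE$ and $\psi:=XF-q^2FX$. PI degree has its usual meaning for prime PI algebras. *)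

theory Defs
  imports
    "HOL-Library.Poly_Mapping"
    "HOL-Computational_Algebra.Polynomial"
    "HOL-Algebra.QuotRing"
    "HOL-Algebra.Generated_Rings"
begin

section \<open>Free associative algebras\<close>

text \<open>
  Words over an alphabet \<open>'g\<close> form the free monoid, written additively because the convolution
  product of \<^type>\<open>poly_mapping\<close> expects an additive (here non-commutative) monoid of exponents.
  Thus \<open>'g word \<Rightarrow>\<^sub>0 'k\<close> with its library ring structure is the free associative algebra
  over \<open>'k\<close> on \<open>'g\<close>.
\<close>

datatype 'g word = Word (letters: "'g list")

instantiation word :: (type) monoid_add
begin

definition zero_word :: "'a word"
  where "zero_word = Word []"

definition plus_word :: "'a word \<Rightarrow> 'a word \<Rightarrow> 'a word"
  where "plus_word v w = Word (letters v @ letters w)"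

instance
  by standard (simp_all add: zero_word_def plus_word_def)

end

type_synonym ('g, 'k) free_alg = "'g word \<Rightarrow>\<^sub>0 'k"

definition fgen :: "'g \<Rightarrow> ('g, 'k::ring_1) free_alg"
  where "fgen g = Poly_Mapping.single (Word [g]) 1"

definition fscal :: "'k \<Rightarrow> ('g, 'k::ring_1) free_alg"
  where "fscal c = Poly_Mapping.single 0 c"

definition free_alg_ring :: "('g, 'k::ring_1) free_alg ring"
  where "free_alg_ring = \<lparr>carrier = UNIV, mult = (*), one = 1, zero = 0, add = (+)\<rparr>"

lemma ring_free_alg_ring: "ring (free_alg_ring :: ('g, 'k::ring_1) free_alg ring)"
proof (rule ringI)
  show "abelian_group (free_alg_ring :: ('g, 'k) free_alg ring)"
  proof (rule abelian_groupI)
    fix x :: "('g, 'k) free_alg"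
    show "\<exists>y\<in>carrier free_alg_ring. y \<oplus>\<^bsub>free_alg_ring\<^esub> x = \<zero>\<^bsub>free_alg_ring\<^esub>"
      by (rule bexI[of _ "- x"]) (simp_all add: free_alg_ring_def)
  qed (simp_all add: free_alg_ring_def add_ac)
  show "Group.monoid (free_alg_ring :: ('g, 'k) free_alg ring)"
    by (rule monoidI) (simp_all add: free_alg_ring_def mult.assoc)
qed (simp_all add: free_alg_ring_def distrib_left distrib_right)


section \<open>The smash product of the quantum plane with quantum sl2\<close>

definition primitive_root_of_unity :: "nat \<Rightarrow> 'k::field \<Rightarrow> bool"
  where "primitive_root_of_unity l q \<longleftrightarrow> l > 0 \<and> q ^ l = 1 \<and> (\<forall>k. 0 < k \<and> k < l \<longrightarrow> q ^ k \<noteq> 1)"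

datatype gens = gE | gF | gK | gKi | gX | gY

abbreviation "fE \<equiv> fgen gE"
abbreviation "fF \<equiv> fgen gF"
abbreviation "fK \<equiv> fgen gK"
abbreviation "fKi \<equiv> fgen gKi"
abbreviation "fX \<equiv> fgen gX"
abbreviation "fY \<equiv> fgen gY"

text \<open>The relation \<open>u = v\<close> is recorded as the element \<open>u - v\<close>; \<^const>\<open>gKi\<close> stands for \<open>K\<^sup>-\<^sup>1\<close>.\<close>

definition smash_relations :: "'k::field \<Rightarrow> (gens, 'k) free_alg set"
  where "smash_relations q =
   {fK * fKi - 1,
    fKi * fK - 1,
    fK * fE * fKi - fscal (q\<^sup>2) * fE,
    fK * fF * fKi - fscal (inverse (q\<^sup>2)) * fF,
    (fE * fF - fF * fE) - fscal (inverse (q - inverse q)) * (fK - fKi),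
    fE * fX - fscal q * fX * fE,
    fE * fY - (fX + fscal (inverse q) * fY * fE),
    fF * fX - (fY * fKi + fX * fF),
    fF * fY - fY * fF,
    fK * fX * fKi - fscal q * fX,
    fK * fY * fKi - fscal (inverse q) * fY,
    fX * fY - fscal q * fY * fX}"

definition smash_ideal :: "'k::field \<Rightarrow> (gens, 'k) free_alg set"
  where "smash_ideal q = genideal free_alg_ring (smash_relations q)"

definition smash_alg :: "'k::field \<Rightarrow> (gens, 'k) free_alg set ring"
  where "smash_alg q = free_alg_ring Quot smash_ideal q"

definition smash_class :: "'k::field \<Rightarrow> (gens, 'k) free_alg \<Rightarrow> (gens, 'k) free_alg set"
  where "smash_class q x = smash_ideal q +>\<^bsub>free_alg_ring\<^esub> x"

definition phi :: "'k::field \<Rightarrow> (gens, 'k) free_alg"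
  where "phi q = fE * fY - fscal q * fY * fE"

definition psi :: "'k::field \<Rightarrow> (gens, 'k) free_alg"
  where "psi q = fX * fF - fscal (q\<^sup>2) * fF * fX"

text \<open>A subalgebra is a subring containing the scalars, hence \<open>range fscal\<close> below.\<close>

definition smash_sub :: "'k::field \<Rightarrow> (gens, 'k) free_alg set set"
  where "smash_sub q = generate_ring (smash_alg q)
     (smash_class q ` (range fscal \<union> {fK, fKi, fX, fY, phi q, psi q}))"

definition smash_subalg :: "'k::field \<Rightarrow> (gens, 'k) free_alg set ring"
  where "smash_subalg q = (smash_alg q)\<lparr>carrier := smash_sub q\<rparr>"

lemma ideal_smash_ideal: "ideal (smash_ideal q) free_alg_ring"
  unfolding smash_ideal_def
  by (rule ring.genideal_ideal[OF ring_free_alg_ring]) (simp add: free_alg_ring_def)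

lemma ring_smash_alg: "ring (smash_alg q)"
  unfolding smash_alg_def by (rule ideal.quotient_is_ring[OF ideal_smash_ideal])

lemma smash_class_closed: "smash_class q x \<in> carrier (smash_alg q)"
  unfolding smash_class_def smash_alg_def
  by (auto simp: FactRing_def A_RCOSETS_def' free_alg_ring_def)

lemma ring_smash_subalg: "ring (smash_subalg q)"
proof -
  have "subring (smash_sub q) (smash_alg q)"
    unfolding smash_sub_def
    by (rule ring.generate_ring_is_subring[OF ring_smash_alg]) (auto simp: smash_class_closed)
  then show ?thesis
    unfolding smash_subalg_def by (rule ring.subring_is_ring[OF ring_smash_alg])
qed


section \<open>Prime PI rings and the PI degree\<close>

text \<open>Zero is a prime ideal; \<^const>\<open>ideal\<close> means two-sided ideal.\<close>

definition prime_ring :: "('a, 'b) ring_scheme \<Rightarrow> bool"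
  where "prime_ring R \<longleftrightarrow> ring R \<and> carrier R \<noteq> {\<zero>\<^bsub>R\<^esub>} \<and>
    (\<forall>I J. ideal I R \<longrightarrow> ideal J R \<longrightarrow> (\<forall>a\<in>I. \<forall>b\<in>J. a \<otimes>\<^bsub>R\<^esub> b = \<zero>\<^bsub>R\<^esub>) \<longrightarrow>
       I = {\<zero>\<^bsub>R\<^esub>} \<or> J = {\<zero>\<^bsub>R\<^esub>})"

text \<open>
  Polynomial identities are elements of the free ring over the integers in the variables
  \<open>x\<^sub>0, x\<^sub>1, \<dots>\<close>. Such a polynomial is monic if some monomial of highest total degree in it has
  coefficient 1.
\<close>

type_synonym nc_poly = "(nat, int) free_alg"

definition nc_degree :: "nc_poly \<Rightarrow> nat"
  where "nc_degree f = Max ((\<lambda>w. length (letters w)) ` Poly_Mapping.keys f)"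

definition nc_monic :: "nc_poly \<Rightarrow> bool"
  where "nc_monic f \<longleftrightarrow> (\<exists>w\<in>Poly_Mapping.keys f.
     length (letters w) = nc_degree f \<and> Poly_Mapping.lookup f w = 1)"

definition word_eval :: "('a, 'b) ring_scheme \<Rightarrow> (nat \<Rightarrow> 'a) \<Rightarrow> nat word \<Rightarrow> 'a"
  where "word_eval R s w = foldr (\<lambda>i a. s i \<otimes>\<^bsub>R\<^esub> a) (letters w) \<one>\<^bsub>R\<^esub>"

definition nc_eval :: "('a, 'b) ring_scheme \<Rightarrow> (nat \<Rightarrow> 'a) \<Rightarrow> nc_poly \<Rightarrow> 'a"
  where "nc_eval R s f =
    (\<Oplus>\<^bsub>R\<^esub>w\<in>Poly_Mapping.keys f. [Poly_Mapping.lookup f w] \<cdot>\<^bsub>R\<^esub> word_eval R s w)"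

definition polynomial_identity :: "('a, 'b) ring_scheme \<Rightarrow> nc_poly \<Rightarrow> bool"
  where "polynomial_identity R f \<longleftrightarrow> (\<forall>s. (\<forall>i. s i \<in> carrier R) \<longrightarrow> nc_eval R s f = \<zero>\<^bsub>R\<^esub>)"

definition PI_ring :: "('a, 'b) ring_scheme \<Rightarrow> bool"
  where "PI_ring R \<longleftrightarrow> ring R \<and> (\<exists>f. nc_monic f \<and> polynomial_identity R f)"

definition min_PI_degree :: "('a, 'b) ring_scheme \<Rightarrow> nat"
  where "min_PI_degree R = (LEAST d. \<exists>f. nc_monic f \<and> nc_degree f = d \<and> polynomial_identity R f)"

text \<open>
  The PI degree of a prime PI ring is half the minimal degree of a monic identity, which is even
  by the theorems of Kaplansky and Posner. No truncated division is used: the value is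
  unspecified if the minimal degree is odd.
\<close>

definition PI_degree :: "('a, 'b) ring_scheme \<Rightarrow> nat"
  where "PI_degree R = (THE n. min_PI_degree R = 2 * n)"

end

theory Submission
  imports Defs "HOL-Combinatorics.Cycles" "HOL-Library.FuncSet"
begin

text \<open>
  With \<open>t = Y X K\<close> and \<open>u = \<phi> X\<^sup>-\<^sup>1\<close>, the element \<open>Z = \<phi> \<psi> + q t\<close> is central, and after inverting
  \<open>X\<close>, \<open>Y\<close> and \<open>\<phi>\<close> both algebras become the polynomial ring in \<open>Z\<close> over the quantum torus with
  \<open>K X = q X K\<close>, \<open>t u = q\<^sup>2 u t\<close> and all other pairs of generators commuting. Hence both embed in
  the matrices of size \<open>n = l m\<close> over a commutative domain of Laurent polynomials, where \<open>m\<close> is the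
  order of \<open>q\<^sup>2\<close>; injectivity follows from a PBW spanning set whose images have distinct leading
  exponents. Already the smaller algebra spans the matrix algebra up to nonzero scalars. Such a
  subring of a matrix ring is prime; it satisfies the standard identity of degree \<open>2 n\<close> by the
  Amitsur-Levitzki theorem, and no monic identity of smaller degree, since a multilinearised identity
  extends to the span and can be evaluated on a staircase of matrix units.
\<close>

text \<open>Modulo the relations, \<open>phi = X + (1/q - q) Y E\<close> and
  \<open>psi = (1 - q^2) X F - q^2 Y K^-1\<close>. With \<open>X\<close> and \<open>Y\<close>
  inverted, \<open>E\<close> and \<open>F\<close> are thus recovered from \<open>phi\<close> and
  \<open>psi\<close>, which is the origin of the denominator \<open>1 - q^2\<close>; then
  \<open>psi\<close> is traded for the central \<open>Z\<close>. The pair \<open>K\<close>,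
  \<open>X\<close> contributes the factor \<open>l\<close>, the order of \<open>q\<close>, to the
  matrix size; the pair \<open>t\<close>, \<open>u\<close> contributes the order of
  \<open>q^2\<close>, and here the parity of \<open>l\<close> enters. The algebras are
  infinite-dimensional, so matrices of this size over the ground field could not represent them
  faithfully. Hence each torus generator and \<open>Z\<close> carry their own indeterminate. These
  are units of the Laurent ring and can be stripped off again when only spans over that ring matter.
  In the Amitsur-Levitzki theorem, \<open>n + 1\<close> indices from a set of size \<open>n\<close>
  cannot be distinct. The \<open>2 n\<close> matrices are grouped in pairs because permuting whole
  pairs costs no sign, while a cycle made of whole pairs has even length and is therefore
  odd.\<close>

unbundle no m_inv_syntax

subsection \<open>The Amitsur-Levitzki identity\<close>

text \<open>For a permutation \<open>s\<close> of the positions, the sum over \<open>h\<close> is a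
  product of traces, one for each cycle of \<open>s\<close>, of the matrices met along that cycle.
  The position \<open>d\<close> is fixed by every \<open>\<pi>\<close> and always carries the matrix
  \<open>B d\<close>.\<close>

definition cyc_weight :: "'i set \<Rightarrow> nat \<Rightarrow> (nat \<Rightarrow> 'i \<Rightarrow> 'i \<Rightarrow> int) \<Rightarrow> (nat \<Rightarrow> nat) \<Rightarrow> int"
  where "cyc_weight I d B s =
    (\<Sum>\<pi> | \<pi> permutes {..<d}. sign \<pi> * (\<Sum>h\<in>{..d} \<rightarrow>\<^sub>E I. \<Prod>p\<le>d. B (\<pi> p) (h p) (h (s p))))"

text \<open>Reindexing \<open>h\<close> by \<open>\<rho>\<close> renames the positions; afterwards
  \<open>\<pi> \<circ> \<rho>\<close> stands in the place of \<open>\<pi>\<close>, and the change of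
  summation variable costs \<open>sign \<rho>\<close>. For this \<open>\<rho>\<close> has to fix
  \<open>d\<close>, whose matrix does not move.\<close>

lemma cyc_weight_conjugate:
  assumes r: "\<rho> permutes {..<d}" and s: "s permutes {..d}"
  shows "cyc_weight I d B (\<rho> \<circ> s \<circ> inv \<rho>) = sign \<rho> * cyc_weight I d B s"
proof -
  have r': "\<rho> permutes {..d}" by (rule permutes_subset[OF r]) auto
  have ri: "inv \<rho> (\<rho> x) = x" "\<rho> (inv \<rho> x) = x" for x
    using permutes_inverses[OF r] by auto
  have inner: "(\<Sum>h\<in>{..d} \<rightarrow>\<^sub>E I. \<Prod>p\<le>d. B (\<pi> p) (h p) (h ((\<rho> \<circ> s \<circ> inv \<rho>) p))) =
        (\<Sum>h\<in>{..d} \<rightarrow>\<^sub>E I. \<Prod>p\<le>d. B ((\<pi> \<circ> \<rho>) p) (h p) (h (s p)))" for \<pi>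
  proof -
    have "(\<Prod>p\<le>d. B (\<pi> p) (h p) (h ((\<rho> \<circ> s \<circ> inv \<rho>) p))) =
        (\<Prod>p\<le>d. B ((\<pi> \<circ> \<rho>) p) ((h \<circ> \<rho>) p) ((h \<circ> \<rho>) (s p)))" for h
      by (subst prod.permute[OF r']) (simp add: o_def ri)
    then show ?thesis
      by (intro sum.reindex_bij_witness[where i="\<lambda>h. h \<circ> inv \<rho>" and j="\<lambda>h. h \<circ> \<rho>"])
        (use r' permutes_inv[OF r'] in \<open>auto simp: ri fun_eq_iff PiE_def Pi_def extensional_def
            permutes_in_image permutes_not_in simp flip: atMost_iff\<close>)
  qed
  have "cyc_weight I d B (\<rho> \<circ> s \<circ> inv \<rho>) =
     (\<Sum>\<pi> | \<pi> permutes {..<d}. sign \<rho> * (sign (\<pi> \<circ> \<rho>) * (\<Sum>h\<in>{..d} \<rightarrow>\<^sub>E I. \<Prod>p\<le>d. B ((\<pi> \<circ> \<rho>) p) (h p) (h (s p)))))"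
    unfolding cyc_weight_def inner
    by (intro sum.cong refl)
      (use r in \<open>auto simp: sign_compose permutes_imp_permutation[of "{..<d}"] mult_ac\<close>)
  also have "\<dots> = sign \<rho> * cyc_weight I d B s"
    unfolding cyc_weight_def sum_distrib_left
    by (rule sum.reindex_bij_witness[where i="\<lambda>h. h \<circ> inv \<rho>" and j="\<lambda>h. h \<circ> \<rho>"])
      (use r permutes_inv[OF r] in \<open>auto simp: fun_eq_iff ri intro: permutes_compose\<close>)
  finally show ?thesis .
qed

lemma sign_cycle_of_list:
  assumes "distinct cs" "cs \<noteq> []"
  shows "sign (cycle_of_list cs) = (-1) ^ (length cs - 1)"
  using assms
proof (induction cs rule: cycle_of_list.induct)
  case (1 i j cs)
  have "sign (cycle_of_list (i # j # cs)) = sign (Transposition.transpose i j) * sign (cycle_of_list (j # cs))"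
    unfolding cycle_of_list.simps
    by (rule sign_compose[OF permutation_swap_id permutation_of_cycle])
  with 1 show ?case by (simp add: sign_swap_id del: cycle_of_list.simps)
qed auto

text \<open>Position \<open>2 i + 1\<close> of the \<open>i\<close>-th pair of factors is followed by the first position
  of the \<open>\<sigma> i\<close>-th pair; the pair number \<open>n\<close> is the single position \<open>2 n\<close>.\<close>

definition pair_succ :: "nat \<Rightarrow> (nat \<Rightarrow> nat) \<Rightarrow> nat \<Rightarrow> nat"
  where "pair_succ n \<sigma> p =
    (if even p \<and> p < 2 * n then Suc p else if p \<le> 2 * n then 2 * \<sigma> (p div 2) else p)"

text \<open>Even positions below \<open>2 * n\<close> have odd images and the remaining positions up
  to \<open>2 * n\<close> have even ones, so injectivity splits by parity; finiteness then gives
  bijectivity.\<close>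

lemma pair_succ_permutes:
  assumes "\<sigma> permutes {..n}"
  shows "pair_succ n \<sigma> permutes {..2 * n}"
proof (rule bij_imp_permutes)
  have in_n: "\<sigma> x \<le> n \<longleftrightarrow> x \<le> n" for x
    using permutes_in_image[OF assms, of x] by simp
  have inj: "\<sigma> x = \<sigma> y \<longleftrightarrow> x = y" for x y
    using permutes_inj[OF assms] by (auto dest: injD)
  have "inj_on (pair_succ n \<sigma>) {..2 * n}"
  proof (rule inj_onI)
    fix x y assume xy: "x \<in> {..2 * n}" "y \<in> {..2 * n}" "pair_succ n \<sigma> x = pair_succ n \<sigma> y"
    show "x = y"
    proof (cases "even x \<and> x < 2 * n"; cases "even y \<and> y < 2 * n")
      assume "even x \<and> x < 2 * n" "\<not> (even y \<and> y < 2 * n)"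
      then show ?thesis using xy by (auto simp: pair_succ_def) presburger+
    next
      assume "\<not> (even x \<and> x < 2 * n)" "even y \<and> y < 2 * n"
      then show ?thesis using xy by (auto simp: pair_succ_def) presburger+
    next
      assume a: "\<not> (even x \<and> x < 2 * n)" "\<not> (even y \<and> y < 2 * n)"
      then have "x div 2 = y div 2" using xy by (auto simp: pair_succ_def inj)
      with a show ?thesis using xy(1,2) by auto presburger+
    qed (use xy in \<open>auto simp: pair_succ_def\<close>)
  qed
  moreover have "pair_succ n \<sigma> ` {..2 * n} \<subseteq> {..2 * n}"
    using in_n by (auto simp: pair_succ_def)
  ultimately show "bij_betw (pair_succ n \<sigma>) {..2 * n} {..2 * n}"
    by (simp add: bij_betw_def endo_inj_surj)
qed (auto simp: pair_succ_def)

text \<open>The fundamental trace identity: \<open>n + 1\<close> vectors of an \<open>n\<close>-dimensional space have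
  vanishing antisymmetrisation, because two of the indices \<open>h 0, h 2, \<dots>, h (2 n)\<close> agree.\<close>

lemma sum_cyc_weight_eq_0:
  assumes I: "finite I" "card I = n"
  shows "(\<Sum>\<sigma> | \<sigma> permutes {..n}. sign \<sigma> * cyc_weight I (2 * n) B (pair_succ n \<sigma>)) = 0"
proof -
  have vanish: "(\<Sum>\<sigma> | \<sigma> permutes {..n}. sign \<sigma> * (\<Prod>p\<le>2 * n. B (\<pi> p) (h p) (h (pair_succ n \<sigma> p)))) = 0"
    (is "?L = 0") if h: "h \<in> {..2 * n} \<rightarrow>\<^sub>E I" for \<pi> and h :: "nat \<Rightarrow> 'a"
  proof -
    have "\<not> inj_on (\<lambda>i. h (2 * i)) {..n}"
    proof
      assume "inj_on (\<lambda>i. h (2 * i)) {..n}"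
      then have "card {..n} \<le> card I"
        by (rule card_inj_on_le) (use h I in auto)
      then show False using I by simp
    qed
    then obtain a b where ab: "a \<le> n" "b \<le> n" "a \<noteq> b" "h (2 * a) = h (2 * b)"
      by (auto simp: inj_on_def)
    define t where "t = Transposition.transpose a b"
    have t: "t permutes {..n}" "sign t = -1" "t \<circ> t = id"
      using ab by (auto simp: t_def permutes_swap_id sign_swap_id)
    have ht: "h (2 * t x) = h (2 * x)" for x
      using ab by (auto simp: t_def Transposition.transpose_def)
    \<comment> \<open>The permutation enters only through the first positions
      \<open>2 * \<sigma> i\<close> of the pairs, where \<open>h\<close> does not notice the
      transposition. Only the sign changes, so the sum is its own negative.\<close>
    have P: "h (pair_succ n (t \<circ> \<sigma>) p) = h (pair_succ n \<sigma> p)" for \<sigma> p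
      by (simp add: pair_succ_def ht)
    have "?L = (\<Sum>\<sigma> | \<sigma> permutes {..n}. sign (t \<circ> \<sigma>) * (\<Prod>p\<le>2 * n. B (\<pi> p) (h p) (h (pair_succ n (t \<circ> \<sigma>) p))))"
      by (rule sum.reindex_bij_witness[where i="\<lambda>\<sigma>. t \<circ> \<sigma>" and j="\<lambda>\<sigma>. t \<circ> \<sigma>"])
        (use t in \<open>auto simp: o_assoc intro: permutes_compose\<close>)
    also have "\<dots> = - ?L"
      unfolding P sum_negf[symmetric]
      by (intro sum.cong refl) (use t in \<open>auto simp: sign_compose permutes_imp_permutation[of "{..n}"]\<close>)
    finally show ?thesis by simp
  qed
  have "(\<Sum>\<sigma> | \<sigma> permutes {..n}. sign \<sigma> * cyc_weight I (2 * n) B (pair_succ n \<sigma>)) =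
     (\<Sum>\<pi> | \<pi> permutes {..<2 * n}. \<Sum>h\<in>{..2 * n} \<rightarrow>\<^sub>E I. sign \<pi> *
        (\<Sum>\<sigma> | \<sigma> permutes {..n}. sign \<sigma> * (\<Prod>p\<le>2 * n. B (\<pi> p) (h p) (h (pair_succ n \<sigma> p)))))"
    unfolding cyc_weight_def sum_distrib_left
    by (subst sum.swap, intro sum.cong refl, subst sum.swap) (simp add: mult_ac)
  also have "\<dots> = 0" by (simp add: vanish cong: sum.cong)
  finally show ?thesis .
qed

text \<open>The cycle of \<open>2 i0\<close> under \<^term>\<open>pair_succ n \<sigma>\<close> has even length and avoids \<open>2 n\<close>: it is an odd
  permutation by which \<^term>\<open>pair_succ n \<sigma>\<close> is conjugated to itself.\<close>

lemma cyc_weight_not_full: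
  assumes s: "\<sigma> permutes {..n}" and i0: "i0 \<le> n" "i0 \<notin> set (support \<sigma> n)"
  shows "cyc_weight I (2 * n) B (pair_succ n \<sigma>) = 0"
proof -
  define s where "s = pair_succ n \<sigma>"
  have perm: "permutation \<sigma>" using s by (auto intro: permutes_imp_permutation)
  have sp: "s permutes {..2 * n}" unfolding s_def by (rule pair_succ_permutes[OF s])
  have perms: "permutation s" using sp by (auto intro: permutes_imp_permutation)
  define O0 where "O0 = range (\<lambda>j. (\<sigma> ^^ j) i0)"
  have O0: "O0 = set (support \<sigma> i0)" unfolding O0_def support_set[OF perm] ..
  have "n \<in> set (support \<sigma> n)" unfolding support_set[OF perm] by (rule range_eqI[of _ _ 0]) simp
  then have n: "n \<notin> O0"
    using disjoint_support'[OF perm, of i0 n] i0(2) unfolding O0 by blast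
  \<comment> \<open>Each step flips the parity as long as the unpaired position \<open>2 * n\<close>
    is avoided, so the orbit closes up after an even number of steps.\<close>
  have orbit: "(s ^^ j) (2 * i0) < 2 * n \<and> (s ^^ j) (2 * i0) div 2 \<in> O0 \<and>
     (even ((s ^^ j) (2 * i0)) \<longleftrightarrow> even j)" for j
  proof (induction j)
    case 0
    have "i0 \<in> O0" unfolding O0_def by (rule range_eqI[of _ _ 0]) simp
    moreover have "i0 \<noteq> n" using n \<open>i0 \<in> O0\<close> by auto
    ultimately show ?case using i0 by auto
  next
    case (Suc j)
    define x where "x = (s ^^ j) (2 * i0)"
    have x: "x < 2 * n" "x div 2 \<in> O0" "even x \<longleftrightarrow> even j" using Suc by (auto simp: x_def)
    have "\<sigma> (x div 2) \<in> O0"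
      using x(2) unfolding O0_def by (auto intro: range_eqI[of _ _ "Suc _"])
    moreover have "\<sigma> (x div 2) \<le> n" using permutes_in_image[OF s, of "x div 2"] x by auto
    moreover have "\<sigma> (x div 2) \<noteq> n" using n \<open>\<sigma> (x div 2) \<in> O0\<close> by auto
    ultimately have "s x < 2 * n \<and> s x div 2 \<in> O0 \<and> (even (s x) \<longleftrightarrow> odd x)"
      using x by (auto simp: s_def pair_succ_def)
    then show ?case using x by (simp add: x_def)
  qed
  define cs where "cs = support s (2 * i0)"
  define \<rho> where "\<rho> = cycle_of_list cs"
  have cs: "distinct cs" unfolding cs_def by (rule cycle_of_permutation[OF perms])
  have len: "length cs = least_power s (2 * i0)" by (simp add: cs_def)
  have lp: "(s ^^ length cs) (2 * i0) = 2 * i0" "length cs > 0"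
    unfolding len by (rule least_power_of_permutation[OF perms])+
  have "even (length cs)" using orbit[of "length cs"] lp by auto
  then have sign: "sign \<rho> = -1"
    unfolding \<rho>_def using sign_cycle_of_list[OF cs] lp by auto
  have set_cs: "set cs = range (\<lambda>j. (s ^^ j) (2 * i0))"
    unfolding cs_def by (rule support_set[OF perms])
  have "set cs \<subseteq> {..<2 * n}" unfolding set_cs using orbit by auto
  then have r: "\<rho> permutes {..<2 * n}"
    unfolding \<rho>_def using cycle_permutes permutes_subset by blast
  have rs: "\<rho> x = (if x \<in> set cs then s x else x)" for x
    using cycle_restrict[OF perms, of x "2 * i0"] id_outside_supp[of x cs]
    by (auto simp: \<rho>_def cs_def)
  \<comment> \<open>Since \<open>\<rho>\<close> is \<open>s\<close> on an \<open>s\<close>-stable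
    set and the identity elsewhere, the two commute.\<close>
  have "s x \<in> set cs \<longleftrightarrow> x \<in> set cs" for x
  proof
    assume "x \<in> set cs"
    then show "s x \<in> set cs" unfolding set_cs by (auto intro: range_eqI[of _ _ "Suc _"])
  next
    assume "s x \<in> set cs"
    then obtain j where j: "s x = (s ^^ j) (2 * i0)" by (auto simp: set_cs)
    have sinj: "s a = s b \<Longrightarrow> a = b" for a b using permutes_inj[OF sp] by (auto dest: injD)
    show "x \<in> set cs"
    proof (cases j)
      case 0
      then have "s x = s ((s ^^ (length cs - 1)) (2 * i0))"
        using j lp by (cases "length cs") auto
      then show ?thesis unfolding set_cs by (auto dest: sinj)
    next
      case (Suc k)
      then show ?thesis unfolding set_cs using j by (auto dest: sinj)
    qed
  qed
  then have "\<rho> \<circ> s = s \<circ> \<rho>" by (auto simp: fun_eq_iff rs)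
  then have "\<rho> \<circ> s \<circ> inv \<rho> = s"
    by (simp add: comp_assoc permutes_inv_o[OF r])
  then have "cyc_weight I (2 * n) B s = - cyc_weight I (2 * n) B s"
    using cyc_weight_conjugate[OF r sp, of I B] sign by simp
  then show ?thesis by (simp add: s_def)
qed

section \<open>Full cycles and permutations of whole pairs\<close>

definition pair_lift :: "nat \<Rightarrow> (nat \<Rightarrow> nat) \<Rightarrow> nat \<Rightarrow> nat"
  where "pair_lift n \<tau> p = (if p < 2 * n then 2 * \<tau> (p div 2) + p mod 2 else p)"

text \<open>Exchanging two pairs is a product of two transpositions, one of the first and one of the
  second positions.\<close>

lemma pair_lift_even_permutation:
  assumes "\<tau> permutes {..<n}"
  shows "pair_lift n \<tau> permutes {..<2 * n} \<and> sign (pair_lift n \<tau>) = 1"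
  using assms finite_lessThan
proof (induction rule: permutes_induct)
  case id
  have "pair_lift n id = id" by (auto simp: pair_lift_def fun_eq_iff)
  then show ?case by (metis permutes_id sign_id)
next
  case (swap a b p)
  let ?t1 = "Transposition.transpose (2 * a) (2 * b)"
  let ?t2 = "Transposition.transpose (2 * a + 1) (2 * b + 1)"
  have eq: "pair_lift n (Transposition.transpose a b \<circ> p) = ?t1 \<circ> (?t2 \<circ> pair_lift n p)"
  proof
    fix x
    have "x \<ge> 2 * n \<Longrightarrow> x \<noteq> 2 * a \<and> x \<noteq> 2 * b \<and> x \<noteq> 2 * a + 1 \<and> x \<noteq> 2 * b + 1"
      using swap(1,2) by auto
    moreover have "x mod 2 = 0 \<or> x mod 2 = 1" by auto
    moreover have "2 * y \<noteq> Suc (2 * z)" "Suc (2 * y) \<noteq> 2 * z" for y z :: nat by presburger+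
    ultimately show "pair_lift n (Transposition.transpose a b \<circ> p) x = (?t1 \<circ> (?t2 \<circ> pair_lift n p)) x"
      by (auto simp: pair_lift_def Transposition.transpose_def)
  qed
  have t: "?t1 permutes {..<2 * n}" "?t2 permutes {..<2 * n}"
    using swap(1,2) by (auto intro!: permutes_swap_id)
  have "permutation (pair_lift n p)" using swap by (auto intro: permutes_imp_permutation[of "{..<2 * n}"])
  then have "sign (?t1 \<circ> (?t2 \<circ> pair_lift n p)) = 1"
    using swap by (auto simp: sign_compose permutation_compose permutation_swap_id sign_swap_id)
  moreover have "?t1 \<circ> (?t2 \<circ> pair_lift n p) permutes {..<2 * n}"
    using swap t by (auto intro!: permutes_compose)
  ultimately show ?case unfolding eq by blast
qed

text \<open>The pair successor of this cycle visits \<open>0, 1, ..., 2 * n\<close> in order and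
  returns to \<open>0\<close>. Its weight is therefore a single trace: that of the standard
  polynomial in the first \<open>2 * n\<close> matrices times the matrix
  \<open>B (2 * n)\<close>.\<close>

definition std_cycle :: "nat \<Rightarrow> nat \<Rightarrow> nat"
  where "std_cycle n i = (if i < n then Suc i else if i = n then 0 else i)"

lemma std_cycle_permutes: "std_cycle n permutes {..n}"
proof (rule bij_imp_permutes)
  show "bij_betw (std_cycle n) {..n} {..n}"
    by (rule bij_betwI[where g = "\<lambda>i. if i = 0 then n else if i \<le> n then i - 1 else i"])
      (auto simp: std_cycle_def)
qed (auto simp: std_cycle_def)

lemma std_cycle_full: "set (support (std_cycle n) n) = {..n}"
proof -
  have perm: "permutation (std_cycle n)"
    using std_cycle_permutes by (auto intro: permutes_imp_permutation)
  have "(std_cycle n ^^ j) n \<le> n" for j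
    by (induction j) (auto simp: std_cycle_def)
  moreover have "i \<le> n \<Longrightarrow> (std_cycle n ^^ Suc i) n = i" for i
    by (induction i) (auto simp: std_cycle_def)
  then have "i \<le> n \<Longrightarrow> i \<in> range (\<lambda>j. (std_cycle n ^^ j) n)" for i
    by (metis rangeI)
  ultimately show ?thesis unfolding support_set[OF perm] by auto
qed

text \<open>The cycle of \<open>\<sigma>\<close> is numbered by
  \<open>\<tau> i = \<sigma>^(i + 1) n\<close>. As its length is \<open>n + 1\<close>, the numbering
  ends with \<open>\<tau> n = n\<close>; so the conjugating permutation fixes \<open>n\<close>, and
  its lift leaves the last matrix in place.\<close>

lemma full_cycle_conjugate:
  assumes s: "\<sigma> permutes {..n}" and full: "set (support \<sigma> n) = {..n}"
  shows "\<exists>\<tau>. \<tau> permutes {..<n} \<and> \<sigma> \<circ> \<tau> = \<tau> \<circ> std_cycle n"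
proof -
  have perm: "permutation \<sigma>" using s by (auto intro: permutes_imp_permutation)
  have dist: "distinct (support \<sigma> n)" by (rule cycle_of_permutation[OF perm])
  have "length (support \<sigma> n) = Suc n" using distinct_card[OF dist] full by simp
  then have len: "least_power \<sigma> n = Suc n" by simp
  have pow: "(\<sigma> ^^ Suc n) n = n" using least_power_of_permutation(1)[OF perm, of n] len by simp
  have inj: "inj_on (\<lambda>i. (\<sigma> ^^ i) n) {0..<Suc n}"
    using dist unfolding len distinct_map set_upt by blast
  define \<tau> where "\<tau> i = (if i \<le> n then (\<sigma> ^^ Suc i) n else i)" for i
  have tn: "\<tau> n = n" using pow by (simp add: \<tau>_def)
  have "inj_on \<tau> {..n}"
  proof (rule inj_onI)
    fix x y assume xy: "x \<in> {..n}" "y \<in> {..n}" "\<tau> x = \<tau> y"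
    then have "\<sigma> ((\<sigma> ^^ x) n) = \<sigma> ((\<sigma> ^^ y) n)" by (simp add: \<tau>_def)
    then have "(\<sigma> ^^ x) n = (\<sigma> ^^ y) n" using permutes_inj[OF s] by (auto dest: injD)
    then show "x = y" using inj_onD[OF inj] xy by auto
  qed
  moreover have "\<tau> ` {..n} \<subseteq> {..n}"
  proof -
    have "(\<sigma> ^^ j) n \<in> {..n}" for j unfolding full[symmetric] support_set[OF perm] by auto
    then show ?thesis by (auto simp: \<tau>_def simp del: funpow.simps)
  qed
  ultimately have "bij_betw \<tau> {..n} {..n}"
    by (simp add: bij_betw_def endo_inj_surj)
  then have tn': "\<tau> permutes {..n}"
    by (rule bij_imp_permutes) (simp add: \<tau>_def)
  have "\<tau> permutes {..<n}"
    by (rule permutes_superset[OF tn']) (auto simp: tn not_less)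
  moreover have "\<sigma> \<circ> \<tau> = \<tau> \<circ> std_cycle n"
  proof
    fix x
    consider "x < n" | "x = n" | "x > n" by linarith
    then show "(\<sigma> \<circ> \<tau>) x = (\<tau> \<circ> std_cycle n) x"
    proof cases
      case 2
      then show ?thesis by (simp add: tn std_cycle_def) (simp add: \<tau>_def)
    next
      case 3
      then show ?thesis using permutes_not_in[OF s, of x] by (simp add: \<tau>_def std_cycle_def)
    qed (simp add: \<tau>_def std_cycle_def)
  qed
  ultimately show ?thesis by blast
qed

text \<open>In the vanishing sum over all \<open>\<sigma>\<close>, those that are not full cycles
  contribute \<open>0\<close>. The full cycles are conjugate to the standard one by even
  permutations of the positions and have its sign, so they contribute equally. What remains is a
  positive integer times the standard term, and the integers allow cancelling that factor.\<close>

lemma cyc_weight_std_cycle: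
  assumes I: "finite I" "card I = n"
  shows "cyc_weight I (2 * n) B (pair_succ n (std_cycle n)) = 0"
proof -
  let ?P = "{\<sigma>. \<sigma> permutes {..n}}" and ?W = "\<lambda>\<sigma>. cyc_weight I (2 * n) B (pair_succ n \<sigma>)"
  let ?F = "{\<sigma>. \<sigma> permutes {..n} \<and> set (support \<sigma> n) = {..n}}"
  have fin: "finite ?P" by (simp add: finite_permutations)
  have full: "sign \<sigma> * ?W \<sigma> = sign (std_cycle n) * ?W (std_cycle n)" if "\<sigma> \<in> ?F" for \<sigma>
  proof -
    have s: "\<sigma> permutes {..n}" using that by simp
    obtain \<tau> where t: "\<tau> permutes {..<n}" "\<sigma> \<circ> \<tau> = \<tau> \<circ> std_cycle n"
      using full_cycle_conjugate[OF s] \<open>\<sigma> \<in> ?F\<close> by auto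
    have perm: "permutation \<sigma>" "permutation \<tau>" "permutation (std_cycle n)"
      using s t std_cycle_permutes by (auto intro: permutes_imp_permutation)
    have "sign \<sigma> * sign \<tau> = sign \<tau> * sign (std_cycle n)"
      using t(2) perm by (metis sign_compose)
    then have sign: "sign \<sigma> = sign (std_cycle n)" by simp
    let ?L = "pair_lift n \<tau>"
    have L: "?L permutes {..<2 * n}" "sign ?L = 1" using pair_lift_even_permutation[OF t(1)] by auto
    have st: "\<sigma> (\<tau> x) = \<tau> (std_cycle n x)" for x using t(2) by (auto simp: fun_eq_iff)
    have tn: "\<tau> n = n" using t(1) by (simp add: permutes_not_in)
    have tlt: "\<tau> x < n \<longleftrightarrow> x < n" for x using permutes_in_image[OF t(1)] by simp
    have scn: "x \<le> n \<Longrightarrow> std_cycle n x \<le> n" for x by (simp add: std_cycle_def)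
    have "pair_succ n \<sigma> \<circ> ?L = ?L \<circ> pair_succ n (std_cycle n)"
    proof
      fix p
      have L2: "i \<le> n \<Longrightarrow> ?L (2 * i) = 2 * \<tau> i" for i
        using tn by (auto simp: pair_lift_def)
      consider (e) i where "p = 2 * i" "i < n" | (o) i where "p = Suc (2 * i)" "i < n" | (n) "p = 2 * n" | (big) "p > 2 * n"
      proof -
        have "p = 2 * (p div 2) \<or> p = Suc (2 * (p div 2))" by presburger
        moreover have "p < 2 * n \<Longrightarrow> p div 2 < n" by auto
        ultimately show ?thesis using that by (metis linorder_neqE_nat)
      qed
      then show "(pair_succ n \<sigma> \<circ> ?L) p = (?L \<circ> pair_succ n (std_cycle n)) p"
      proof cases
        case e
        then show ?thesis using tlt[of i] by (simp add: pair_succ_def pair_lift_def)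
      next
        case o
        then have "pair_succ n (std_cycle n) p = 2 * std_cycle n i" by (simp add: pair_succ_def)
        moreover have "?L p = Suc (2 * \<tau> i)" using o by (simp add: pair_lift_def)
        moreover have "pair_succ n \<sigma> (Suc (2 * \<tau> i)) = 2 * \<sigma> (\<tau> i)"
          using o tlt[of i] by (simp add: pair_succ_def)
        ultimately show ?thesis using o L2[OF scn, of i] by (simp add: st)
      next
        case n
        then show ?thesis using L2[OF scn, of n] st[of n] by (simp add: pair_succ_def pair_lift_def tn)
      next
        case big
        then show ?thesis by (simp add: pair_succ_def pair_lift_def)
      qed
    qed
    then have "pair_succ n \<sigma> = ?L \<circ> pair_succ n (std_cycle n) \<circ> inv ?L"
      by (metis comp_assoc comp_id permutes_inv_o(1)[OF L(1)])
    then have "?W \<sigma> = ?W (std_cycle n)"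
      using cyc_weight_conjugate[OF L(1) pair_succ_permutes[OF std_cycle_permutes], of I B] L(2) by simp
    then show ?thesis using sign by simp
  qed
  have zero: "sign \<sigma> * ?W \<sigma> = 0" if "\<sigma> \<in> ?P - ?F" for \<sigma>
  proof -
    have s: "\<sigma> permutes {..n}" "set (support \<sigma> n) \<noteq> {..n}" using that by auto
    have perm: "permutation \<sigma>" using s by (auto intro: permutes_imp_permutation)
    have "(\<sigma> ^^ j) n \<in> {..n}" for j
      using permutes_in_image[OF permutes_funpow[OF s(1)], of j n] by simp
    then have "set (support \<sigma> n) \<subseteq> {..n}" unfolding support_set[OF perm] by auto
    then obtain i0 where "i0 \<le> n" "i0 \<notin> set (support \<sigma> n)" using s(2) by fastforce
    from cyc_weight_not_full[OF s(1) this] show ?thesis by simp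
  qed
  have "0 = (\<Sum>\<sigma>\<in>?P. sign \<sigma> * ?W \<sigma>)" using sum_cyc_weight_eq_0[OF I, of B] by simp
  also have "\<dots> = (\<Sum>\<sigma>\<in>?F. sign \<sigma> * ?W \<sigma>)"
    by (rule sum.mono_neutral_right[OF fin]) (use zero in auto)
  also have "\<dots> = int (card ?F) * (sign (std_cycle n) * ?W (std_cycle n))"
    by (subst sum.cong[OF refl full]) simp_all
  finally have "int (card ?F) * (sign (std_cycle n) * ?W (std_cycle n)) = 0" ..
  moreover have "finite ?F" using fin by (rule rev_finite_subset) auto
  moreover have "std_cycle n \<in> ?F" using std_cycle_permutes std_cycle_full by auto
  ultimately show ?thesis by (auto simp: card_eq_0_iff)
qed

text \<open>The entry \<open>(a, b)\<close> of the product of the matrices \<open>U 0, \<dots>, U (m - 1)\<close>.\<close>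

definition path_sum :: "'i set \<Rightarrow> nat \<Rightarrow> (nat \<Rightarrow> 'i \<Rightarrow> 'i \<Rightarrow> 'c::comm_ring_1) \<Rightarrow> 'i \<Rightarrow> 'i \<Rightarrow> 'c"
  where "path_sum I m U a b =
    (\<Sum>h | h \<in> {..m} \<rightarrow>\<^sub>E I \<and> h 0 = a \<and> h m = b. \<Prod>k<m. U k (h k) (h (Suc k)))"

lemma amitsur_levitzki_int:
  fixes A :: "nat \<Rightarrow> 'i \<Rightarrow> 'i \<Rightarrow> int"
  assumes I: "finite I" "card I = n"
  shows "(\<Sum>\<pi> | \<pi> permutes {..<2 * n}. sign \<pi> * path_sum I (2 * n) (\<lambda>k. A (\<pi> k)) a b) = 0"
proof -
  \<comment> \<open>The extra matrix is the unit at \<open>(b, a)\<close>: closing the path from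
    \<open>b\<close> back to \<open>a\<close> turns the trace into the entry
    \<open>(a, b)\<close>.\<close>
  define B where "B = A(2 * n := (\<lambda>x y. if x = b \<and> y = a then 1 else 0))"
  have "(\<Sum>h\<in>{..2 * n} \<rightarrow>\<^sub>E I. \<Prod>p\<le>2 * n. B (\<pi> p) (h p) (h (pair_succ n (std_cycle n) p)))
      = path_sum I (2 * n) (\<lambda>k. A (\<pi> k)) a b"  if "\<pi> permutes {..<2 * n}" for \<pi>
  proof -
    have pn: "\<pi> (2 * n) = 2 * n" using that by (simp add: permutes_not_in)
    have plt: "\<pi> k \<noteq> 2 * n" if "k < 2 * n" for k
      using permutes_in_image[OF \<open>\<pi> permutes _\<close>, of k] that by auto
    have succ: "pair_succ n (std_cycle n) p = Suc p" if "p < 2 * n" for p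
    proof -
      have "p div 2 < n" using that by auto
      then show ?thesis using that by (auto simp: pair_succ_def std_cycle_def)
    qed
    have last: "pair_succ n (std_cycle n) (2 * n) = 0" by (simp add: pair_succ_def std_cycle_def)
    have "(\<Prod>p\<le>2 * n. B (\<pi> p) (h p) (h (pair_succ n (std_cycle n) p))) =
       (if h 0 = a \<and> h (2 * n) = b then \<Prod>k<2 * n. A (\<pi> k) (h k) (h (Suc k)) else 0)" for h
    proof -
      have "{..2 * n} = insert (2 * n) {..<2 * n}" by auto
      then have "(\<Prod>p\<le>2 * n. B (\<pi> p) (h p) (h (pair_succ n (std_cycle n) p))) =
         B (2 * n) (h (2 * n)) (h 0) * (\<Prod>p<2 * n. B (\<pi> p) (h p) (h (pair_succ n (std_cycle n) p)))"
        by (simp add: pn last)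
      also have "(\<Prod>p<2 * n. B (\<pi> p) (h p) (h (pair_succ n (std_cycle n) p))) = (\<Prod>k<2 * n. A (\<pi> k) (h k) (h (Suc k)))"
        by (intro prod.cong refl) (simp add: plt succ B_def)
      finally have "(\<Prod>p\<le>2 * n. B (\<pi> p) (h p) (h (pair_succ n (std_cycle n) p))) =
         B (2 * n) (h (2 * n)) (h 0) * (\<Prod>k<2 * n. A (\<pi> k) (h k) (h (Suc k)))" .
      then show ?thesis by (simp add: B_def)
    qed
    then show ?thesis
      unfolding path_sum_def
      by (simp, subst sum.inter_filter[symmetric]) (auto simp: I(1) finite_PiE intro!: sum.cong)
  qed
  then have "(\<Sum>\<pi> | \<pi> permutes {..<2 * n}. sign \<pi> * path_sum I (2 * n) (\<lambda>k. A (\<pi> k)) a b) =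
     cyc_weight I (2 * n) B (pair_succ n (std_cycle n))"
    unfolding cyc_weight_def by (intro sum.cong) auto
  then show ?thesis by (simp add: cyc_weight_std_cycle[OF I])
qed

text \<open>The integral case cancels factors \<open>2\<close> and \<open>n!\<close>; multilinearity reduces an arbitrary
  characteristic to it, because matrix units are integral.\<close>

lemma amitsur_levitzki:
  fixes A :: "nat \<Rightarrow> 'i \<Rightarrow> 'i \<Rightarrow> 'c::comm_ring_1"
  assumes I: "finite I" "card I = n" and ab: "a \<in> I" "b \<in> I"
  shows "(\<Sum>\<pi> | \<pi> permutes {..<2 * n}. of_int (sign \<pi>) * path_sum I (2 * n) (\<lambda>k. A (\<pi> k)) a b) = 0"
proof -
  let ?H = "{h. h \<in> {..2 * n} \<rightarrow>\<^sub>E I \<and> h 0 = a \<and> h (2 * n) = b}"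
  let ?E = "{..<2 * n} \<rightarrow>\<^sub>E (I \<times> I)"
  \<comment> \<open>Here \<open>e\<close> chooses one entry of each matrix, and \<open>U e j\<close>
    is the matrix unit at the chosen place of the matrix number \<open>j\<close>.\<close>
  define U :: "(nat \<Rightarrow> 'i \<times> 'i) \<Rightarrow> nat \<Rightarrow> 'i \<Rightarrow> 'i \<Rightarrow> int"
    where "U e j x y = (if e j = (x, y) then 1 else 0)" for e j x y
  have expand: "(\<Prod>k<2 * n. A (\<pi> k) (h k) (h (Suc k))) =
      (\<Sum>e\<in>?E. (\<Prod>j<2 * n. A j (fst (e j)) (snd (e j))) * of_int (\<Prod>k<2 * n. U e (\<pi> k) (h k) (h (Suc k))))"
    if p: "\<pi> permutes {..<2 * n}" and h: "h \<in> ?H" for \<pi> h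
  proof -
    have hI: "k < 2 * n \<Longrightarrow> (h k, h (Suc k)) \<in> I \<times> I" for k using h by (auto simp: PiE_def Pi_def)
    have pinv: "inv \<pi> permutes {..<2 * n}" using p by (rule permutes_inv)
    have perm_eq: "(\<Prod>j<2 * n. U e j (h (inv \<pi> j)) (h (Suc (inv \<pi> j)))) = (\<Prod>k<2 * n. U e (\<pi> k) (h k) (h (Suc k)))" for e
      using prod.permute[OF p, of "\<lambda>j. U e j (h (inv \<pi> j)) (h (Suc (inv \<pi> j)))"]
      by (simp add: o_def permutes_inverses[OF p])
    \<comment> \<open>The entries must be chosen per matrix and independently of
      \<open>\<pi>\<close>, so the product over positions \<open>k\<close> is first rewritten over
      the matrices \<open>j = \<pi> k\<close>.\<close>
    have "(\<Prod>k<2 * n. A (\<pi> k) (h k) (h (Suc k))) = (\<Prod>j<2 * n. A j (h (inv \<pi> j)) (h (Suc (inv \<pi> j))))"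
      using prod.permute[OF p, of "\<lambda>j. A j (h (inv \<pi> j)) (h (Suc (inv \<pi> j)))"]
      by (simp add: o_def permutes_inverses[OF p])
    also have "\<dots> = (\<Prod>j<2 * n. \<Sum>z\<in>I \<times> I. A j (fst z) (snd z) *
        of_int (if z = (h (inv \<pi> j), h (Suc (inv \<pi> j))) then 1 else 0))"
    proof (rule prod.cong[OF refl])
      fix j assume "j \<in> {..<2 * n}"
      then have z: "(h (inv \<pi> j), h (Suc (inv \<pi> j))) \<in> I \<times> I"
        using hI permutes_in_image[OF pinv, of j] by auto
      have "(\<Sum>z\<in>I \<times> I. A j (fst z) (snd z) * of_int (if z = (h (inv \<pi> j), h (Suc (inv \<pi> j))) then 1 else 0))
        = (\<Sum>z\<in>I \<times> I. if z = (h (inv \<pi> j), h (Suc (inv \<pi> j))) then A j (fst z) (snd z) else 0)"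
        by (intro sum.cong) auto
      also have "\<dots> = A j (h (inv \<pi> j)) (h (Suc (inv \<pi> j)))"
        using z I(1) by (subst sum.delta) auto
      finally show "A j (h (inv \<pi> j)) (h (Suc (inv \<pi> j))) = (\<Sum>z\<in>I \<times> I. A j (fst z) (snd z) *
        of_int (if z = (h (inv \<pi> j), h (Suc (inv \<pi> j))) then 1 else 0))" ..
    qed
    also have "\<dots> = (\<Sum>e\<in>?E. \<Prod>j<2 * n. A j (fst (e j)) (snd (e j)) *
        of_int (if e j = (h (inv \<pi> j), h (Suc (inv \<pi> j))) then 1 else 0))"
      by (rule prod_sum_PiE) (use I in auto)
    also have "\<dots> = (\<Sum>e\<in>?E. (\<Prod>j<2 * n. A j (fst (e j)) (snd (e j))) *
        of_int (\<Prod>j<2 * n. U e j (h (inv \<pi> j)) (h (Suc (inv \<pi> j)))))"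
      by (simp add: prod.distrib U_def)
    finally show ?thesis by (simp only: perm_eq)
  qed
  have "(\<Sum>\<pi> | \<pi> permutes {..<2 * n}. of_int (sign \<pi>) * path_sum I (2 * n) (\<lambda>k. A (\<pi> k)) a b) =
    (\<Sum>\<pi> | \<pi> permutes {..<2 * n}. \<Sum>h\<in>?H. \<Sum>e\<in>?E. (\<Prod>j<2 * n. A j (fst (e j)) (snd (e j))) *
       of_int (sign \<pi> * (\<Prod>k<2 * n. U e (\<pi> k) (h k) (h (Suc k)))))"
    unfolding path_sum_def sum_distrib_left
    by (intro sum.cong refl) (simp only: mem_Collect_eq expand sum_distrib_left, simp add: mult_ac expand sum_distrib_left)
  also have "\<dots> = (\<Sum>\<pi> | \<pi> permutes {..<2 * n}. \<Sum>e\<in>?E. \<Sum>h\<in>?H. (\<Prod>j<2 * n. A j (fst (e j)) (snd (e j))) *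
       of_int (sign \<pi> * (\<Prod>k<2 * n. U e (\<pi> k) (h k) (h (Suc k)))))"
    by (intro sum.cong refl sum.swap)
  also have "\<dots> = (\<Sum>e\<in>?E. (\<Prod>j<2 * n. A j (fst (e j)) (snd (e j))) * of_int
      (\<Sum>\<pi> | \<pi> permutes {..<2 * n}. sign \<pi> * path_sum I (2 * n) (\<lambda>k. U e (\<pi> k)) a b))"
    unfolding path_sum_def of_int_sum sum_distrib_left by (rule sum.swap)
  also have "\<dots> = 0" by (simp only: amitsur_levitzki_int[OF I]) simp
  finally show ?thesis .
qed

subsection \<open>Subrings spanning a matrix algebra\<close>

lemma path_sum_cong:
  assumes "\<And>k x y. k < m \<Longrightarrow> x \<in> I \<Longrightarrow> y \<in> I \<Longrightarrow> U k x y = V k x y"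
  shows "path_sum I m U a b = path_sum I m V a b"
  unfolding path_sum_def
proof (intro sum.cong refl prod.cong)
  fix h k assume "h \<in> {h. h \<in> {..m} \<rightarrow>\<^sub>E I \<and> h 0 = a \<and> h m = b}" "k \<in> {..<m}"
  then show "U k (h k) (h (Suc k)) = V k (h k) (h (Suc k))"
    by (intro assms) (auto simp: PiE_def Pi_def)
qed

lemma path_sum_0:
  assumes "a \<in> I"
  shows "path_sum I 0 U a b = (if a = b then 1 else 0)"
proof -
  have "{h. h \<in> {..0::nat} \<rightarrow>\<^sub>E I \<and> h 0 = a \<and> h 0 = b} = (if a = b then {\<lambda>k. if k = 0 then a else undefined} else {})"
    using assms by (auto simp: PiE_def extensional_def Pi_def fun_eq_iff)
  then show ?thesis by (simp add: path_sum_def)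
qed

lemma path_sum_Suc:
  assumes I: "finite I" and a: "a \<in> I"
  shows "path_sum I (Suc m) U a b = (\<Sum>c\<in>I. U 0 a c * path_sum I m (\<lambda>k. U (Suc k)) c b)"
proof -
  let ?H = "\<lambda>c. {h. h \<in> {..m} \<rightarrow>\<^sub>E I \<and> h 0 = c \<and> h m = b}"
  let ?H' = "{h. h \<in> {..Suc m} \<rightarrow>\<^sub>E I \<and> h 0 = a \<and> h (Suc m) = b}"
  have fin: "finite (?H c)" for c
    by (rule finite_subset[of _ "{..m} \<rightarrow>\<^sub>E I"]) (auto intro: finite_PiE I)
  have "(\<Sum>c\<in>I. U 0 a c * path_sum I m (\<lambda>k. U (Suc k)) c b) =
    (\<Sum>(c, h)\<in>Sigma I ?H. U 0 a c * (\<Prod>k<m. U (Suc k) (h k) (h (Suc k))))"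
    unfolding path_sum_def sum_distrib_left using I fin by (subst sum.Sigma) auto
  also have "\<dots> = (\<Sum>h\<in>?H'. \<Prod>k<Suc m. U k (h k) (h (Suc k)))"
    by (rule sum.reindex_bij_witness[where j="\<lambda>(c, h) k. case k of 0 \<Rightarrow> a | Suc k \<Rightarrow> h k"
          and i="\<lambda>h. (h 1, \<lambda>k. h (Suc k))"])
      (use a in \<open>auto simp: PiE_def extensional_def Pi_def fun_eq_iff prod.lessThan_Suc_shift split: nat.split
         simp del: prod.lessThan_Suc\<close>)
  finally show ?thesis by (simp add: path_sum_def)
qed

text \<open>The coefficients range over the whole entry ring, so they may be scalars that the
  represented ring does not contain. Multilinear identities and conditions of the form
  \<open>a M b = 0\<close> still pass from \<open>G\<close> to this span.\<close>

inductive_set mat_span :: "('i \<Rightarrow> 'i \<Rightarrow> 'c::comm_ring_1) set \<Rightarrow> ('i \<Rightarrow> 'i \<Rightarrow> 'c) set"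
  for G where
    base: "M \<in> G \<Longrightarrow> M \<in> mat_span G"
  | lin: "M \<in> mat_span G \<Longrightarrow> N \<in> mat_span G \<Longrightarrow> (\<lambda>i j. c * M i j + d * N i j) \<in> mat_span G"

section \<open>The standard polynomial\<close>

definition std_poly :: "nat \<Rightarrow> nc_poly"
  where "std_poly d = (\<Sum>\<pi> | \<pi> permutes {..<d}. Poly_Mapping.single (Word (map \<pi> [0..<d])) (sign \<pi>))"

lemma map_permutes_inj:
  assumes "\<pi> permutes {..<d}" "\<pi>' permutes {..<d}" "map \<pi> [0..<d] = map \<pi>' [0..<d]"
  shows "\<pi> = \<pi>'"
proof
  fix x show "\<pi> x = \<pi>' x"
    using assms permutes_not_in[OF assms(1), of x] permutes_not_in[OF assms(2), of x]
    by (cases "x < d") (auto simp: map_eq_conv)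
qed

lemma lookup_std_poly:
  assumes "\<pi> permutes {..<d}"
  shows "Poly_Mapping.lookup (std_poly d) (Word (map \<pi> [0..<d])) = sign \<pi>"
proof -
  have "Poly_Mapping.lookup (std_poly d) (Word (map \<pi> [0..<d])) =
    (\<Sum>\<pi>' | \<pi>' permutes {..<d}. if \<pi>' = \<pi> then sign \<pi>' else 0)"
    unfolding std_poly_def lookup_sum
  proof (intro sum.cong refl)
    fix \<pi>' assume "\<pi>' \<in> {\<pi>'. \<pi>' permutes {..<d}}"
    then have "map \<pi>' [0..<d] = map \<pi> [0..<d] \<longleftrightarrow> \<pi>' = \<pi>" using map_permutes_inj[OF _ assms] by blast
    then show "Poly_Mapping.lookup (Poly_Mapping.single (Word (map \<pi>' [0..<d])) (sign \<pi>')) (Word (map \<pi> [0..<d])) =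
        (if \<pi>' = \<pi> then sign \<pi>' else 0)"
      by (simp add: lookup_single when_def del: map_eq_conv)
  qed
  then show ?thesis using assms by (simp add: finite_permutations)
qed

lemma keys_std_poly:
  "Poly_Mapping.keys (std_poly d) = (\<lambda>\<pi>. Word (map \<pi> [0..<d])) ` {\<pi>. \<pi> permutes {..<d}}"
proof
  show "Poly_Mapping.keys (std_poly d) \<subseteq> (\<lambda>\<pi>. Word (map \<pi> [0..<d])) ` {\<pi>. \<pi> permutes {..<d}}"
  proof
    fix w assume "w \<in> Poly_Mapping.keys (std_poly d)"
    then have "(\<Sum>\<pi> | \<pi> permutes {..<d}. Poly_Mapping.lookup (Poly_Mapping.single (Word (map \<pi> [0..<d])) (sign \<pi>)) w) \<noteq> 0"
      by (simp add: in_keys_iff std_poly_def lookup_sum)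
    then obtain \<pi> where "\<pi> permutes {..<d}" "Poly_Mapping.lookup (Poly_Mapping.single (Word (map \<pi> [0..<d])) (sign \<pi>)) w \<noteq> 0"
      by (auto elim: sum.not_neutral_contains_not_neutral)
    then show "w \<in> (\<lambda>\<pi>. Word (map \<pi> [0..<d])) ` {\<pi>. \<pi> permutes {..<d}}"
      by (auto simp: lookup_single when_def split: if_splits)
  qed
qed (auto simp: in_keys_iff lookup_std_poly)

lemma nc_degree_std_poly: "nc_degree (std_poly d) = d"
proof -
  have "(\<lambda>w. length (letters w)) ` Poly_Mapping.keys (std_poly d) = {d}"
  proof -
    have "\<exists>\<pi>. \<pi> permutes {..<d}" using permutes_id by blast
    then show ?thesis unfolding keys_std_poly image_image by auto
  qed
  then show ?thesis by (simp add: nc_degree_def)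
qed

lemma nc_monic_std_poly: "nc_monic (std_poly d)"
  unfolding nc_monic_def nc_degree_std_poly
proof (rule bexI)
  show "length (letters (Word (map id [0..<d]))) = d \<and> Poly_Mapping.lookup (std_poly d) (Word (map id [0..<d])) = 1"
    using lookup_std_poly[OF permutes_id, of d] by simp
  show "Word (map id [0..<d]) \<in> Poly_Mapping.keys (std_poly d)"
    unfolding keys_std_poly using permutes_id[of "{..<d}"] by blast
qed

text \<open>Toggling a point of \<open>D - A\<close> is a sign-reversing involution on the sets
  \<open>S\<close>. With \<open>A\<close> the image of a map, the alternating sum detects whether
  the map is onto \<open>D\<close>; this is its use in the multilinearisation.\<close>

lemma sum_sign_supersets:
  assumes "finite D" "A \<subseteq> D"
  shows "(\<Sum>S | A \<subseteq> S \<and> S \<subseteq> D. (-1::int) ^ card S) = (if A = D then (-1) ^ card D else 0)"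
proof (cases "A = D")
  case True
  then have "{S. A \<subseteq> S \<and> S \<subseteq> D} = {D}" by auto
  then show ?thesis using True by simp
next
  case False
  then obtain x where x: "x \<in> D" "x \<notin> A" using assms by auto
  define t where "t S = (if x \<in> S then S - {x} else insert x S)" for S
  have sgn: "(-1::int) ^ card (t S) = - ((-1) ^ card S)" if "S \<subseteq> D" for S
  proof (cases "x \<in> S")
    case True
    moreover have "finite S" using that assms finite_subset by auto
    ultimately show ?thesis
      using card_Suc_Diff1[of S x] by (cases "card S") (auto simp: t_def)
  next
    case False
    moreover have "finite S" using that assms finite_subset by auto
    ultimately show ?thesis by (simp add: t_def)
  qed
  have "(\<Sum>S | A \<subseteq> S \<and> S \<subseteq> D. (-1::int) ^ card S) = (\<Sum>S | A \<subseteq> S \<and> S \<subseteq> D. (-1) ^ card (t S))"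
  proof (rule sum.reindex_bij_witness[where i=t and j=t])
    fix S assume S: "S \<in> {S. A \<subseteq> S \<and> S \<subseteq> D}"
    show tt: "t (t S) = S" by (auto simp: t_def)
    show "t S \<in> {S. A \<subseteq> S \<and> S \<subseteq> D}" using S x by (auto simp: t_def)
    show "(-1::int) ^ card (t (t S)) = (-1) ^ card S" by (simp only: tt)
  qed (use x in \<open>auto simp: t_def\<close>)
  also have "\<dots> = - (\<Sum>S | A \<subseteq> S \<and> S \<subseteq> D. (-1::int) ^ card S)"
    unfolding sum_negf[symmetric] by (intro sum.cong refl) (auto simp: sgn)
  finally show ?thesis using False by simp
qed

text \<open>Over the fraction field of the entry ring the image spans the full matrix algebra;
  allowing a nonzero multiple of each matrix unit expresses this without fractions. Matrices are
  total functions, hence only entries with indices in \<open>I\<close> are compared. By additivity,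
  \<open>\<Theta>_inj\<close> amounts to injectivity.\<close>

locale spanning_matrix_ring = ring R for R (structure) +
  fixes I :: "'i set" and \<Theta> :: "'a \<Rightarrow> 'i \<Rightarrow> 'i \<Rightarrow> 'c::idom"
  assumes finite_I: "finite I" and nonempty_I: "I \<noteq> {}"
    and \<Theta>_add: "\<lbrakk>x \<in> carrier R; y \<in> carrier R; i \<in> I; j \<in> I\<rbrakk> \<Longrightarrow> \<Theta> (x \<oplus> y) i j = \<Theta> x i j + \<Theta> y i j"
    and \<Theta>_mult: "\<lbrakk>x \<in> carrier R; y \<in> carrier R; i \<in> I; j \<in> I\<rbrakk> \<Longrightarrow>
        \<Theta> (x \<otimes> y) i j = (\<Sum>k\<in>I. \<Theta> x i k * \<Theta> y k j)"
    and \<Theta>_one: "\<lbrakk>i \<in> I; j \<in> I\<rbrakk> \<Longrightarrow> \<Theta> \<one> i j = (if i = j then 1 else 0)"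
    and \<Theta>_inj: "\<lbrakk>x \<in> carrier R; \<And>i j. i \<in> I \<Longrightarrow> j \<in> I \<Longrightarrow> \<Theta> x i j = 0\<rbrakk> \<Longrightarrow> x = \<zero>"
    and spanning: "\<lbrakk>i \<in> I; j \<in> I\<rbrakk> \<Longrightarrow> \<exists>M\<in>mat_span (\<Theta> ` carrier R). \<exists>c. c \<noteq> 0 \<and>
        (\<forall>k\<in>I. \<forall>l\<in>I. M k l = (if k = i \<and> l = j then c else 0))"
begin

lemma \<Theta>_zero: "i \<in> I \<Longrightarrow> j \<in> I \<Longrightarrow> \<Theta> \<zero> i j = 0"
  using \<Theta>_add[of \<zero> \<zero> i j] by (metis add_cancel_right_left l_zero zero_closed)

lemma \<Theta>_minus: "x \<in> carrier R \<Longrightarrow> i \<in> I \<Longrightarrow> j \<in> I \<Longrightarrow> \<Theta> (\<ominus> x) i j = - \<Theta> x i j"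
  using \<Theta>_add[of x "\<ominus> x" i j] \<Theta>_zero[of i j] by (simp add: r_neg eq_neg_iff_add_eq_0 add.commute)

lemma \<Theta>_nat_multiple:
  "x \<in> carrier R \<Longrightarrow> i \<in> I \<Longrightarrow> j \<in> I \<Longrightarrow> \<Theta> ([(k::nat)] \<cdot> x) i j = of_nat k * \<Theta> x i j"
  by (induction k) (simp_all add: \<Theta>_zero \<Theta>_add algebra_simps)

lemma \<Theta>_int_multiple:
  assumes "x \<in> carrier R" "i \<in> I" "j \<in> I"
  shows "\<Theta> ([(k::int)] \<cdot> x) i j = of_int k * \<Theta> x i j"
proof (cases "k \<ge> 0")
  case True
  then show ?thesis using assms by (simp add: add_pow_int_ge \<Theta>_nat_multiple)
next
  case False
  then have "of_int k = - (of_nat (nat (- k)) :: 'c)" by simp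
  then show ?thesis using False assms by (simp add: add_pow_int_lt \<Theta>_nat_multiple \<Theta>_minus)
qed

lemma \<Theta>_finsum:
  assumes "finite A" "f \<in> A \<rightarrow> carrier R" "i \<in> I" "j \<in> I"
  shows "\<Theta> (\<Oplus>x\<in>A. f x) i j = (\<Sum>x\<in>A. \<Theta> (f x) i j)"
  using assms by (induction A rule: finite_induct) (simp_all add: \<Theta>_zero \<Theta>_add)

lemma word_eval_closed:
  assumes "\<And>k. s k \<in> carrier R"
  shows "word_eval R s w \<in> carrier R"
proof -
  have "foldr (\<lambda>i a. s i \<otimes> a) ws \<one> \<in> carrier R" for ws
    using assms by (induction ws) auto
  then show ?thesis by (simp add: word_eval_def)
qed

lemma \<Theta>_word_eval:
  assumes "\<And>k. s k \<in> carrier R" "i \<in> I" "j \<in> I"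
  shows "\<Theta> (word_eval R s w) i j =
    path_sum I (length (letters w)) (\<lambda>k. \<Theta> (s (letters w ! k))) i j"
proof -
  have "\<Theta> (word_eval R s (Word ws)) i j = path_sum I (length ws) (\<lambda>k. \<Theta> (s (ws ! k))) i j" for ws
    using assms(2)
  proof (induction ws arbitrary: i)
    case Nil
    then show ?case using assms(3) by (simp add: word_eval_def \<Theta>_one path_sum_0)
  next
    case (Cons v ws)
    have "word_eval R s (Word (v # ws)) = s v \<otimes> word_eval R s (Word ws)" by (simp add: word_eval_def)
    then have "\<Theta> (word_eval R s (Word (v # ws))) i j = (\<Sum>k\<in>I. \<Theta> (s v) i k * \<Theta> (word_eval R s (Word ws)) k j)"
      using \<Theta>_mult[OF assms(1) word_eval_closed[OF assms(1)] Cons.prems assms(3)] by simp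
    also have "\<dots> = path_sum I (length (v # ws)) (\<lambda>k. \<Theta> (s ((v # ws) ! k))) i j"
      by (simp add: path_sum_Suc[OF finite_I Cons.prems] Cons.IH)
    finally show ?case .
  qed
  from this[of "letters w"] show ?thesis by simp
qed

lemma \<Theta>_nc_eval:
  assumes "\<And>k. s k \<in> carrier R" "i \<in> I" "j \<in> I"
  shows "\<Theta> (nc_eval R s f) i j = (\<Sum>w\<in>Poly_Mapping.keys f. of_int (Poly_Mapping.lookup f w) *
    path_sum I (length (letters w)) (\<lambda>k. \<Theta> (s (letters w ! k))) i j)"
  unfolding nc_eval_def
  by (subst \<Theta>_finsum) (use assms in \<open>auto simp: \<Theta>_int_multiple word_eval_closed \<Theta>_word_eval\<close>)

lemma polynomial_identity_std_poly: "polynomial_identity R (std_poly (2 * card I))"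
  unfolding polynomial_identity_def
proof (intro allI impI)
  fix s :: "nat \<Rightarrow> 'a" assume s: "\<forall>i. s i \<in> carrier R"
  let ?d = "2 * card I"
  show "nc_eval R s (std_poly ?d) = \<zero>"
  proof (rule \<Theta>_inj)
    show "nc_eval R s (std_poly ?d) \<in> carrier R"
      unfolding nc_eval_def using s by (intro finsum_closed) (auto simp: word_eval_closed)
    fix i j assume ij: "i \<in> I" "j \<in> I"
    have inj: "inj_on (\<lambda>\<pi>. Word (map \<pi> [0..<?d])) {\<pi>. \<pi> permutes {..<?d}}"
      by (rule inj_onI) (use map_permutes_inj in blast)
    have "\<Theta> (nc_eval R s (std_poly ?d)) i j = (\<Sum>\<pi> | \<pi> permutes {..<?d}. of_int (sign \<pi>) *
        path_sum I ?d (\<lambda>k. \<Theta> (s (map \<pi> [0..<?d] ! k))) i j)"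
      using s ij by (simp add: \<Theta>_nc_eval keys_std_poly sum.reindex[OF inj] lookup_std_poly)
    also have "\<dots> = (\<Sum>\<pi> | \<pi> permutes {..<?d}. of_int (sign \<pi>) *
        path_sum I ?d (\<lambda>k. \<Theta> (s (\<pi> k))) i j)"
      by (intro sum.cong refl arg_cong2[of _ _ _ _ "(*)"] path_sum_cong) simp
    also have "\<dots> = 0" by (rule amitsur_levitzki[OF finite_I refl ij])
    finally show "\<Theta> (nc_eval R s (std_poly ?d)) i j = 0" .
  qed
qed

text \<open>Multilinearisation: the variable \<open>x\<close> is replaced by the sum of the \<open>U p\<close> over the
  positions \<open>p \<in> S\<close> at which it occurs in \<open>w\<close>; the alternating sum over \<open>S\<close> keeps exactly the terms
  in which every \<open>U p\<close> occurs once.\<close>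

lemma multilinear_identity:
  assumes f: "polynomial_identity R f" and deg: "nc_degree f = length w"
    and U: "\<And>p. p < length w \<Longrightarrow> U p \<in> carrier R" and ij: "i \<in> I" "j \<in> I"
  shows "(\<Sum>g | g \<in> {..<length w} \<rightarrow>\<^sub>E {..<length w} \<and> g ` {..<length w} = {..<length w}.
     of_int (Poly_Mapping.lookup f (Word (map (\<lambda>k. w ! g k) [0..<length w]))) *
     path_sum I (length w) (\<lambda>k. \<Theta> (U (g k))) i j) = 0"
proof -
  define d where "d = length w"
  let ?c = "\<lambda>v. of_int (Poly_Mapping.lookup f v) :: 'c" and ?K = "Poly_Mapping.keys f"
  let ?G = "\<lambda>v S. {g \<in> {..<length (letters v)} \<rightarrow>\<^sub>E S. \<forall>k<length (letters v). w ! g k = letters v ! k}"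
  let ?P = "\<lambda>m g. path_sum I m (\<lambda>k. \<Theta> (U (g k))) i j"
  let ?T = "{g. g \<in> {..<d} \<rightarrow>\<^sub>E {..<d} \<and> g ` {..<d} = {..<d}}"
  have len: "length (letters v) \<le> d" if "v \<in> ?K" for v
    unfolding d_def deg[symmetric] nc_degree_def using that by (intro Max_ge) auto
  have Ud: "p < d \<Longrightarrow> U p \<in> carrier R" for p using U by (simp add: d_def)
  have finG: "finite (?G v S)" if "finite S" for v S
    by (rule finite_subset[of _ "{..<length (letters v)} \<rightarrow>\<^sub>E S"]) (auto intro: finite_PiE that)
  have eval: "(\<Sum>v\<in>?K. \<Sum>g\<in>?G v S. ?c v * ?P (length (letters v)) g) = 0" if S: "S \<subseteq> {..<d}" for S
  proof -
    \<comment> \<open>A variable that \<open>w\<close> has at no position of \<open>S\<close>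
      receives the empty sum \<open>\<zero>\<close>.\<close>
    define s where "s x = (\<Oplus>p\<in>{p\<in>S. w ! p = x}. U p)" for x
    have fin: "finite {p\<in>S. w ! p = x}" for x
      using S finite_subset[OF _ finite_lessThan, of "{p\<in>S. w ! p = x}" d] by auto
    have finS: "finite S" using S finite_subset by blast
    have s: "s x \<in> carrier R" for x unfolding s_def using S Ud by (intro finsum_closed) auto
    have \<Theta>s: "\<Theta> (s x) a b = (\<Sum>p\<in>{p\<in>S. w ! p = x}. \<Theta> (U p) a b)" if "a \<in> I" "b \<in> I" for x a b
      unfolding s_def by (rule \<Theta>_finsum[OF fin]) (use S Ud that in auto)
    have "path_sum I (length (letters v)) (\<lambda>k. \<Theta> (s (letters v ! k))) i j =
        (\<Sum>g\<in>?G v S. ?P (length (letters v)) g)" for v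
    proof -
      let ?m = "length (letters v)"
      have eqG: "(\<Pi>\<^sub>E k\<in>{..<?m}. {p\<in>S. w ! p = letters v ! k}) = ?G v S"
        by (auto simp: PiE_def Pi_def)
      have "path_sum I ?m (\<lambda>k. \<Theta> (s (letters v ! k))) i j =
         path_sum I ?m (\<lambda>k a b. \<Sum>p\<in>{p\<in>S. w ! p = letters v ! k}. \<Theta> (U p) a b) i j"
        by (rule path_sum_cong) (simp add: \<Theta>s)
      also have "\<dots> = (\<Sum>h | h \<in> {..?m} \<rightarrow>\<^sub>E I \<and> h 0 = i \<and> h ?m = j.
          \<Sum>g\<in>?G v S. \<Prod>k<?m. \<Theta> (U (g k)) (h k) (h (Suc k)))"
        unfolding path_sum_def eqG[symmetric] by (intro sum.cong refl prod_sum_PiE) (auto simp: fin)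
      also have "\<dots> = (\<Sum>g\<in>?G v S. ?P ?m g)"
        unfolding path_sum_def by (rule sum.swap)
      finally show ?thesis .
    qed
    then have "(\<Sum>v\<in>?K. \<Sum>g\<in>?G v S. ?c v * ?P (length (letters v)) g) = \<Theta> (nc_eval R s f) i j"
      by (simp add: \<Theta>_nc_eval[OF s ij] sum_distrib_left)
    also have "\<dots> = 0" using f s by (simp add: polynomial_identity_def \<Theta>_zero ij)
    finally show ?thesis .
  qed
  have "0 = (\<Sum>S\<in>Pow {..<d}. (-1) ^ card S * (\<Sum>v\<in>?K. \<Sum>g\<in>?G v S. ?c v * ?P (length (letters v)) g))"
    by (simp add: eval)
  \<comment> \<open>A choice with values in \<open>S\<close> is a choice among all positions whose
    image lies in \<open>S\<close>. This makes the range of \<open>g\<close> independent of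
    \<open>S\<close>, so that the sums can be exchanged.\<close>
  also have "\<dots> = (\<Sum>S\<in>Pow {..<d}. \<Sum>v\<in>?K. \<Sum>g\<in>?G v {..<d}. if g ` {..<length (letters v)} \<subseteq> S then
      (-1) ^ card S * (?c v * ?P (length (letters v)) g) else 0)"
    unfolding sum_distrib_left
  proof (rule sum.cong[OF refl], rule sum.cong[OF refl])
    fix S v assume S: "S \<in> Pow {..<d}"
    then have "?G v S = {g \<in> ?G v {..<d}. g ` {..<length (letters v)} \<subseteq> S}"
      by (auto simp: PiE_def Pi_def)
    then show "(\<Sum>g\<in>?G v S. (-1) ^ card S * (?c v * ?P (length (letters v)) g)) =
      (\<Sum>g\<in>?G v {..<d}. if g ` {..<length (letters v)} \<subseteq> S then
      (-1) ^ card S * (?c v * ?P (length (letters v)) g) else 0)"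
      by (simp only: sum.inter_filter[OF finG[OF finite_lessThan]])
  qed
  also have "\<dots> = (\<Sum>v\<in>?K. \<Sum>S\<in>Pow {..<d}. \<Sum>g\<in>?G v {..<d}. if g ` {..<length (letters v)} \<subseteq> S then
      (-1) ^ card S * (?c v * ?P (length (letters v)) g) else 0)"
    by (rule sum.swap)
  also have "\<dots> = (\<Sum>v\<in>?K. \<Sum>g\<in>?G v {..<d}. \<Sum>S\<in>Pow {..<d}. if g ` {..<length (letters v)} \<subseteq> S then
      (-1) ^ card S * (?c v * ?P (length (letters v)) g) else 0)"
    by (intro sum.cong refl sum.swap)
  also have "\<dots> = (\<Sum>v\<in>?K. \<Sum>g\<in>?G v {..<d}. if g ` {..<length (letters v)} = {..<d} then
      (-1) ^ d * (?c v * ?P (length (letters v)) g) else 0)"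
  proof (intro sum.cong refl)
    fix v g assume g: "g \<in> ?G v {..<d}"
    let ?A = "g ` {..<length (letters v)}"
    have A: "?A \<subseteq> {..<d}" using g by auto
    have "(\<Sum>S\<in>Pow {..<d}. if ?A \<subseteq> S then (-1) ^ card S * (?c v * ?P (length (letters v)) g) else 0)
      = (\<Sum>S\<in>{S \<in> Pow {..<d}. ?A \<subseteq> S}. (-1) ^ card S * (?c v * ?P (length (letters v)) g))"
      by (rule sum.inter_filter[symmetric]) simp
    also have "{S \<in> Pow {..<d}. ?A \<subseteq> S} = {S. ?A \<subseteq> S \<and> S \<subseteq> {..<d}}" by auto
    also have "(\<Sum>S | ?A \<subseteq> S \<and> S \<subseteq> {..<d}. (-1) ^ card S * (?c v * ?P (length (letters v)) g)) =
        of_int (\<Sum>S | ?A \<subseteq> S \<and> S \<subseteq> {..<d}. (-1) ^ card S) * (?c v * ?P (length (letters v)) g)"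
      by (simp add: sum_distrib_right)
    finally show "(\<Sum>S\<in>Pow {..<d}. if ?A \<subseteq> S then (-1) ^ card S * (?c v * ?P (length (letters v)) g) else 0)
      = (if ?A = {..<d} then (-1) ^ d * (?c v * ?P (length (letters v)) g) else 0)"
      using sum_sign_supersets[OF finite_lessThan A] by simp
  qed
  also have "\<dots> = (\<Sum>v\<in>?K. \<Sum>g\<in>?T. if v = Word (map (\<lambda>k. w ! g k) [0..<d]) then (-1) ^ d * (?c v * ?P d g) else 0)"
  proof (rule sum.cong[OF refl])
    fix v assume v: "v \<in> ?K"
    let ?m = "length (letters v)"
    let ?w = "\<lambda>g. Word (map (\<lambda>k. w ! g k) [0..<d])"
    \<comment> \<open>A word of \<open>f\<close> has at most \<open>d\<close> letters and reaches
      all \<open>d\<close> positions only if it has exactly \<open>d\<close>. Terms of lower degree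
      drop out here.\<close>
    have surj: "?m = d" if "g ` {..<?m} = {..<d}" for g :: "nat \<Rightarrow> nat"
      using card_image_le[of "{..<?m}" g] that len[OF v] by simp
    have iff: "(\<forall>k<?m. w ! g k = letters v ! k) \<longleftrightarrow> v = ?w g" if "?m = d" for g
      using that by (cases v) (auto simp: list_eq_iff_nth_eq)
    have md: "?m = d" if "v = ?w g" for g using that by simp
    have g_iff: "g \<in> {g \<in> ?G v {..<d}. g ` {..<?m} = {..<d}} \<longleftrightarrow> g \<in> {g \<in> ?T. v = ?w g}" for g
    proof (cases "?m = d")
      case True
      show ?thesis using iff[OF True, of g, unfolded True] unfolding mem_Collect_eq True
        by (simp only: conj_ac)
    next
      case False
      then have "g ` {..<?m} \<noteq> {..<d}" "v \<noteq> ?w g" using surj md by iprover+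
      then show ?thesis by simp
    qed
    have eq: "{g \<in> ?G v {..<d}. g ` {..<?m} = {..<d}} = {g \<in> ?T. v = ?w g}" by (rule Set.set_eqI, rule g_iff)
    have finT: "finite ?T" by (rule finite_subset[of _ "{..<d} \<rightarrow>\<^sub>E {..<d}"]) (auto intro: finite_PiE)
    have "(\<Sum>g\<in>?G v {..<d}. if g ` {..<?m} = {..<d} then (-1) ^ d * (?c v * ?P ?m g) else 0) =
      (\<Sum>g\<in>{g \<in> ?T. v = ?w g}. (-1) ^ d * (?c v * ?P ?m g))"
      unfolding eq[symmetric] by (rule sum.inter_filter[symmetric, OF finG[OF finite_lessThan]])
    also have "\<dots> = (\<Sum>g\<in>{g \<in> ?T. v = ?w g}. (-1) ^ d * (?c v * ?P d g))"
      by (rule sum.cong[OF refl]) (use md in auto)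
    also have "\<dots> = (\<Sum>g\<in>?T. if v = ?w g then (-1) ^ d * (?c v * ?P d g) else 0)"
      by (rule sum.inter_filter[OF finT])
    finally show "(\<Sum>g\<in>?G v {..<d}. if g ` {..<?m} = {..<d} then (-1) ^ d * (?c v * ?P ?m g) else 0)
       = (\<Sum>g\<in>?T. if v = ?w g then (-1) ^ d * (?c v * ?P d g) else 0)" .
  qed
  also have "\<dots> = (\<Sum>g\<in>?T. \<Sum>v\<in>?K. if v = Word (map (\<lambda>k. w ! g k) [0..<d]) then (-1) ^ d * (?c v * ?P d g) else 0)"
    by (rule sum.swap)
  also have "\<dots> = (\<Sum>g\<in>?T. (-1) ^ d * (?c (Word (map (\<lambda>k. w ! g k) [0..<d])) * ?P d g))"
  proof (rule sum.cong[OF refl])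
    fix g
    show "(\<Sum>v\<in>?K. if v = Word (map (\<lambda>k. w ! g k) [0..<d]) then (-1) ^ d * (?c v * ?P d g) else 0) =
      (-1) ^ d * (?c (Word (map (\<lambda>k. w ! g k) [0..<d])) * ?P d g)"
      by (subst sum.delta[OF finite_keys]) (auto simp: in_keys_iff)
  qed
  also have "\<dots> = (-1) ^ d * (\<Sum>g\<in>?T. ?c (Word (map (\<lambda>k. w ! g k) [0..<d])) * ?P d g)"
    by (simp add: sum_distrib_left)
  finally show ?thesis by (simp add: d_def)
qed

text \<open>A surjection of a finite set onto itself is injective, so the matrix number
  \<open>r\<close> occurs in exactly one factor along every path.\<close>

lemma path_sum_linear:
  assumes g: "g \<in> {..<d} \<rightarrow>\<^sub>E {..<d}" "g ` {..<d} = {..<d}" and r: "r < d"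
  shows "path_sum I d (\<lambda>k. (M(r := (\<lambda>i j. x * A i j + y * B i j))) (g k)) a b =
     x * path_sum I d (\<lambda>k. (M(r := A)) (g k)) a b + y * path_sum I d (\<lambda>k. (M(r := B)) (g k)) a b"
proof -
  obtain k0 where k0: "k0 < d" "g k0 = r" using g r by (metis imageE lessThan_iff)
  have "inj_on g {..<d}" using g by (simp add: eq_card_imp_inj_on)
  then have other: "k < d \<Longrightarrow> k \<noteq> k0 \<Longrightarrow> g k \<noteq> r" for k using k0 by (auto dest: inj_onD)
  have split: "(\<Prod>k<d. (M(r := Z)) (g k) (h k) (h (Suc k))) =
      Z (h k0) (h (Suc k0)) * (\<Prod>k\<in>{..<d} - {k0}. M (g k) (h k) (h (Suc k)))" for Z h
  proof -
    have "(\<Prod>k<d. (M(r := Z)) (g k) (h k) (h (Suc k))) = (M(r := Z)) (g k0) (h k0) (h (Suc k0)) *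
       (\<Prod>k\<in>{..<d} - {k0}. (M(r := Z)) (g k) (h k) (h (Suc k)))"
      using k0 by (intro prod.remove) auto
    also have "(\<Prod>k\<in>{..<d} - {k0}. (M(r := Z)) (g k) (h k) (h (Suc k))) = (\<Prod>k\<in>{..<d} - {k0}. M (g k) (h k) (h (Suc k)))"
      by (intro prod.cong refl) (auto simp: other)
    finally show ?thesis using k0 by simp
  qed
  show ?thesis unfolding path_sum_def split by (simp add: sum_distrib_left sum.distrib[symmetric] algebra_simps)
qed

text \<open>The form is linear in each argument over the entry ring. The induction frees one
  argument at a time: those below \<open>r\<close> may lie in the span, those from \<open>r\<close>
  on are still images of ring elements.\<close>

lemma multilinear_identity_span:
  assumes f: "polynomial_identity R f" and deg: "nc_degree f = length w"
    and M: "\<And>p. p < length w \<Longrightarrow> M p \<in> mat_span (\<Theta> ` carrier R)" and ij: "i \<in> I" "j \<in> I"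
  shows "(\<Sum>g | g \<in> {..<length w} \<rightarrow>\<^sub>E {..<length w} \<and> g ` {..<length w} = {..<length w}.
     of_int (Poly_Mapping.lookup f (Word (map (\<lambda>k. w ! g k) [0..<length w]))) *
     path_sum I (length w) (\<lambda>k. M (g k)) i j) = 0"
proof -
  define d where "d = length w"
  let ?T = "{g. g \<in> {..<d} \<rightarrow>\<^sub>E {..<d} \<and> g ` {..<d} = {..<d}}"
  let ?c = "\<lambda>g. of_int (Poly_Mapping.lookup f (Word (map (\<lambda>k. w ! g k) [0..<d]))) :: 'c"
  define L where "L M = (\<Sum>g\<in>?T. ?c g * path_sum I d (\<lambda>k. M (g k)) i j)" for M
  have L_lin: "L (M(r := (\<lambda>i j. x * A i j + y * B i j))) = x * L (M(r := A)) + y * L (M(r := B))"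
    if "r < d" for M r x A y B
    unfolding L_def sum_distrib_left sum.distrib[symmetric]
  proof (rule sum.cong[OF refl])
    fix g assume "g \<in> ?T"
    then have g: "g \<in> {..<d} \<rightarrow>\<^sub>E {..<d}" "g ` {..<d} = {..<d}" by auto
    show "?c g * path_sum I d (\<lambda>k. (M(r := \<lambda>i j. x * A i j + y * B i j)) (g k)) i j =
        x * (?c g * path_sum I d (\<lambda>k. (M(r := A)) (g k)) i j) + y * (?c g * path_sum I d (\<lambda>k. (M(r := B)) (g k)) i j)"
      unfolding path_sum_linear[OF g that] by (simp only: algebra_simps)
  qed
  have "L M = 0" if "\<And>p. p < d \<Longrightarrow> M p \<in> mat_span (\<Theta> ` carrier R)"
    "\<And>p. r \<le> p \<Longrightarrow> p < d \<Longrightarrow> M p \<in> \<Theta> ` carrier R" "r \<le> d" for r M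
    using that
  proof (induction r arbitrary: M)
    case 0
    then have "\<forall>p. \<exists>u. p < d \<longrightarrow> u \<in> carrier R \<and> M p = \<Theta> u" by blast
    then obtain U where U: "p < d \<Longrightarrow> U p \<in> carrier R" "p < d \<Longrightarrow> M p = \<Theta> (U p)" for p by metis
    have "L M = (\<Sum>g\<in>?T. ?c g * path_sum I d (\<lambda>k. \<Theta> (U (g k))) i j)"
      unfolding L_def by (intro sum.cong refl arg_cong2[of _ _ _ _ "(*)"] path_sum_cong)
        (auto simp: PiE_def Pi_def U)
    also have "\<dots> = 0"
      using multilinear_identity[OF f deg _ ij, of U] U(1) by (simp add: d_def)
    finally show ?case .
  next
    case (Suc r)
    have "L (M(r := A)) = 0" if "A \<in> mat_span (\<Theta> ` carrier R)" for A
      using that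
    proof induction
      case (base A)
      show ?case
        by (rule Suc.IH) (use Suc.prems base in \<open>auto simp: le_Suc_eq intro: mat_span.base\<close>)
    next
      case (lin A B x y)
      have "r < d" using Suc.prems(3) by simp
      then show ?case by (simp only: L_lin lin.IH mult_zero_right add_0)
    qed
    from this[OF Suc.prems(1), of r] Suc.prems(3) show ?case by simp
  qed
  from this[of M d] M show ?thesis by (simp add: d_def L_def)
qed

text \<open>Up to scalars the staircase is \<open>e00, e01, e11, e12, ...\<close>, with the unit
  number \<open>p\<close> at \<open>(p div 2, Suc p div 2)\<close>. Its first \<open>d\<close> units
  involve only the indices \<open>0, ..., d div 2\<close>, which exist since
  \<open>d < 2 * card I\<close>. Among all orders of the factors only the given one reaches the last
  index from the first, so the identity isolates the coefficient \<open>1\<close> of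
  \<open>w\<close>.\<close>

lemma nc_degree_identity_ge:
  assumes f: "polynomial_identity R f" and monic: "nc_monic f"
  shows "2 * card I \<le> nc_degree f"
proof (rule ccontr)
  assume less: "\<not> 2 * card I \<le> nc_degree f"
  obtain w where w: "length w = nc_degree f" "Poly_Mapping.lookup f (Word w) = 1"
    using monic unfolding nc_monic_def by (metis word.exhaust word.sel)
  define d where "d = length w"
  have d: "d < 2 * card I" using less w by (simp add: d_def)
  obtain x where x: "bij_betw x {..<card I} I"
    using ex_bij_betw_nat_finite[OF finite_I] by (auto simp: atLeast0LessThan)
  have xI: "k < card I \<Longrightarrow> x k \<in> I" for k using x by (auto simp: bij_betw_def)
  have xinj: "k < card I \<Longrightarrow> k' < card I \<Longrightarrow> x k = x k' \<Longrightarrow> k = k'" for k k'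
    using x by (auto simp: bij_betw_def dest: inj_onD)
  have half: "k \<le> d \<Longrightarrow> k div 2 < card I" for k using d by auto
  have "\<forall>p. \<exists>M c. p < d \<longrightarrow> M \<in> mat_span (\<Theta> ` carrier R) \<and> c \<noteq> 0 \<and>
      (\<forall>k\<in>I. \<forall>l\<in>I. M k l = (if k = x (p div 2) \<and> l = x (Suc p div 2) then c else 0))"
  proof
    fix p
    show "\<exists>M c. p < d \<longrightarrow> M \<in> mat_span (\<Theta> ` carrier R) \<and> c \<noteq> 0 \<and>
      (\<forall>k\<in>I. \<forall>l\<in>I. M k l = (if k = x (p div 2) \<and> l = x (Suc p div 2) then c else 0))"
    proof (cases "p < d")
      case True
      then have "x (p div 2) \<in> I" "x (Suc p div 2) \<in> I" using xI half[of p] half[of "Suc p"] by auto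
      from spanning[OF this] show ?thesis by blast
    qed simp
  qed
  then obtain M c where Mc: "\<forall>p. p < d \<longrightarrow> M p \<in> mat_span (\<Theta> ` carrier R) \<and> c p \<noteq> 0 \<and>
      (\<forall>k\<in>I. \<forall>l\<in>I. M p k l = (if k = x (p div 2) \<and> l = x (Suc p div 2) then c p else 0))"
    unfolding choice_iff by (elim exE)
  have M: "\<And>p. p < d \<Longrightarrow> M p \<in> mat_span (\<Theta> ` carrier R)" "\<And>p. p < d \<Longrightarrow> c p \<noteq> 0"
      "\<And>p k l. p < d \<Longrightarrow> k \<in> I \<Longrightarrow> l \<in> I \<Longrightarrow> M p k l = (if k = x (p div 2) \<and> l = x (Suc p div 2) then c p else 0)"
    using Mc by blast+
  let ?i = "x 0" and ?j = "x (d div 2)"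
  have ij: "?i \<in> I" "?j \<in> I" using xI half[of 0] half[of d] by auto
  let ?T = "{g. g \<in> {..<d} \<rightarrow>\<^sub>E {..<d} \<and> g ` {..<d} = {..<d}}"
  let ?H = "{h. h \<in> {..d} \<rightarrow>\<^sub>E I \<and> h 0 = ?i \<and> h d = ?j}"
  define h0 where "h0 = (\<lambda>k\<in>{..d}. x (k div 2))"
  define g0 where "g0 = (\<lambda>k\<in>{..<d}. k)"
  have nz: "g = g0 \<and> h = h0"
    if g: "g \<in> ?T" and h: "h \<in> ?H" and ne: "(\<Prod>k<d. M (g k) (h k) (h (Suc k))) \<noteq> 0" for g h
  proof -
    have gd: "k < d \<Longrightarrow> g k < d" for k using g by auto
    have hI: "k \<le> d \<Longrightarrow> h k \<in> I" for k using h by auto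
    have eq: "h k = x (g k div 2)" "h (Suc k) = x (Suc (g k) div 2)" if "k < d" for k
    proof -
      have "M (g k) (h k) (h (Suc k)) \<noteq> 0" using ne that by (auto simp: prod_zero_iff)
      then show "h k = x (g k div 2)" "h (Suc k) = x (Suc (g k) div 2)"
        using M(3)[OF gd[OF that] hI hI, of k "Suc k"] that by (auto split: if_splits)
    qed
    have inj: "inj_on g {..<d}" using g by (simp add: eq_card_imp_inj_on)
    \<comment> \<open>The inner indices of adjacent factors agree, so \<open>g (Suc k)\<close> has
      the same half as \<open>Suc (g k)\<close>; being different from \<open>g k\<close>, it is
      larger.\<close>
    have mono: "g k < g (Suc k)" if "Suc k < d" for k
    proof -
      have "g (Suc k) div 2 = Suc (g k) div 2"
        by (rule xinj) (use eq[of k] eq[of "Suc k"] that half[of "Suc (g k)"] half[of "g (Suc k)"] gd[of k] gd[of "Suc k"] in auto)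
      moreover have "g k \<noteq> g (Suc k)" using inj_onD[OF inj, of k "Suc k"] that by auto
      ultimately show ?thesis by presburger
    qed
    \<comment> \<open>A strictly increasing self-map of \<open>{..<d}\<close> is the identity: it is
      bounded by \<open>k\<close> from below, and from above by counting down from
      \<open>d\<close>.\<close>
    have ge: "k < d \<Longrightarrow> k \<le> g k" for k
    proof (induction k)
      case (Suc k)
      then show ?case using mono[of k] by simp
    qed simp
    have le: "k < d \<Longrightarrow> g (d - Suc k) \<le> d - Suc k" for k
    proof (induction k)
      case 0
      then show ?case using gd[of "d - 1"] by simp
    next
      case (Suc k)
      then show ?case using mono[of "d - Suc (Suc k)"] by (simp add: Suc_diff_Suc)
    qed
    have gk: "g k = k" if "k < d" for k
      using le[of "d - Suc k"] ge[of k] that by simp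
    have "g = g0" using g gk by (auto simp: g0_def fun_eq_iff PiE_def extensional_def)
    moreover have "h k = x (k div 2)" if "k \<le> d" for k
      using that eq[of k] gk[of k] h by (cases "k = d") auto
    then have "h = h0" using h by (auto simp: h0_def fun_eq_iff PiE_def extensional_def)
    ultimately show ?thesis by simp
  qed
  have g0: "g0 \<in> ?T" by (auto simp: g0_def image_iff)
  have h0: "h0 \<in> ?H" using xI half by (auto simp: h0_def)
  have finT: "finite ?T" by (rule finite_subset[of _ "{..<d} \<rightarrow>\<^sub>E {..<d}"]) (auto intro: finite_PiE)
  have finH: "finite ?H" by (rule finite_subset[of _ "{..d} \<rightarrow>\<^sub>E I"]) (auto intro: finite_PiE finite_I)
  have path: "path_sum I d (\<lambda>k. M (g k)) ?i ?j = (if g = g0 then \<Prod>k<d. c k else 0)" if "g \<in> ?T" for g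
  proof (cases "g = g0")
    case True
    have "path_sum I d (\<lambda>k. M (g k)) ?i ?j = (\<Sum>h\<in>{h0}. \<Prod>k<d. M (g k) (h k) (h (Suc k)))"
      unfolding path_sum_def
    proof (rule sum.mono_neutral_right[OF finH])
      show "{h0} \<subseteq> ?H" using h0 by simp
      show "\<forall>h\<in>?H - {h0}. (\<Prod>k<d. M (g k) (h k) (h (Suc k))) = 0" using nz[OF that] by blast
    qed
    also have "\<dots> = (\<Prod>k<d. c k)"
      by (simp, intro prod.cong refl) (use xI half in \<open>auto simp: True g0_def h0_def M(3)\<close>)
    finally show ?thesis using True by simp
  next
    case False
    then have "\<forall>h\<in>?H. (\<Prod>k<d. M (g k) (h k) (h (Suc k))) = 0" using nz[OF that] by blast
    then have "path_sum I d (\<lambda>k. M (g k)) ?i ?j = 0" unfolding path_sum_def by (rule sum.neutral)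
    then show ?thesis using False by simp
  qed
  have "map (\<lambda>k. w ! g0 k) [0..<d] = map ((!) w) [0..<d]"
    by (rule map_cong) (simp_all add: g0_def)
  then have "map (\<lambda>k. w ! g0 k) [0..<d] = w"
    unfolding d_def map_nth .
  then have coeff: "of_int (Poly_Mapping.lookup f (Word (map (\<lambda>k. w ! g0 k) [0..<d]))) = (1 :: 'c)"
    by (simp only: w of_int_1)
  have "(\<Sum>g\<in>?T. of_int (Poly_Mapping.lookup f (Word (map (\<lambda>k. w ! g k) [0..<d]))) *
     path_sum I d (\<lambda>k. M (g k)) ?i ?j) = (\<Sum>g\<in>?T. if g = g0 then \<Prod>k<d. c k else 0)"
  proof (rule sum.cong[OF refl])
    fix g assume g: "g \<in> ?T"
    show "of_int (Poly_Mapping.lookup f (Word (map (\<lambda>k. w ! g k) [0..<d]))) *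
     path_sum I d (\<lambda>k. M (g k)) ?i ?j = (if g = g0 then \<Prod>k<d. c k else 0)"
    proof (cases "g = g0")
      case True
      show ?thesis unfolding path[OF g] unfolding True coeff by simp
    next
      case False
      then show ?thesis unfolding path[OF g] by simp
    qed
  qed
  also have "\<dots> = (\<Prod>k<d. c k)" using g0 finT by (simp add: sum.delta)
  finally have "(\<Prod>k<d. c k) = 0"
    using multilinear_identity_span[OF f w(1)[symmetric] _ ij, of M, folded d_def] M(1) by simp
  then show False using M(2) by auto
qed

lemma PI_degree_eq_card: "PI_degree R = card I"
proof -
  have "min_PI_degree R = 2 * card I"
    unfolding min_PI_degree_def
    by (rule Least_equality)
      (use nc_monic_std_poly nc_degree_std_poly polynomial_identity_std_poly nc_degree_identity_ge in blast)+
  then show ?thesis by (auto simp: PI_degree_def)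
qed

lemma PI_ring: "PI_ring R"
  unfolding PI_ring_def using ring_axioms nc_monic_std_poly polynomial_identity_std_poly by blast

text \<open>If \<open>a r b = 0\<close> for all \<open>r\<close> in the ring, the same holds for all
  matrices of the span in place of \<open>r\<close>. For nonzero entries of \<open>a\<close> at
  \<open>(i, j)\<close> and of \<open>b\<close> at \<open>(k, l)\<close>, a multiple
  \<open>c\<close> of the unit at \<open>(j, k)\<close> gives
  \<open>\<Theta> a i j * c * \<Theta> b k l = 0\<close>, which is impossible in a domain.\<close>

lemma prime_ring: "prime_ring R"
  unfolding prime_ring_def
proof (intro conjI allI impI)
  show "carrier R \<noteq> {\<zero>}"
  proof
    assume "carrier R = {\<zero>}"
    then have "\<one> = \<zero>" using one_closed by auto
    moreover obtain i where "i \<in> I" using nonempty_I by auto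
    ultimately show False using \<Theta>_one[of i i] \<Theta>_zero[of i i] by simp
  qed
  fix J K assume J: "ideal J R" and K: "ideal K R" and JK: "\<forall>a\<in>J. \<forall>b\<in>K. a \<otimes> b = \<zero>"
  show "J = {\<zero>} \<or> K = {\<zero>}"
  proof (rule ccontr)
    assume "\<not> (J = {\<zero>} \<or> K = {\<zero>})"
    moreover have "\<zero> \<in> J" "\<zero> \<in> K" using J K by (auto intro: additive_subgroup.zero_closed ideal.axioms(1))
    ultimately obtain a b where ab: "a \<in> J" "b \<in> K" "a \<noteq> \<zero>" "b \<noteq> \<zero>" by auto
    have carr: "a \<in> carrier R" "b \<in> carrier R" using ab J K by (auto intro: ideal.Icarr)
    obtain i j where i: "i \<in> I" "j \<in> I" "\<Theta> a i j \<noteq> 0" using \<Theta>_inj[OF carr(1)] ab by auto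
    obtain k l where k: "k \<in> I" "l \<in> I" "\<Theta> b k l \<noteq> 0" using \<Theta>_inj[OF carr(2)] ab by auto
    have zero: "(\<Sum>q\<in>I. (\<Sum>p\<in>I. \<Theta> a i p * M p q) * \<Theta> b q l) = 0" if "M \<in> mat_span (\<Theta> ` carrier R)" for M
      using that
    proof induction
      case (base M)
      then obtain r where r: "r \<in> carrier R" "M = \<Theta> r" by auto
      have "a \<otimes> r \<in> J" using J ab r by (auto intro: ideal.I_r_closed)
      then have "(a \<otimes> r) \<otimes> b = \<zero>" using JK ab by blast
      then have "\<Theta> ((a \<otimes> r) \<otimes> b) i l = 0" using i k by (simp add: \<Theta>_zero)
      then show ?case using i k r carr by (simp add: \<Theta>_mult)
    next
      case (lin M N x y)
      have "(\<Sum>q\<in>I. (\<Sum>p\<in>I. \<Theta> a i p * (x * M p q + y * N p q)) * \<Theta> b q l) =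
         x * (\<Sum>q\<in>I. (\<Sum>p\<in>I. \<Theta> a i p * M p q) * \<Theta> b q l) + y * (\<Sum>q\<in>I. (\<Sum>p\<in>I. \<Theta> a i p * N p q) * \<Theta> b q l)"
        by (simp add: algebra_simps sum.distrib sum_distrib_left sum_distrib_right)
      then show ?case using lin by simp
    qed
    obtain M c where M: "M \<in> mat_span (\<Theta> ` carrier R)" "c \<noteq> 0"
        "\<And>p q. p \<in> I \<Longrightarrow> q \<in> I \<Longrightarrow> M p q = (if p = j \<and> q = k then c else 0)"
      using spanning[OF i(2) k(1)] by blast
    have "(\<Sum>q\<in>I. (\<Sum>p\<in>I. \<Theta> a i p * M p q) * \<Theta> b q l) = (\<Sum>q\<in>I. if q = k then \<Theta> a i j * c * \<Theta> b q l else 0)"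
    proof (intro sum.cong refl)
      fix q assume q: "q \<in> I"
      have "(\<Sum>p\<in>I. \<Theta> a i p * M p q) = (\<Sum>p\<in>I. if p = j then (if q = k then \<Theta> a i j * c else 0) else 0)"
        by (intro sum.cong refl) (use q in \<open>auto simp: M(3)\<close>)
      then show "(\<Sum>p\<in>I. \<Theta> a i p * M p q) * \<Theta> b q l = (if q = k then \<Theta> a i j * c * \<Theta> b q l else 0)"
        using i finite_I by simp
    qed
    also have "\<dots> = \<Theta> a i j * c * \<Theta> b k l" using k finite_I by simp
    finally show False using zero[OF M(1)] M(2) i k by simp
  qed
qed (rule ring_axioms)

end

subsection \<open>A representation on functions of two integer variables\<close>

type_synonym 'k laurent = "int poly \<Rightarrow>\<^sub>0 'k"

type_synonym 'k vec = "int \<Rightarrow> int \<Rightarrow> 'k laurent"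

text \<open>Exponent vectors of Laurent monomials are encoded as integer polynomials, whose order is
  lexicographic with the last coefficient most significant.\<close>

definition lm :: "'k::field \<Rightarrow> int \<Rightarrow> int \<Rightarrow> int \<Rightarrow> int \<Rightarrow> int \<Rightarrow> int \<Rightarrow> 'k laurent"
  where "lm q x k t u z n = Poly_Mapping.single [:x, k, t, u, z:] (q powi n)"

definition lc :: "'k::field \<Rightarrow> 'k laurent"
  where "lc c = Poly_Mapping.single 0 c"

text \<open>The formulas solve for \<open>Y\<close>, \<open>E\<close>, \<open>F\<close> in \<open>t = Y X K\<close>, \<open>u X = \<phi>\<close>, \<open>Z = \<phi> \<psi> + q t\<close>, where \<open>X\<close> and
  \<open>u\<close> shift the first and the second variable and \<open>K\<close>, \<open>t\<close> multiply by \<open>q\<^sup>a\<close>, \<open>q\<^sup>2\<^sup>b\<close>, each scaled by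
  an indeterminate; the arguments of \<^const>\<open>lm\<close> are the exponents of the indeterminates of
  \<open>X, K, t, u, Z\<close> and of \<open>q\<close>.\<close>

fun gen_act :: "'k::field \<Rightarrow> gens \<Rightarrow> 'k vec \<Rightarrow> 'k vec"
  where
    "gen_act q gX v a b = lm q 1 0 0 0 0 0 * v (a - 1) b"
  | "gen_act q gY v a b = lm q (-1) (-1) 1 0 0 (2 * b - a) * v (a + 1) b"
  | "gen_act q gK v a b = lm q 0 1 0 0 0 a * v a b"
  | "gen_act q gKi v a b = lm q 0 (-1) 0 0 0 (- a) * v a b"
  | "gen_act q gE v a b = lc (1 / (1 - q\<^sup>2)) * lm q 2 1 (-1) 0 0 (a - 2 * b) *
       (lm q 0 0 0 1 0 0 * v (a - 2) (b - 1) - v (a - 2) b)"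
  | "gen_act q gF v a b = lc (1 / (1 - q\<^sup>2)) *
       ((lm q (-2) 0 0 (-1) 1 0 - lm q (-2) 0 1 (-1) 0 (2 * b + 3)) * v (a + 2) (b + 1) +
        lm q (-2) (-2) 1 0 0 (2 * b - 2 * a - 1) * v (a + 2) b)"

definition word_act :: "'k::field \<Rightarrow> gens word \<Rightarrow> 'k vec \<Rightarrow> 'k vec"
  where "word_act q w v = foldr (gen_act q) (letters w) v"

definition act :: "'k::field \<Rightarrow> (gens, 'k) free_alg \<Rightarrow> 'k vec \<Rightarrow> 'k vec"
  where "act q x v a b =
    (\<Sum>w\<in>Poly_Mapping.keys x. lc (Poly_Mapping.lookup x w) * word_act q w v a b)"

section \<open>Laurent monomials, linearity and multiplicativity of the action\<close>

lemma lc_0: "lc 0 = 0" and lc_1: "lc 1 = 1"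
  and lc_add: "lc (c + d) = lc c + lc d"
  and lc_mult: "lc (c * d) = lc c * lc d"
  and lc_uminus: "lc (- c) = - lc c"
  by (simp_all add: lc_def single_add mult_single single_uminus)

lemma lm_mult:
  "q \<noteq> 0 \<Longrightarrow> lm q x k t u z n * lm q x' k' t' u' z' n' =
    lm q (x + x') (k + k') (t + t') (u + u') (z + z') (n + n')"
  by (simp add: lm_def mult_single power_int_add)

lemma lm_mult_left:
  "q \<noteq> 0 \<Longrightarrow> lm q x k t u z n * (lm q x' k' t' u' z' n' * y) =
    lm q (x + x') (k + k') (t + t') (u + u') (z + z') (n + n') * y"
  by (simp add: lm_mult mult.assoc[symmetric])

lemma lm_mult_mid:
  "q \<noteq> 0 \<Longrightarrow> lm q x k t u z n * (y * lm q x' k' t' u' z' n') =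
    lm q (x + x') (k + k') (t + t') (u + u') (z + z') (n + n') * y"
  by (simp add: lm_mult mult.assoc[symmetric] mult.commute[of y])

definition lin_op :: "('k::field vec \<Rightarrow> 'k vec) \<Rightarrow> bool"
  where "lin_op T \<longleftrightarrow> (\<forall>c d u v a b. T (\<lambda>a b. c * u a b + d * v a b) a b = c * T u a b + d * T v a b)"

lemma lin_opD:
  assumes "lin_op T"
  shows "T (\<lambda>a b. c * u a b + d * v a b) a b = c * T u a b + d * T v a b"
    "T (\<lambda>a b. c * u a b) a b = c * T u a b"
    "T (\<lambda>a b. u a b + v a b) a b = T u a b + T v a b"
    "T (\<lambda>a b. 0) a b = 0"
  using assms[unfolded lin_op_def, rule_format, of c u d v a b]
    assms[unfolded lin_op_def, rule_format, of c u 0 u a b]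
    assms[unfolded lin_op_def, rule_format, of 1 u 1 v a b]
    assms[unfolded lin_op_def, rule_format, of 0 u 0 u a b]
  by simp_all

lemma lin_op_sum:
  assumes "lin_op T" "finite S"
  shows "T (\<lambda>a b. \<Sum>i\<in>S. f i * u i a b) a b = (\<Sum>i\<in>S. f i * T (u i) a b)"
  using assms(2)
proof (induction S rule: finite_induct)
  case (insert x S)
  show ?case
    using insert lin_opD(1)[OF assms(1), of "f x" "u x" 1 "\<lambda>a b. \<Sum>i\<in>S. f i * u i a b" a b] by simp
qed (simp add: lin_opD(4)[OF assms(1)])

lemma lin_op_gen_act: "lin_op (gen_act q g)"
  unfolding lin_op_def by (cases g) (simp_all add: algebra_simps)

lemma lin_op_word_act: "lin_op (word_act q w)"
proof -
  have "lin_op (foldr (gen_act q) ws)" for ws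
  proof (induction ws)
    case (Cons g ws)
    have "foldr (gen_act q) ws (\<lambda>a b. c * u a b + d * v a b) =
        (\<lambda>a b. c * foldr (gen_act q) ws u a b + d * foldr (gen_act q) ws v a b)" for c d u v
      using Cons by (intro ext) (simp add: lin_op_def)
    then show ?case using lin_op_gen_act[of q g] by (simp add: lin_op_def)
  qed (simp add: lin_op_def)
  then show ?thesis unfolding word_act_def[abs_def] .
qed

lemma lin_op_act: "lin_op (act q x)"
  unfolding lin_op_def act_def
  by (simp add: lin_opD(1)[OF lin_op_word_act] algebra_simps sum.distrib sum_distrib_left)

lemma act_superset:
  assumes "finite S" "Poly_Mapping.keys x \<subseteq> S"
  shows "act q x v a b = (\<Sum>w\<in>S. lc (Poly_Mapping.lookup x w) * word_act q w v a b)"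
  unfolding act_def using assms by (intro sum.mono_neutral_left) (auto simp: in_keys_iff lc_0)

lemma act_add: "act q (x + y) v a b = act q x v a b + act q y v a b"
proof -
  let ?S = "Poly_Mapping.keys x \<union> Poly_Mapping.keys y"
  have S: "finite ?S" "Poly_Mapping.keys x \<subseteq> ?S" "Poly_Mapping.keys y \<subseteq> ?S" "Poly_Mapping.keys (x + y) \<subseteq> ?S"
    using Poly_Mapping.keys_add[of x y] by auto
  show ?thesis
    by (simp add: act_superset[OF S(1,2)] act_superset[OF S(1,3)] act_superset[OF S(1,4)]
        lookup_add lc_add distrib_right sum.distrib)
qed

lemma act_0: "act q 0 v a b = 0"
  by (simp add: act_def)

lemma act_uminus: "act q (- x) v a b = - act q x v a b"
  using act_add[of q x "- x" v a b] by (simp add: act_0 eq_neg_iff_add_eq_0 add.commute)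

lemma act_diff: "act q (x - y) v a b = act q x v a b - act q y v a b"
  using act_add[of q x "- y" v a b] by (simp add: act_uminus)

lemma act_sum: "act q (\<Sum>i\<in>S. f i) v a b = (\<Sum>i\<in>S. act q (f i) v a b)"
  by (induction S rule: infinite_finite_induct) (simp_all add: act_0 act_add)

lemma act_single: "act q (Poly_Mapping.single w c) v a b = lc c * word_act q w v a b"
  by (subst act_superset[of "{w}"]) auto

lemma free_alg_sum_singles:
  "x = (\<Sum>w\<in>Poly_Mapping.keys x. Poly_Mapping.single w (Poly_Mapping.lookup x w))"
  by (rule poly_mapping_eqI) (simp add: lookup_sum lookup_single when_def in_keys_iff)

lemma act_mult: "act q (x * y) v = act q x (act q y v)"
proof (intro ext)
  fix a b
  have single: "act q (Poly_Mapping.single w c * Poly_Mapping.single w' c') v =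
      (\<lambda>a b. lc c * word_act q w (\<lambda>a b. lc c' * word_act q w' v a b) a b)" for w w' c c'
  proof (intro ext)
    fix a b
    have "word_act q (w + w') v = word_act q w (word_act q w' v)"
      by (simp add: plus_word_def word_act_def)
    then show "act q (Poly_Mapping.single w c * Poly_Mapping.single w' c') v a b =
        lc c * word_act q w (\<lambda>a b. lc c' * word_act q w' v a b) a b"
      unfolding lin_opD(2)[OF lin_op_word_act] by (simp add: mult_single act_single lc_mult mult.assoc)
  qed
  have yv: "act q y v = (\<lambda>a b. \<Sum>w'\<in>Poly_Mapping.keys y. lc (Poly_Mapping.lookup y w') * word_act q w' v a b)"
    by (intro ext) (simp add: act_def)
  have "x * y = (\<Sum>w\<in>Poly_Mapping.keys x. \<Sum>w'\<in>Poly_Mapping.keys y.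
      Poly_Mapping.single w (Poly_Mapping.lookup x w) * Poly_Mapping.single w' (Poly_Mapping.lookup y w'))"
    by (subst free_alg_sum_singles[of x], subst free_alg_sum_singles[of y]) (rule sum_product)
  then have "act q (x * y) v a b = (\<Sum>w\<in>Poly_Mapping.keys x. \<Sum>w'\<in>Poly_Mapping.keys y.
      lc (Poly_Mapping.lookup x w) * word_act q w (\<lambda>a b. lc (Poly_Mapping.lookup y w') * word_act q w' v a b) a b)"
    by (simp add: act_sum single)
  also have "\<dots> = act q x (act q y v) a b"
    unfolding yv by (simp add: act_def lin_op_sum[OF lin_op_word_act] lin_opD(2)[OF lin_op_word_act]
        sum_distrib_left)
  finally show "act q (x * y) v a b = act q x (act q y v) a b" .
qed

lemma act_fgen: "act q (fgen g) v = gen_act q g v"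
  by (intro ext) (simp add: fgen_def act_single word_act_def lc_1)

lemma act_fscal: "act q (fscal c) v a b = lc c * v a b"
  by (simp add: fscal_def act_single word_act_def zero_word_def)

lemma act_1: "act q 1 v a b = v a b"
  using act_fscal[of q 1 v a b] by (simp add: fscal_def lc_1)

lemma act_fscal_mult: "act q (fscal c * x) v a b = lc c * act q x v a b"
  by (simp add: act_mult act_fscal)

lemmas act_simps = act_mult act_fgen act_fscal act_1 act_add act_diff

text \<open>This is \<open>1 / (1 - q^2) = q^2 / (1 - q^2) + 1\<close> multiplied by a monomial. The
  fraction is kept as an opaque constant when the relations are verified, and this rule compares
  terms whose powers of \<open>q\<close> differ by two.\<close>

lemma lc_recursion:
  fixes q :: "'k::field"
  assumes q: "q \<noteq> 0" "q\<^sup>2 \<noteq> 1"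
  shows "lc (1 / (1 - q\<^sup>2)) * lm q x k t u z n =
    lc (1 / (1 - q\<^sup>2)) * lm q x k t u z (n + 2) + lm q x k t u z n"
proof -
  have "1 / (1 - q\<^sup>2) = 1 / (1 - q\<^sup>2) * q\<^sup>2 + 1" using q by (simp add: field_simps)
  then have rec: "lc (1 / (1 - q\<^sup>2)) = lc (1 / (1 - q\<^sup>2)) * lc (q\<^sup>2) + 1"
    unfolding lc_mult[symmetric] lc_1[symmetric] lc_add[symmetric] by (rule arg_cong)
  have shift: "lc (q\<^sup>2) * lm q x k t u z n = lm q x k t u z (n + 2)"
    using q by (simp add: lc_def lm_def mult_single power_int_add mult.commute)
  have "lc (1 / (1 - q\<^sup>2)) * lm q x k t u z n = (lc (1 / (1 - q\<^sup>2)) * lc (q\<^sup>2) + 1) * lm q x k t u z n"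
    by (rule arg_cong[OF rec, of "\<lambda>y. y * lm q x k t u z n"])
  also have "\<dots> = lc (1 / (1 - q\<^sup>2)) * lm q x k t u z (n + 2) + lm q x k t u z n"
    by (simp only: distrib_right mult.assoc shift mult_1)
  finally show ?thesis .
qed

lemma lc_recursion_left:
  fixes q :: "'k::field"
  assumes q: "q \<noteq> 0" "q\<^sup>2 \<noteq> 1"
  shows "lc (1 / (1 - q\<^sup>2)) * (w * lm q x k t u z n) =
    w * lm q x k t u z n + lc (1 / (1 - q\<^sup>2)) * (w * lm q x k t u z (n + 2))"
  using arg_cong[OF lc_recursion[OF q, of x k t u z n], of "(*) w"] by (simp add: algebra_simps)

lemma act_smash_relations:
  fixes q :: "'k::field"
  assumes q: "q \<noteq> 0" "q\<^sup>2 \<noteq> 1" and r: "r \<in> smash_relations q"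
  shows "act q r v a b = 0"
proof -
  define B where "B = lc (1 / (1 - q\<^sup>2))"
  have lcq: "lc q = lm q 0 0 0 0 0 1" "lc (q\<^sup>2) = lm q 0 0 0 0 0 2"
    "lc (inverse q) = lm q 0 0 0 0 0 (-1)" "lc (inverse (q\<^sup>2)) = lm q 0 0 0 0 0 (-2)"
    using q by (simp_all add: lc_def lm_def power_int_minus)
  note Blm = lc_recursion[OF q, folded B_def]
  note Blm_left = lc_recursion_left[OF q, folded B_def]
  \<comment> \<open>The commutator of \<open>E\<close> and \<open>F\<close> has the denominator
    \<open>q - 1/q\<close>. Writing \<open>1 / (q - 1/q) = - q / (1 - q^2)\<close> leaves the single
    constant \<open>B\<close> in all relations.\<close>
  have c: "lc (inverse (q - inverse q)) = - (lm q 0 0 0 0 0 1 * B)"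
  proof -
    have "q - inverse q \<noteq> 0" using q by (simp add: field_simps power2_eq_square)
    then have "inverse (q - inverse q) = - (q * (1 / (1 - q\<^sup>2)))"
      using q by (simp add: field_simps power2_eq_square)
    then show ?thesis unfolding B_def lcq(1)[symmetric] lc_mult[symmetric] lc_uminus[symmetric] by (rule arg_cong)
  qed
  have one: "lm q 0 0 0 0 0 0 = 1" by (simp add: lm_def)
  note nf = act_simps lcq c B_def[symmetric] lm_mult[OF q(1)] lm_mult_left[OF q(1)] lm_mult_mid[OF q(1)]
  \<comment> \<open>The nine relations of the first case hold by adding exponents. The three named
    ones compare terms with different numbers of factors \<open>B\<close> and use the
    recursion.\<close>
  consider "r = fK * fKi - 1 \<or> r = fKi * fK - 1 \<or> r = fK * fE * fKi - fscal (q\<^sup>2) * fE \<or>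
      r = fK * fF * fKi - fscal (inverse (q\<^sup>2)) * fF \<or> r = fE * fX - fscal q * fX * fE \<or>
      r = fF * fY - fY * fF \<or> r = fK * fX * fKi - fscal q * fX \<or> 
      r = fK * fY * fKi - fscal (inverse q) * fY \<or> r = fX * fY - fscal q * fY * fX"
    | (EF) "r = (fE * fF - fF * fE) - fscal (inverse (q - inverse q)) * (fK - fKi)"
    | (EY) "r = fE * fY - (fX + fscal (inverse q) * fY * fE)"
    | (FX) "r = fF * fX - (fY * fKi + fX * fF)"
    using r unfolding smash_relations_def by blast
  then show ?thesis
  proof cases
    case 1
    then show ?thesis
      by (elim disjE; simp add: nf one) (simp_all add: nf algebra_simps)
  next
    case EF
    show ?thesis
      unfolding EF
    proof (simp add: nf algebra_simps, goal_cases)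
      case 1
      \<comment> \<open>The letters \<open>k\<close> and \<open>n\<close> stand for the monomials in
        \<open>K\<close> and in its inverse, the digit for the shift of the exponent of
        \<open>q\<close>. Applying each recursion once under an outer factor \<open>B\<close>
        balances the quadratic terms.\<close>
      have "B * (w * k1) + (B * (B * (w * n1)) + B * (B * (w * k3))) =
        B * (w * n1) + (B * (B * (w * k1)) + B * (B * (w * n3)))"
        if "B * k1 = B * k3 + k1" "B * n1 = B * n3 + n1" for k1 k3 n1 n3 w
      proof -
        have "B * (B * (w * k1)) = B * w * (B * k3 + k1)" "B * (B * (w * n1)) = B * w * (B * n3 + n1)"
          unfolding that[symmetric] by (simp_all add: mult_ac)
        then show ?thesis by (simp add: algebra_simps)
      qed
      from this[OF Blm[of 0 1 0 0 0 "1 + a"] Blm[of 0 "-1" 0 0 0 "1 - a"], of "v a b"]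
      show ?case by (simp add: add.commute)
    qed
  next
    case EY
    show ?thesis
      unfolding EY by (simp add: nf algebra_simps) (simp add: Blm_left[of _ 1 0 0 0 0 0])
  next
    case FX
    show ?thesis
      unfolding FX by (simp add: nf algebra_simps) (subst Blm_left, simp add: algebra_simps)
  qed
qed

text \<open>By the choice of the action of \<open>E\<close> the denominators cancel and only the
  monomial \<open>u X\<close> is left. It gives the subalgebra an invertible shift that involves the
  second variable.\<close>

lemma act_phi:
  fixes q :: "'k::field"
  assumes q: "q \<noteq> 0" "q\<^sup>2 \<noteq> 1"
  shows "act q (phi q) v a b = lm q 1 0 0 1 0 0 * v (a - 1) (b - 1)"
proof -
  define B where "B = lc (1 / (1 - q\<^sup>2))"
  have "lc q = lm q 0 0 0 0 0 1" by (simp add: lc_def lm_def)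
  then show ?thesis
    unfolding phi_def
    by (simp add: act_simps lm_mult[OF q(1)] lm_mult_left[OF q(1)] lm_mult_mid[OF q(1)] B_def[symmetric]
        algebra_simps) (simp add: lc_recursion_left[OF q, folded B_def, of _ 1 0 0 1 0 0])
qed

subsection \<open>The smash product is spanned by ordered monomials\<close>

lemma smash_ideal_closed:
  shows smash_ideal_zero: "0 \<in> smash_ideal q"
    and smash_ideal_add: "x \<in> smash_ideal q \<Longrightarrow> y \<in> smash_ideal q \<Longrightarrow> x + y \<in> smash_ideal q"
    and smash_ideal_mult_left: "x \<in> smash_ideal q \<Longrightarrow> y * x \<in> smash_ideal q"
    and smash_ideal_mult_right: "x \<in> smash_ideal q \<Longrightarrow> x * y \<in> smash_ideal q"
    and smash_ideal_uminus: "x \<in> smash_ideal q \<Longrightarrow> - x \<in> smash_ideal q"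
    and smash_ideal_diff: "x \<in> smash_ideal q \<Longrightarrow> y \<in> smash_ideal q \<Longrightarrow> x - y \<in> smash_ideal q"
proof -
  interpret ideal "smash_ideal q" free_alg_ring by (rule ideal_smash_ideal)
  show "0 \<in> smash_ideal q"
    using additive_subgroup.zero_closed[OF additive_subgroup_axioms] by (simp add: free_alg_ring_def)
  show add: "x \<in> smash_ideal q \<Longrightarrow> y \<in> smash_ideal q \<Longrightarrow> x + y \<in> smash_ideal q" for x y
    using additive_subgroup.a_closed[OF additive_subgroup_axioms, of x y] by (simp add: free_alg_ring_def)
  show left: "x \<in> smash_ideal q \<Longrightarrow> y * x \<in> smash_ideal q" for x y
    using I_l_closed[of x y] by (simp add: free_alg_ring_def)
  show "x \<in> smash_ideal q \<Longrightarrow> x * y \<in> smash_ideal q" for x y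
    using I_r_closed[of x y] by (simp add: free_alg_ring_def)
  show um: "x \<in> smash_ideal q \<Longrightarrow> - x \<in> smash_ideal q" for x
    using left[of x "- 1"] by simp
  show "x \<in> smash_ideal q \<Longrightarrow> y \<in> smash_ideal q \<Longrightarrow> x - y \<in> smash_ideal q"
    using add[of x "- y"] um by simp
qed

lemma smash_relations_subset: "smash_relations q \<subseteq> smash_ideal q"
  unfolding smash_ideal_def by (rule ring.genideal_self[OF ring_free_alg_ring]) (simp add: free_alg_ring_def)

lemma act_smash_ideal:
  assumes q: "q \<noteq> 0" "q\<^sup>2 \<noteq> 1" and x: "x \<in> smash_ideal q"
  shows "act q x v a b = 0"
proof -
  let ?J = "{x. \<forall>v a b. act q x v a b = 0}"
  have zero: "act q y (\<lambda>a b. 0) a b = 0" for y a b by (rule lin_opD(4)[OF lin_op_act])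
  have "ideal ?J (free_alg_ring :: (gens, 'a) free_alg ring)"
  proof (rule idealI)
    show "subgroup ?J (add_monoid (free_alg_ring :: (gens, 'a) free_alg ring))"
    proof (rule group.subgroupI)
      show "Group.group (add_monoid (free_alg_ring :: (gens, 'a) free_alg ring))"
        using abelian_group.a_group[OF ring.is_abelian_group[OF ring_free_alg_ring]] .
      fix x assume "x \<in> ?J"
      moreover have "m_inv (add_monoid free_alg_ring) x = - x" for x :: "(gens, 'a) free_alg"
        using abelian_group.minus_equality[OF ring.is_abelian_group[OF ring_free_alg_ring], of "- x" x]
        by (simp add: free_alg_ring_def a_inv_def)
      ultimately show "m_inv (add_monoid free_alg_ring) x \<in> ?J" by (simp add: act_uminus)
    next
      show "?J \<noteq> {}" using act_0 by blast
    qed (auto simp: free_alg_ring_def act_add)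
    fix a x :: "(gens, 'a) free_alg" assume a: "a \<in> ?J"
    then have "act q a v = (\<lambda>a b. 0)" for v by (intro ext) simp
    then show "x \<otimes>\<^bsub>free_alg_ring\<^esub> a \<in> ?J" "a \<otimes>\<^bsub>free_alg_ring\<^esub> x \<in> ?J"
      using a by (simp_all add: free_alg_ring_def act_mult zero)
  qed (rule ring_free_alg_ring)
  moreover have "smash_relations q \<subseteq> ?J" using act_smash_relations[OF q] by blast
  ultimately have "smash_ideal q \<subseteq> ?J"
    unfolding smash_ideal_def by (rule ring.genideal_minimal[OF ring_free_alg_ring])
  then show ?thesis using x by blast
qed

definition smash_cong :: "'k::field \<Rightarrow> (gens, 'k) free_alg \<Rightarrow> (gens, 'k) free_alg \<Rightarrow> bool"
  where "smash_cong q x y \<longleftrightarrow> x - y \<in> smash_ideal q"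

lemma smash_cong_refl [simp]: "smash_cong q x x"
  by (simp add: smash_cong_def smash_ideal_zero)

lemma smash_cong_sym: "smash_cong q x y \<Longrightarrow> smash_cong q y x"
  unfolding smash_cong_def using smash_ideal_uminus[of "x - y" q] by simp

lemma smash_cong_trans [trans]: "smash_cong q x y \<Longrightarrow> smash_cong q y z \<Longrightarrow> smash_cong q x z"
  unfolding smash_cong_def using smash_ideal_add[of "x - y" q "y - z"] by simp

lemma smash_cong_add: "smash_cong q x y \<Longrightarrow> smash_cong q x' y' \<Longrightarrow> smash_cong q (x + x') (y + y')"
  unfolding smash_cong_def using smash_ideal_add[of "x - y" q "x' - y'"] by (simp add: algebra_simps)

lemma smash_cong_left: "smash_cong q x y \<Longrightarrow> smash_cong q (z * x) (z * y)"
  unfolding smash_cong_def using smash_ideal_mult_left[of "x - y" q z] by (simp add: algebra_simps)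

lemma smash_cong_right: "smash_cong q x y \<Longrightarrow> smash_cong q (x * z) (y * z)"
  unfolding smash_cong_def using smash_ideal_mult_right[of "x - y" q z] by (simp add: algebra_simps)

lemma fscal_mult: "fscal (c * d) = fscal c * fscal d"
  by (simp add: fscal_def mult_single)

lemma fscal_1 [simp]: "fscal 1 = 1"
  by (simp add: fscal_def)

lemma fscal_0 [simp]: "fscal 0 = 0"
  by (simp add: fscal_def)

lemma fscal_add: "fscal (c + d) = fscal c + fscal d"
  by (simp add: fscal_def single_add)

lemma fscal_comm:
  fixes c :: "'k::field"
  shows "x * fscal c = fscal c * x"
proof -
  have "(\<Sum>w\<in>Poly_Mapping.keys x. Poly_Mapping.single w (Poly_Mapping.lookup x w)) * fscal c =
      fscal c * (\<Sum>w\<in>Poly_Mapping.keys x. Poly_Mapping.single w (Poly_Mapping.lookup x w))"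
    by (simp add: sum_distrib_left sum_distrib_right fscal_def mult_single mult.commute)
  then show ?thesis by (simp only: free_alg_sum_singles[symmetric])
qed

lemma fscal_left_comm:
  fixes c :: "'k::field"
  shows "x * (fscal c * y) = fscal c * (x * y)"
  by (metis fscal_comm mult.assoc)

lemma smash_cong_relation: "x - y \<in> smash_relations q \<Longrightarrow> smash_cong q x y"
  using smash_relations_subset[of q] unfolding smash_cong_def by blast

lemma smash_rels:
  shows rel_KKi: "smash_cong q (fK * fKi) 1" and rel_KiK: "smash_cong q (fKi * fK) 1"
    and rel_KE: "smash_cong q (fK * fE * fKi) (fscal (q\<^sup>2) * fE)"
    and rel_KF: "smash_cong q (fK * fF * fKi) (fscal (inverse (q\<^sup>2)) * fF)"
    and rel_EF: "smash_cong q (fE * fF) (fF * fE + fscal (inverse (q - inverse q)) * (fK - fKi))"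
    and rel_EX: "smash_cong q (fE * fX) (fscal q * fX * fE)"
    and rel_EY: "smash_cong q (fE * fY) (fX + fscal (inverse q) * fY * fE)"
    and rel_FX: "smash_cong q (fF * fX) (fY * fKi + fX * fF)"
    and rel_FY: "smash_cong q (fF * fY) (fY * fF)"
    and rel_KX: "smash_cong q (fK * fX * fKi) (fscal q * fX)"
    and rel_KY: "smash_cong q (fK * fY * fKi) (fscal (inverse q) * fY)"
    and rel_XY: "smash_cong q (fX * fY) (fscal q * fY * fX)"
proof -
  have "fE * fF - fF * fE - fscal (inverse (q - inverse q)) * (fK - fKi) \<in> smash_relations q"
    unfolding smash_relations_def by (rule insertI1 | rule insertI2)+
  then show "smash_cong q (fE * fF) (fF * fE + fscal (inverse (q - inverse q)) * (fK - fKi))"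
    by (intro smash_cong_relation) (simp only: diff_diff_eq)
qed (rule smash_cong_relation, unfold smash_relations_def, (rule insertI1 | rule insertI2)+)+

lemma skew_comm:
  fixes q :: "'k::field"
  assumes "smash_cong q (fK * g * fKi) (fscal c * g)" "c \<noteq> 0"
  shows "smash_cong q (fK * g) (fscal c * (g * fK))" "smash_cong q (fKi * g) (fscal (inverse c) * (g * fKi))"
proof -
  have "smash_cong q (fK * g * 1) (fK * g * (fKi * fK))"
    by (intro smash_cong_left smash_cong_sym[OF rel_KiK])
  also have "fK * g * (fKi * fK) = fK * g * fKi * fK" by (simp add: mult.assoc)
  also have "smash_cong q (fK * g * fKi * fK) (fscal c * g * fK)" by (intro smash_cong_right assms)
  finally show "smash_cong q (fK * g) (fscal c * (g * fK))" by (simp add: mult.assoc)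
  have "g = fscal (inverse c) * (fscal c * g)"
    using assms(2) by (simp add: mult.assoc[symmetric] fscal_mult[symmetric])
  then have "fKi * g = fscal (inverse c) * (fKi * (fscal c * g))" by (metis fscal_left_comm)
  also have "smash_cong q \<dots> (fscal (inverse c) * (fKi * (fK * g * fKi)))"
    by (intro smash_cong_left smash_cong_sym[OF assms(1)])
  also have "fscal (inverse c) * (fKi * (fK * g * fKi)) = fscal (inverse c) * ((fKi * fK) * (g * fKi))"
    by (simp add: mult.assoc)
  also have "smash_cong q \<dots> (fscal (inverse c) * (1 * (g * fKi)))"
    by (intro smash_cong_left smash_cong_right rel_KiK)
  finally show "smash_cong q (fKi * g) (fscal (inverse c) * (g * fKi))" by simp
qed

lemma skew_power:
  fixes q :: "'k::field"
  assumes "smash_cong q (h * g) (fscal c * (g * h))"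
  shows "smash_cong q (h * g ^ n) (fscal (c ^ n) * (g ^ n * h))"
proof (induction n)
  case (Suc n)
  have "h * g ^ Suc n = h * g * g ^ n" by (simp add: mult.assoc)
  also have "smash_cong q \<dots> (fscal c * (g * h) * g ^ n)" by (intro smash_cong_right assms)
  also have "fscal c * (g * h) * g ^ n = fscal c * (g * (h * g ^ n))" by (simp add: mult.assoc)
  also have "smash_cong q \<dots> (fscal c * (g * (fscal (c ^ n) * (g ^ n * h))))"
    by (intro smash_cong_left Suc)
  also have "\<dots> = fscal (c ^ Suc n) * (g ^ Suc n * h)"
    by (simp only: fscal_left_comm[of g] fscal_mult power_Suc mult.assoc)
  finally show ?case .
qed simp

definition kpow :: "int \<Rightarrow> (gens, 'k::field) free_alg"
  where "kpow k = (if k \<ge> 0 then fK ^ nat k else fKi ^ nat (- k))"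

lemma kpow_step:
  fixes q :: "'k::field"
  shows "smash_cong q (fK * kpow k) (kpow (k + 1))" "smash_cong q (fKi * kpow k) (kpow (k - 1))"
proof -
  show "smash_cong q (fK * kpow k) (kpow (k + 1))"
  proof (cases "k \<ge> 0")
    case True
    then show ?thesis by (simp add: kpow_def nat_add_distrib)
  next
    case False
    define n where "n = nat (- k - 1)"
    have n: "nat (- k) = Suc n" "nat (- (k + 1)) = n" using False by (auto simp: n_def)
    have "smash_cong q (fK * fKi * fKi ^ n) (1 * fKi ^ n)" by (intro smash_cong_right rel_KKi)
    moreover have "kpow (k + 1) = (fKi ^ n :: (gens, 'k) free_alg)"
      using False n by (cases "k + 1 = 0") (auto simp: kpow_def)
    moreover have "kpow k = (fKi * fKi ^ n :: (gens, 'k) free_alg)" using False n by (simp add: kpow_def)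
    ultimately show ?thesis by (simp add: mult.assoc)
  qed
  show "smash_cong q (fKi * kpow k) (kpow (k - 1))"
  proof (cases "k > 0")
    case True
    define n where "n = nat (k - 1)"
    have n: "nat k = Suc n" "nat (k - 1) = n" using True by (auto simp: n_def)
    have "smash_cong q (fKi * fK * fK ^ n) (1 * fK ^ n)" by (intro smash_cong_right rel_KiK)
    then show ?thesis using True n by (simp add: kpow_def mult.assoc)
  next
    case False
    then have "nat (- (k - 1)) = Suc (nat (- k))" by auto
    then show ?thesis using False by (auto simp: kpow_def)
  qed
qed

text \<open>Including the ideal makes this the preimage of a span in the quotient, so that congruent
  elements may be exchanged.\<close>

inductive_set smash_span :: "'k::field \<Rightarrow> (gens, 'k) free_alg set \<Rightarrow> (gens, 'k) free_alg set"
  for q G where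
    ideal: "x \<in> smash_ideal q \<Longrightarrow> x \<in> smash_span q G"
  | base: "x \<in> G \<Longrightarrow> x \<in> smash_span q G"
  | add: "x \<in> smash_span q G \<Longrightarrow> y \<in> smash_span q G \<Longrightarrow> x + y \<in> smash_span q G"
  | scale: "x \<in> smash_span q G \<Longrightarrow> fscal c * x \<in> smash_span q G"

lemma smash_span_cong:
  assumes "smash_cong q x y" "y \<in> smash_span q G"
  shows "x \<in> smash_span q G"
  using smash_span.add[OF smash_span.ideal[of "x - y" q G] assms(2)] assms(1) by (simp add: smash_cong_def)

lemma smash_span_diff:
  assumes "x \<in> smash_span q G" "y \<in> smash_span q G"
  shows "x - y \<in> smash_span q G"
proof -
  have "fscal (- 1) + 1 = (0 :: (gens, 'a) free_alg)" using fscal_add[of "- 1 :: 'a" 1] by simp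
  then have "fscal (- 1) = (- 1 :: (gens, 'a) free_alg)" by (simp add: eq_neg_iff_add_eq_0)
  then show ?thesis using smash_span.add[OF assms(1) smash_span.scale[OF assms(2), of "- 1"]] by simp
qed

lemma smash_span_left:
  assumes "\<And>x. x \<in> G \<Longrightarrow> h * x \<in> smash_span q G'" "y \<in> smash_span q G"
  shows "h * y \<in> smash_span q G'"
  using assms(2)
proof induction
  case (ideal x)
  then show ?case by (intro smash_span.ideal smash_ideal_mult_left)
next
  case (scale x c)
  then show ?case unfolding fscal_left_comm by (intro smash_span.scale)
qed (simp_all add: assms(1) distrib_left smash_span.add)

text \<open>The order \<open>X, Y, F, E, K\<close> is suited to left multiplication: on the way to
  its place a generator meets only generators whose exchange rules produce factors that can be
  treated beforehand.\<close>

definition uq_monomials :: "(gens, 'k::field) free_alg set"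
  where "uq_monomials = {fF ^ s * (fE ^ r * kpow k) | s r k. True}"

definition pbw_monomials :: "(gens, 'k::field) free_alg set"
  where "pbw_monomials = {fX ^ i * (fY ^ j * p) | i j p. p \<in> uq_monomials}"

text \<open>The factor \<open>h\<close> passes the whole power of \<open>g\<close> at the cost of
  the scalar \<open>c ^ n\<close>, so it is enough to know what \<open>h\<close> does behind that
  power.\<close>

lemma smash_span_skew:
  assumes g: "smash_cong q (h * g) (fscal c * (g * h))" and y: "g ^ n * (h * y) \<in> smash_span q G"
  shows "h * (g ^ n * y) \<in> smash_span q G"
proof -
  have "smash_cong q (h * g ^ n * y) (fscal (c ^ n) * (g ^ n * h) * y)"
    by (intro smash_cong_right skew_power g)
  then have "smash_cong q (h * (g ^ n * y)) (fscal (c ^ n) * (g ^ n * (h * y)))"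
    by (simp add: mult.assoc)
  then show ?thesis by (rule smash_span_cong) (intro smash_span.scale y)
qed

context
  fixes q :: "'k::field"
  assumes q: "q \<noteq> 0"
begin

lemma K_skew:
  "h \<in> {fK, fKi} \<Longrightarrow> g \<in> {fE, fF, fX, fY} \<Longrightarrow> \<exists>c. smash_cong q (h * g) (fscal c * (g * h))"
  using skew_comm[OF rel_KE[of q]] skew_comm[OF rel_KF[of q]] skew_comm[OF rel_KX[of q]]
    skew_comm[OF rel_KY[of q]] q by auto

lemma uq_span_K:
  assumes h: "h \<in> {fK, fKi}" and y: "y \<in> smash_span q uq_monomials"
  shows "h * y \<in> smash_span q uq_monomials"
proof (rule smash_span_left[OF _ y])
  fix x :: "(gens, 'k) free_alg" assume "x \<in> uq_monomials"
  then obtain s r k where x: "x = fF ^ s * (fE ^ r * kpow k)" by (auto simp: uq_monomials_def)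
  obtain c where c: "smash_cong q (h * fF) (fscal c * (fF * h))" using K_skew[OF h, of fF] by auto
  obtain d where d: "smash_cong q (h * fE) (fscal d * (fE * h))" using K_skew[OF h, of fE] by auto
  obtain k' where k': "smash_cong q (h * kpow k) (kpow k')" using kpow_step h by blast
  have "smash_cong q (h * fE ^ r * kpow k) (fscal (d ^ r) * (fE ^ r * h) * kpow k)"
    by (intro smash_cong_right skew_power d)
  also have "fscal (d ^ r) * (fE ^ r * h) * kpow k = fscal (d ^ r) * (fE ^ r * (h * kpow k))"
    by (simp add: mult.assoc)
  also have "smash_cong q \<dots> (fscal (d ^ r) * (fE ^ r * kpow k'))" by (intro smash_cong_left k')
  finally have "smash_cong q (fF ^ s * (h * (fE ^ r * kpow k))) (fF ^ s * (fscal (d ^ r) * (fE ^ r * kpow k')))"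
    by (intro smash_cong_left) (simp add: mult.assoc)
  then have "fF ^ s * (h * (fE ^ r * kpow k)) \<in> smash_span q uq_monomials"
    by (rule smash_span_cong)
      (unfold fscal_left_comm, intro smash_span.scale smash_span.base, auto simp: uq_monomials_def)
  then show "h * x \<in> smash_span q uq_monomials" unfolding x by (rule smash_span_skew[OF c])
qed

lemma uq_span_F:
  assumes y: "y \<in> smash_span q uq_monomials"
  shows "fF * y \<in> smash_span q uq_monomials"
proof (rule smash_span_left[OF _ y])
  fix x :: "(gens, 'k) free_alg" assume "x \<in> uq_monomials"
  then obtain s r k where x: "x = fF ^ s * (fE ^ r * kpow k)" by (auto simp: uq_monomials_def)
  have "fF * x = fF ^ Suc s * (fE ^ r * kpow k)" by (simp add: x mult.assoc)
  then have "fF * x \<in> uq_monomials" unfolding uq_monomials_def by blast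
  then show "fF * x \<in> smash_span q uq_monomials" by (rule smash_span.base)
qed

text \<open>Each exchange of \<open>E\<close> with a factor \<open>F\<close> leaves a combination of
  \<open>K\<close> and its inverse, under which the span is already stable; the induction is on the
  power of \<open>F\<close>.\<close>

lemma uq_span_E:
  assumes y: "y \<in> smash_span q uq_monomials"
  shows "fE * y \<in> smash_span q uq_monomials"
proof (rule smash_span_left[OF _ y])
  fix x :: "(gens, 'k) free_alg" assume "x \<in> uq_monomials"
  then obtain s r k where x: "x = fF ^ s * (fE ^ r * kpow k)" by (auto simp: uq_monomials_def)
  have "fE * (fF ^ s * (fE ^ r * kpow k)) \<in> smash_span q uq_monomials"
  proof (induction s)
    case 0
    have "fE * (fE ^ r * kpow k) = fF ^ 0 * (fE ^ Suc r * kpow k)" by (simp add: mult.assoc)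
    then have "fE * (fE ^ r * kpow k) \<in> uq_monomials" unfolding uq_monomials_def by blast
    then have "fE * (fE ^ r * kpow k) \<in> smash_span q uq_monomials" by (rule smash_span.base)
    then show ?case by simp
  next
    case (Suc s)
    let ?w = "fF ^ s * (fE ^ r * kpow k)"
    have w: "?w \<in> smash_span q uq_monomials" by (intro smash_span.base) (auto simp: uq_monomials_def)
    have "smash_cong q (fE * fF * ?w) ((fF * fE + fscal (inverse (q - inverse q)) * (fK - fKi)) * ?w)"
      by (intro smash_cong_right rel_EF)
    then have "smash_cong q (fE * (fF ^ Suc s * (fE ^ r * kpow k)))
        (fF * (fE * ?w) + fscal (inverse (q - inverse q)) * (fK * ?w - fKi * ?w))"
      by (simp add: mult.assoc distrib_right left_diff_distrib right_diff_distrib)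
    then show ?case
      by (rule smash_span_cong)
        (intro smash_span.add smash_span.scale smash_span_diff uq_span_F uq_span_K Suc w; simp)
  qed
  then show "fE * x \<in> smash_span q uq_monomials" unfolding x .
qed

lemma pbw_spanI:
  assumes "p \<in> smash_span q uq_monomials"
  shows "fX ^ i * (fY ^ j * p) \<in> smash_span q pbw_monomials"
  unfolding mult.assoc[symmetric]
  by (rule smash_span_left[OF _ assms], rule smash_span.base) (auto simp: pbw_monomials_def mult.assoc)

lemma pbw_span_left:
  assumes "y \<in> smash_span q pbw_monomials"
    and "\<And>i j p. p \<in> smash_span q uq_monomials \<Longrightarrow> h * (fX ^ i * (fY ^ j * p)) \<in> smash_span q pbw_monomials"
  shows "h * y \<in> smash_span q pbw_monomials"
proof (rule smash_span_left[OF _ assms(1)])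
  fix x :: "(gens, 'k) free_alg" assume "x \<in> pbw_monomials"
  then obtain i j p where "x = fX ^ i * (fY ^ j * p)" "p \<in> uq_monomials"
    by (auto simp: pbw_monomials_def)
  then show "h * x \<in> smash_span q pbw_monomials" by (simp add: assms(2) smash_span.base)
qed

lemma pbw_span_X:
  assumes y: "y \<in> smash_span q pbw_monomials"
  shows "fX * y \<in> smash_span q pbw_monomials"
proof (rule pbw_span_left[OF y])
  fix i j and p :: "(gens, 'k) free_alg" assume "p \<in> smash_span q uq_monomials"
  from pbw_spanI[OF this, of "Suc i" j]
  show "fX * (fX ^ i * (fY ^ j * p)) \<in> smash_span q pbw_monomials" by (simp add: mult.assoc)
qed

lemma pbw_span_X_power:
  "y \<in> smash_span q pbw_monomials \<Longrightarrow> fX ^ i * y \<in> smash_span q pbw_monomials"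
  by (induction i) (simp_all add: pbw_span_X mult.assoc)

lemma pbw_span_Y:
  assumes y: "y \<in> smash_span q pbw_monomials"
  shows "fY * y \<in> smash_span q pbw_monomials"
proof (rule pbw_span_left[OF y])
  fix i j and p :: "(gens, 'k) free_alg" assume p: "p \<in> smash_span q uq_monomials"
  have "fscal (inverse q) * (fscal q * (fY * fX)) = fY * fX"
    using q by (simp add: mult.assoc[symmetric] fscal_mult[symmetric])
  then have "smash_cong q (fY * fX) (fscal (inverse q) * (fX * fY))"
    using smash_cong_sym[OF smash_cong_left[OF rel_XY[of q], of "fscal (inverse q)"]] by (simp add: mult.assoc)
  then show "fY * (fX ^ i * (fY ^ j * p)) \<in> smash_span q pbw_monomials"
  proof (rule smash_span_skew)
    show "fX ^ i * (fY * (fY ^ j * p)) \<in> smash_span q pbw_monomials"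
      using pbw_spanI[OF p, of i "Suc j"] by (simp add: mult.assoc)
  qed
qed

lemma pbw_span_K:
  assumes h: "h \<in> {fK, fKi}" and y: "y \<in> smash_span q pbw_monomials"
  shows "h * y \<in> smash_span q pbw_monomials"
proof (rule pbw_span_left[OF y])
  fix i j and p :: "(gens, 'k) free_alg" assume p: "p \<in> smash_span q uq_monomials"
  obtain c where c: "smash_cong q (h * fX) (fscal c * (fX * h))" using K_skew[OF h, of fX] by auto
  obtain d where d: "smash_cong q (h * fY) (fscal d * (fY * h))" using K_skew[OF h, of fY] by auto
  have "h * (fY ^ j * p) \<in> smash_span q pbw_monomials"
    by (rule smash_span_skew[OF d]) (use pbw_spanI[OF uq_span_K[OF h p], of 0 j] in simp)
  then have "fX ^ i * (h * (fY ^ j * p)) \<in> smash_span q pbw_monomials" by (rule pbw_span_X_power)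
  then show "h * (fX ^ i * (fY ^ j * p)) \<in> smash_span q pbw_monomials" by (rule smash_span_skew[OF c])
qed

text \<open>The generator \<open>F\<close> commutes with \<open>Y\<close>, but past each
  \<open>X\<close> it leaves \<open>Y K^-1\<close>. Stability under \<open>X\<close>,
  \<open>Y\<close> and \<open>K^-1\<close> therefore comes before this lemma.\<close>

lemma pbw_span_F:
  assumes y: "y \<in> smash_span q pbw_monomials"
  shows "fF * y \<in> smash_span q pbw_monomials"
proof (rule pbw_span_left[OF y])
  fix i j and p :: "(gens, 'k) free_alg" assume p: "p \<in> smash_span q uq_monomials"
  show "fF * (fX ^ i * (fY ^ j * p)) \<in> smash_span q pbw_monomials"
  proof (induction i)
    case 0
    have "smash_cong q (fF * fY) (fscal 1 * (fY * fF))" using rel_FY by simp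
    then have "fF * (fY ^ j * p) \<in> smash_span q pbw_monomials"
      by (rule smash_span_skew) (use pbw_spanI[OF uq_span_F[OF p], of 0 j] in simp)
    then show ?case by simp
  next
    case (Suc i)
    let ?w = "fX ^ i * (fY ^ j * p)"
    have "smash_cong q (fF * fX * ?w) ((fY * fKi + fX * fF) * ?w)"
      by (intro smash_cong_right rel_FX)
    then have "smash_cong q (fF * (fX ^ Suc i * (fY ^ j * p))) (fY * (fKi * ?w) + fX * (fF * ?w))"
      by (simp add: mult.assoc distrib_right)
    then show ?case
      by (rule smash_span_cong)
        (intro smash_span.add pbw_span_Y pbw_span_X pbw_span_K Suc pbw_spanI p; simp)
  qed
qed

text \<open>The generator \<open>E\<close> passes all of \<open>X ^ i\<close> up to a scalar; past
  each \<open>Y\<close> it leaves an \<open>X\<close>, and behind the \<open>Y\<close> factors it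
  acts inside the span of the monomials in \<open>F\<close>, \<open>E\<close>,
  \<open>K\<close>.\<close>

lemma pbw_span_E:
  assumes y: "y \<in> smash_span q pbw_monomials"
  shows "fE * y \<in> smash_span q pbw_monomials"
proof (rule pbw_span_left[OF y])
  fix i j and p :: "(gens, 'k) free_alg" assume p: "p \<in> smash_span q uq_monomials"
  have Y: "fE * (fY ^ j * p) \<in> smash_span q pbw_monomials"
  proof (induction j)
    case 0
    show ?case using pbw_spanI[OF uq_span_E[OF p], of 0 0] by simp
  next
    case (Suc j)
    let ?w = "fY ^ j * p"
    have "smash_cong q (fE * fY * ?w) ((fX + fscal (inverse q) * fY * fE) * ?w)"
      by (intro smash_cong_right rel_EY)
    then have "smash_cong q (fE * (fY ^ Suc j * p)) (fX * ?w + fscal (inverse q) * (fY * (fE * ?w)))"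
      by (simp add: mult.assoc distrib_right)
    then show ?case
    proof (rule smash_span_cong)
      have "?w \<in> smash_span q pbw_monomials" using pbw_spanI[OF p, of 0 j] by simp
      then show "fX * ?w + fscal (inverse q) * (fY * (fE * ?w)) \<in> smash_span q pbw_monomials"
        by (intro smash_span.add smash_span.scale pbw_span_Y pbw_span_X Suc)
    qed
  qed
  have "smash_cong q (fE * fX) (fscal q * (fX * fE))" using rel_EX by (simp add: mult.assoc)
  then show "fE * (fX ^ i * (fY ^ j * p)) \<in> smash_span q pbw_monomials"
    by (rule smash_span_skew) (rule pbw_span_X_power[OF Y])
qed

text \<open>The span contains \<open>1\<close> and is stable under left multiplication by every
  generator, hence contains all words.\<close>

lemma pbw_spanning: "x \<in> smash_span q pbw_monomials"
proof -
  have gen: "fgen g * y \<in> smash_span q pbw_monomials" if "y \<in> smash_span q pbw_monomials" for g y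
    using that by (cases g) (simp_all add: pbw_span_X pbw_span_Y pbw_span_E pbw_span_F pbw_span_K)
  have one: "1 \<in> smash_span q pbw_monomials"
  proof -
    have "1 = fF ^ 0 * (fE ^ 0 * kpow 0)" by (simp add: kpow_def)
    then have "(1 :: (gens, 'k) free_alg) \<in> uq_monomials" unfolding uq_monomials_def by blast
    from pbw_spanI[OF smash_span.base[OF this], of 0 0] show ?thesis by simp
  qed
  have word: "Poly_Mapping.single (Word ws) 1 \<in> smash_span q pbw_monomials" for ws
  proof (induction ws)
    case Nil
    then show ?case using one by (simp add: single_one[symmetric] zero_word_def del: single_one)
  next
    case (Cons g ws)
    have "Poly_Mapping.single (Word (g # ws)) 1 = fgen g * Poly_Mapping.single (Word ws) (1 :: 'k)"
      by (simp add: fgen_def mult_single plus_word_def)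
    then show ?case using gen[OF Cons] by simp
  qed
  have single: "Poly_Mapping.single w c \<in> smash_span q pbw_monomials" for w c
    using smash_span.scale[OF word[of "letters w"], of c] by (simp add: fscal_def mult_single)
  have "(\<Sum>w\<in>S. Poly_Mapping.single w (f w)) \<in> smash_span q pbw_monomials" if "finite S" for S f
    using that by (induction S rule: finite_induct)
      (auto intro: smash_span.add single smash_span.ideal smash_ideal_zero)
  from this[OF finite_keys[of x], of "Poly_Mapping.lookup x"] show ?thesis
    by (simp only: free_alg_sum_singles[symmetric])
qed

end

subsection \<open>Faithfulness\<close>

definition lead :: "'k::field laurent \<Rightarrow> int poly \<Rightarrow> bool"
  where "lead p e \<longleftrightarrow> (\<forall>k\<in>Poly_Mapping.keys p. k \<le> e) \<and> Poly_Mapping.lookup p e \<noteq> 0"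

definition below :: "'k::field laurent \<Rightarrow> int poly \<Rightarrow> bool"
  where "below p e \<longleftrightarrow> (\<forall>k\<in>Poly_Mapping.keys p. k < e)"

lemma keys_single_mult:
  fixes p :: "'k::field laurent"
  shows "Poly_Mapping.keys (Poly_Mapping.single f c * p) \<subseteq> (+) f ` Poly_Mapping.keys p"
  using keys_mult[of "Poly_Mapping.single f c" p] by (auto split: if_splits)

lemma lookup_single_mult:
  fixes p :: "'k::field laurent"
  shows "Poly_Mapping.lookup (Poly_Mapping.single f c * p) (f + e) = c * Poly_Mapping.lookup p e"
proof -
  have "p = (\<Sum>w\<in>Poly_Mapping.keys p. Poly_Mapping.single w (Poly_Mapping.lookup p w))"
    by (rule poly_mapping_eqI) (simp add: lookup_sum lookup_single when_def in_keys_iff)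
  then have "Poly_Mapping.single f c * p =
      (\<Sum>w\<in>Poly_Mapping.keys p. Poly_Mapping.single (f + w) (c * Poly_Mapping.lookup p w))"
    by (metis (no_types, lifting) mult_single sum.cong sum_distrib_left)
  then have "Poly_Mapping.lookup (Poly_Mapping.single f c * p) (f + e) =
      (\<Sum>w\<in>Poly_Mapping.keys p. if w = e then c * Poly_Mapping.lookup p w else 0)"
    by (simp add: lookup_sum lookup_single when_def)
  then show ?thesis by (simp add: in_keys_iff)
qed

lemma lead_single_mult: "lead p e \<Longrightarrow> c \<noteq> 0 \<Longrightarrow> lead (Poly_Mapping.single f c * p) (f + e)"
  unfolding lead_def lookup_single_mult using keys_single_mult[of f c p] by auto

lemma below_single_mult:
  assumes "lead p e" "f < g"
  shows "below (Poly_Mapping.single f c * p) (g + e)"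
  unfolding below_def
proof
  fix k assume "k \<in> Poly_Mapping.keys (Poly_Mapping.single f c * p)"
  then obtain k' where "k = f + k'" "k' \<in> Poly_Mapping.keys p" using keys_single_mult[of f c p] by auto
  then show "k < g + e" using assms unfolding lead_def by (auto intro: add_less_le_mono)
qed

lemma lead_add: "lead p e \<Longrightarrow> below r e \<Longrightarrow> lead (p + r) e"
  using Poly_Mapping.keys_add[of p r] unfolding lead_def below_def
  by (auto simp: lookup_add in_keys_iff dest: less_imp_le)

lemma lead_diff: "lead p e \<Longrightarrow> below r e \<Longrightarrow> lead (p - r) e"
  using lead_add[of p e "- r"] by (simp add: below_def in_keys_iff)

text \<open>These are the dominant terms of the action: for \<open>E\<close> the one containing
  \<open>u\<close>, for \<open>F\<close> the one containing \<open>Z\<close>, since these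
  coordinates outrank the ones before them.\<close>

fun gen_exp :: "gens \<Rightarrow> int poly"
  where
    "gen_exp gX = [:1:]"
  | "gen_exp gY = [:-1, -1, 1:]"
  | "gen_exp gK = [:0, 1:]"
  | "gen_exp gKi = [:0, -1:]"
  | "gen_exp gE = [:2, 1, -1, 1:]"
  | "gen_exp gF = [:-2, 0, 0, -1, 1:]"

text \<open>The hypothesis concerns all points because generators shift the arguments. The powers of
  \<open>q\<close> that depend on the point are nonzero scalars, so the leading exponent is the same
  everywhere.\<close>

lemma lead_gen_act:
  fixes q :: "'k::field"
  assumes q: "q \<noteq> 0" "q\<^sup>2 \<noteq> 1" and v: "\<And>a b. lead (v a b) e"
  shows "lead (gen_act q g v a b) (gen_exp g + e)"
proof -
  let ?s = Poly_Mapping.single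
  define \<beta> where "\<beta> = 1 / (1 - q\<^sup>2)"
  have beta: "\<beta> \<noteq> 0" using q by (simp add: \<beta>_def)
  have qn: "q powi n \<noteq> 0" for n using q by simp
  note single = lead_single_mult[OF v qn]
  show ?thesis
  proof (cases g)
    case gE
    have eq: "gen_act q gE v a b = ?s [:2, 1, -1, 1:] (\<beta> * q powi (a - 2 * b)) * v (a - 2) (b - 1) -
        ?s [:2, 1, -1:] (\<beta> * q powi (a - 2 * b)) * v (a - 2) b"
      by (simp add: lm_def lc_def \<beta>_def[symmetric] right_diff_distrib mult.assoc[symmetric] mult_single)
    have "[:2, 1, -1:] < ([:2, 1, -1, 1:] :: int poly)" by (simp add: less_poly_def pos_poly_pCons)
    then show ?thesis
      unfolding gE eq gen_exp.simps using beta q(1)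
      by (intro lead_diff lead_single_mult[OF v] below_single_mult[OF v]) simp_all
  next
    case gF
    have eq: "gen_act q gF v a b = ?s [:-2, 0, 0, -1, 1:] \<beta> * v (a + 2) (b + 1) -
        ?s [:-2, 0, 1, -1:] (\<beta> * q powi (2 * b + 3)) * v (a + 2) (b + 1) +
        ?s [:-2, -2, 1:] (\<beta> * q powi (2 * b - 2 * a - 1)) * v (a + 2) b"
      by (simp add: lm_def lc_def \<beta>_def[symmetric] right_diff_distrib left_diff_distrib distrib_left
          mult.assoc[symmetric] mult_single)
    have "[:-2, 0, 1, -1:] < ([:-2, 0, 0, -1, 1:] :: int poly)" "[:-2, -2, 1:] < ([:-2, 0, 0, -1, 1:] :: int poly)"
      by (simp_all add: less_poly_def pos_poly_pCons)
    then show ?thesis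
      unfolding gF eq gen_exp.simps using beta q(1)
      by (intro lead_add lead_diff lead_single_mult[OF v] below_single_mult[OF v]) simp_all
  qed (use single[of "[:1:]" 0] single[of "[:-1, -1, 1:]"] single[of "[:0, 1:]"] single[of "[:0, -1:]"]
      in \<open>simp_all add: lm_def\<close>)
qed

definition pbw_monomial :: "nat \<times> nat \<times> nat \<times> nat \<times> int \<Rightarrow> (gens, 'k::field) free_alg"
  where "pbw_monomial = (\<lambda>(i, j, s, r, k). fX ^ i * (fY ^ j * (fF ^ s * (fE ^ r * kpow k))))"

definition pbw_exp :: "nat \<times> nat \<times> nat \<times> nat \<times> int \<Rightarrow> int poly"
  where "pbw_exp = (\<lambda>(i, j, s, r, k).
    [:int i - int j - 2 * int s + 2 * int r, k - int j + int r, int j - int r, int r - int s, int s:])"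

text \<open>The exponent vector is triangular: read from its last coordinate it yields
  \<open>s\<close>, \<open>r\<close>, \<open>j\<close>, \<open>k\<close>, \<open>i\<close> in
  turn.\<close>

lemma pbw_exp_inj: "pbw_exp \<tau> = pbw_exp \<tau>' \<Longrightarrow> \<tau> = \<tau>'"
  by (cases \<tau>; cases \<tau>') (simp add: pbw_exp_def)

context
  fixes q :: "'k::field"
  assumes q: "q \<noteq> 0" "q\<^sup>2 \<noteq> 1"
begin

lemma lead_act_power:
  assumes "\<And>a b. lead (act q y v a b) e"
  shows "lead (act q (fgen g ^ n * y) v a b) (of_nat n * gen_exp g + e)"
proof (induction n arbitrary: a b)
  case (Suc n)
  show ?case
    using lead_gen_act[OF q, of "act q (fgen g ^ n * y) v" _ g a b, OF Suc] by (simp add: act_mult act_fgen mult.assoc algebra_simps)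
qed (simp add: assms)

lemma lead_act_pbw_monomial:
  "lead (act q (pbw_monomial \<tau>) (\<lambda>a b. 1) a b) (pbw_exp \<tau>)"
proof -
  obtain i j s r k where \<tau>: "\<tau> = (i, j, s, r, k)" by (metis prod_cases5)
  have one: "lead (act q 1 (\<lambda>a b. 1) a b) 0" for a b
    by (simp add: act_1 lead_def)
  have "lead (act q (kpow k) (\<lambda>a b. 1) a b) [:0, k:]" for a b
  proof (cases "k \<ge> 0")
    case True
    then show ?thesis using lead_act_power[OF one, of gK "nat k"] by (simp add: kpow_def of_nat_poly)
  next
    case False
    then show ?thesis using lead_act_power[OF one, of gKi "nat (- k)"] by (simp add: kpow_def of_nat_poly)
  qed
  then have "lead (act q (fX ^ i * (fY ^ j * (fF ^ s * (fE ^ r * kpow k)))) (\<lambda>a b. 1) a b)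
     (of_nat i * gen_exp gX + (of_nat j * gen_exp gY + (of_nat s * gen_exp gF + (of_nat r * gen_exp gE + [:0, k:]))))"
    by (intro lead_act_power)
  then show ?thesis by (simp add: \<tau> pbw_monomial_def pbw_exp_def of_nat_poly algebra_simps)
qed

lemma smash_span_pbw_sum:
  assumes "x \<in> smash_span q pbw_monomials"
  shows "\<exists>T c. finite T \<and> smash_cong q x (\<Sum>\<tau>\<in>T. fscal (c \<tau>) * pbw_monomial \<tau>)"
  using assms
proof induction
  case (ideal x)
  then show ?case by (intro exI[of _ "{}"]) (simp add: smash_cong_def)
next
  case (base x)
  then obtain \<tau> where "x = pbw_monomial \<tau>"
    by (auto simp: pbw_monomials_def uq_monomials_def pbw_monomial_def)
  then have "smash_cong q x (\<Sum>\<tau>\<in>{\<tau>}. fscal 1 * pbw_monomial \<tau>)" by simp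
  then show ?case by (intro exI[of _ "{\<tau>}"] exI[of _ "\<lambda>_. 1"]) simp
next
  case (add x y)
  then obtain T c T' c' where xy: "finite T" "smash_cong q x (\<Sum>\<tau>\<in>T. fscal (c \<tau>) * pbw_monomial \<tau>)"
    "finite T'" "smash_cong q y (\<Sum>\<tau>\<in>T'. fscal (c' \<tau>) * pbw_monomial \<tau>)" by blast
  define d where "d \<tau> = (if \<tau> \<in> T then c \<tau> else 0)" for \<tau>
  define d' where "d' \<tau> = (if \<tau> \<in> T' then c' \<tau> else 0)" for \<tau>
  have "(\<Sum>\<tau>\<in>T. fscal (c \<tau>) * pbw_monomial \<tau>) = (\<Sum>\<tau>\<in>T \<union> T'. fscal (d \<tau>) * pbw_monomial \<tau>)"
    by (intro sum.mono_neutral_cong_left) (auto simp: xy d_def)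
  moreover have "(\<Sum>\<tau>\<in>T'. fscal (c' \<tau>) * pbw_monomial \<tau>) = (\<Sum>\<tau>\<in>T \<union> T'. fscal (d' \<tau>) * pbw_monomial \<tau>)"
    by (intro sum.mono_neutral_cong_left) (auto simp: xy d'_def)
  ultimately have "smash_cong q (x + y) (\<Sum>\<tau>\<in>T \<union> T'. fscal (d \<tau> + d' \<tau>) * pbw_monomial \<tau>)"
    using smash_cong_add[OF xy(2,4)] by (simp add: fscal_add distrib_right sum.distrib)
  with xy(1,3) show ?case by (intro exI[of _ "T \<union> T'"] exI[of _ "\<lambda>\<tau>. d \<tau> + d' \<tau>"] conjI finite_UnI)
next
  case (scale x k)
  then obtain T c where x: "finite T" "smash_cong q x (\<Sum>\<tau>\<in>T. fscal (c \<tau>) * pbw_monomial \<tau>)" by blast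
  have "smash_cong q (fscal k * x) (\<Sum>\<tau>\<in>T. fscal (k * c \<tau>) * pbw_monomial \<tau>)"
    using smash_cong_left[OF x(2), of "fscal k"] by (simp add: sum_distrib_left fscal_mult mult.assoc)
  with x(1) show ?case by (intro exI[of _ T] exI[of _ "\<lambda>\<tau>. k * c \<tau>"] conjI)
qed

text \<open>The values at the constant function have pairwise distinct leading exponents.\<close>

lemma act_faithful:
  assumes zero: "act q x (\<lambda>a b. 1) 0 0 = 0"
  shows "x \<in> smash_ideal q"
proof -
  let ?l = "\<lambda>x. act q x (\<lambda>a b. 1) 0 0"
  obtain T c where T: "finite T" "smash_cong q x (\<Sum>\<tau>\<in>T. fscal (c \<tau>) * pbw_monomial \<tau>)"
    using smash_span_pbw_sum[OF pbw_spanning[OF q(1)]] by blast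
  define S where "S = {\<tau>\<in>T. c \<tau> \<noteq> 0}"
  have S: "finite S" using T by (simp add: S_def)
  have sum_S: "(\<Sum>\<tau>\<in>T. fscal (c \<tau>) * pbw_monomial \<tau>) = (\<Sum>\<tau>\<in>S. fscal (c \<tau>) * pbw_monomial \<tau>)"
    unfolding S_def by (intro sum.mono_neutral_right T) auto
  have "?l (x - (\<Sum>\<tau>\<in>S. fscal (c \<tau>) * pbw_monomial \<tau>)) = 0"
    using T(2) unfolding smash_cong_def sum_S by (rule act_smash_ideal[OF q])
  then have sum0: "(\<Sum>\<tau>\<in>S. lc (c \<tau>) * ?l (pbw_monomial \<tau>)) = 0"
    using zero by (simp add: act_diff act_sum act_fscal_mult)
  have "S = {}"
  proof (rule ccontr)
    assume "S \<noteq> {}"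
    then have "Max (pbw_exp ` S) \<in> pbw_exp ` S" using S by (intro Max_in) auto
    then obtain \<sigma> where s: "\<sigma> \<in> S" "pbw_exp \<sigma> = Max (pbw_exp ` S)" by auto
    have lookup0: "Poly_Mapping.lookup (lc (c \<tau>) * ?l (pbw_monomial \<tau>)) (pbw_exp \<sigma>) =
      c \<tau> * Poly_Mapping.lookup (?l (pbw_monomial \<tau>)) (pbw_exp \<sigma>)" for \<tau>
      using lookup_single_mult[of 0 "c \<tau>" _ "pbw_exp \<sigma>"] by (simp add: lc_def)
    have other: "Poly_Mapping.lookup (?l (pbw_monomial \<tau>)) (pbw_exp \<sigma>) = 0" if "\<tau> \<in> S" "\<tau> \<noteq> \<sigma>" for \<tau>
    proof -
      have "pbw_exp \<tau> \<le> pbw_exp \<sigma>" unfolding s(2) using S that by auto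
      then have "pbw_exp \<tau> < pbw_exp \<sigma>" using that(2) pbw_exp_inj by (metis order_less_le)
      then show ?thesis using lead_act_pbw_monomial[of \<tau> 0 0]
        unfolding lead_def by (auto simp: in_keys_iff dest: leD)
    qed
    have "0 = (\<Sum>\<tau>\<in>S. c \<tau> * Poly_Mapping.lookup (?l (pbw_monomial \<tau>)) (pbw_exp \<sigma>))"
      using arg_cong[OF sum0, of "\<lambda>p. Poly_Mapping.lookup p (pbw_exp \<sigma>)"] by (simp add: lookup_sum lookup0)
    also have "\<dots> = c \<sigma> * Poly_Mapping.lookup (?l (pbw_monomial \<sigma>)) (pbw_exp \<sigma>)"
      using other S s(1) by (subst sum.remove[OF S s(1)]) (simp add: sum.neutral)
    finally show False using s(1) lead_act_pbw_monomial[of \<sigma> 0 0] by (simp add: S_def lead_def)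
  qed
  then show ?thesis using T(2) unfolding sum_S by (simp add: smash_cong_def)
qed

end

subsection \<open>Periodic functions\<close>

text \<open>This is the order of \<open>q^2\<close> when \<open>q\<close> has order
  \<open>l\<close>.\<close>

definition half_order :: "nat \<Rightarrow> nat"
  where "half_order l = (if odd l then l else l div 2)"

definition vec_index :: "nat \<Rightarrow> (int \<times> int) set"
  where "vec_index l = {0..<int l} \<times> {0..<int (half_order l)}"

definition periodic :: "nat \<Rightarrow> 'k::field vec \<Rightarrow> bool"
  where "periodic l v \<longleftrightarrow> (\<forall>a b. v (a + int l) b = v a b \<and> v a (b + int (half_order l)) = v a b)"

definition delta :: "nat \<Rightarrow> int \<times> int \<Rightarrow> 'k::field vec"
  where "delta l p a b = (if a mod int l = fst p \<and> b mod int (half_order l) = snd p then 1 else 0)"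

definition op_matrix :: "nat \<Rightarrow> ('k::field vec \<Rightarrow> 'k vec) \<Rightarrow> int \<times> int \<Rightarrow> int \<times> int \<Rightarrow> 'k laurent"
  where "op_matrix l T p r = T (delta l r) (fst p) (snd p)"

text \<open>For \<open>q\<close> of order \<open>l\<close> both sides say that
  \<open>q^(2 n) = 1\<close>, expressed once by the order of \<open>q\<close> and once by that of
  \<open>q^2\<close>.\<close>

lemma dvd_double_iff_half_order: "int l dvd 2 * n \<longleftrightarrow> int (half_order l) dvd n"
proof (cases "odd l")
  case True
  then have "coprime (int l) 2" by (simp add: coprime_right_2_iff_odd)
  then show ?thesis using True by (simp add: half_order_def coprime_dvd_mult_right_iff)
next
  case False
  then obtain k where "l = 2 * k" by auto
  then show ?thesis by (simp add: half_order_def)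
qed

lemma periodic_delta: "periodic l (delta l p)"
  by (simp add: periodic_def delta_def)

lemma periodic_mod:
  assumes "periodic l v"
  shows "v (a mod int l) (b mod int (half_order l)) = v a b"
proof -
  have a: "v (a + int k * int l) b = v a b" for a b k
  proof (induction k)
    case (Suc k)
    have "a + int (Suc k) * int l = (a + int k * int l) + int l" by (simp add: algebra_simps)
    then show ?case using Suc assms by (simp only: periodic_def)
  qed simp
  have b: "v a (b + int k * int (half_order l)) = v a b" for a b k
  proof (induction k)
    case (Suc k)
    have "b + int (Suc k) * int (half_order l) = (b + int k * int (half_order l)) + int (half_order l)"
      by (simp add: algebra_simps)
    then show ?case using Suc assms by (simp only: periodic_def)
  qed simp
  have a': "v (a mod int l) b = v a b" for a b
  proof (cases "a div int l \<ge> 0")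
    case True
    then show ?thesis using a[of "a mod int l" "nat (a div int l)" b] by simp
  next
    case False
    then have "a + int (nat (- (a div int l))) * int l = a mod int l"
      by (simp add: minus_div_mult_eq_mod[symmetric])
    then show ?thesis using a[of a "nat (- (a div int l))" b] by simp
  qed
  have b': "v a (b mod int (half_order l)) = v a b" for a b
  proof (cases "b div int (half_order l) \<ge> 0")
    case True
    then show ?thesis using b[of a "b mod int (half_order l)" "nat (b div int (half_order l))"] by simp
  next
    case False
    then have "b + int (nat (- (b div int (half_order l)))) * int (half_order l) = b mod int (half_order l)"
      by (simp add: minus_div_mult_eq_mod[symmetric])
    then show ?thesis using b[of a b "nat (- (b div int (half_order l)))"] by simp
  qed
  show ?thesis by (simp add: a' b')
qed

lemma periodic_expand:
  assumes v: "periodic l v" and l: "l \<ge> 3"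
  shows "v = (\<lambda>a b. \<Sum>p\<in>vec_index l. v (fst p) (snd p) * delta l p a b)"
proof (intro ext)
  fix a b
  let ?p = "(a mod int l, b mod int (half_order l))"
  have "half_order l > 0" using l by (auto simp: half_order_def)
  then have p: "?p \<in> vec_index l" using l by (auto simp: vec_index_def)
  have "(\<Sum>p\<in>vec_index l. v (fst p) (snd p) * delta l p a b) =
      (\<Sum>p\<in>vec_index l. if p = ?p then v (fst p) (snd p) else 0)"
    by (intro sum.cong refl) (auto simp: delta_def)
  also have "\<dots> = v (a mod int l) (b mod int (half_order l))"
    using p by (simp add: vec_index_def)
  finally show "v a b = (\<Sum>p\<in>vec_index l. v (fst p) (snd p) * delta l p a b)"
    by (simp add: periodic_mod[OF v])
qed

text \<open>The span over the Laurent polynomials is formed for operators on all functions, where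
  shifts and multiplications compose without reduction of indices; periodic functions turn it into a
  span of matrices afterwards.\<close>

inductive_set op_span :: "'k::field \<Rightarrow> ('k vec \<Rightarrow> 'k vec) set"
  for q where
    base: "smash_class q x \<in> smash_sub q \<Longrightarrow> act q x \<in> op_span q"
  | lin: "S \<in> op_span q \<Longrightarrow> T \<in> op_span q \<Longrightarrow> (\<lambda>v a b. c * S v a b + d * T v a b) \<in> op_span q"

lemma op_span_scale: "T \<in> op_span q \<Longrightarrow> (\<lambda>v a b. c * T v a b) \<in> op_span q"
  using op_span.lin[of T q T c 0] by simp

subsection \<open>The quotient algebra\<close>

lemma smash_class_eq: "smash_class q x = {i + x | i. i \<in> smash_ideal q}"
  by (auto simp: smash_class_def a_r_coset_def' free_alg_ring_def)

lemma smash_class_eqD: "smash_class q x = smash_class q y \<Longrightarrow> x - y \<in> smash_ideal q"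
proof -
  assume eq: "smash_class q x = smash_class q y"
  have "0 + x \<in> smash_class q x" unfolding smash_class_eq using smash_ideal_zero by blast
  then have "x \<in> smash_class q y" using eq by simp
  then show ?thesis by (auto simp: smash_class_eq)
qed

lemma smash_class_eqI:
  assumes "x - y \<in> smash_ideal q"
  shows "smash_class q x = smash_class q y"
proof -
  have "i + x \<in> smash_class q y" if "i \<in> smash_ideal q" for i
  proof -
    have "i + x = (i + (x - y)) + y" by simp
    then show ?thesis unfolding smash_class_eq using smash_ideal_add[OF that assms] by blast
  qed
  moreover have "i + y \<in> smash_class q x" if "i \<in> smash_ideal q" for i
  proof -
    have "i + y = (i - (x - y)) + x" by simp
    then show ?thesis unfolding smash_class_eq using smash_ideal_diff[OF that assms] by blast
  qed
  ultimately show ?thesis unfolding smash_class_eq[of q x] smash_class_eq[of q y] by blast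
qed

lemma carrier_smash_alg: "carrier (smash_alg q) = range (smash_class q)"
  by (auto simp: smash_alg_def FactRing_def A_RCOSETS_def' free_alg_ring_def smash_class_def)

lemma smash_alg_ops:
  shows smash_class_add: "smash_class q x \<oplus>\<^bsub>smash_alg q\<^esub> smash_class q y = smash_class q (x + y)"
    and smash_class_mult: "smash_class q x \<otimes>\<^bsub>smash_alg q\<^esub> smash_class q y = smash_class q (x * y)"
    and smash_class_one: "\<one>\<^bsub>smash_alg q\<^esub> = smash_class q 1"
    and smash_class_zero: "\<zero>\<^bsub>smash_alg q\<^esub> = smash_class q 0"
proof -
  have c: "x \<in> carrier free_alg_ring" for x :: "(gens, 'a) free_alg" by (simp add: free_alg_ring_def)
  have zero: "smash_class q 0 = smash_ideal q" by (auto simp: smash_class_eq)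
  show "smash_class q x \<oplus>\<^bsub>smash_alg q\<^esub> smash_class q y = smash_class q (x + y)"
    using ideal.a_rcos_sum[OF ideal_smash_ideal c c, of q x y]
    by (simp add: smash_alg_def FactRing_def smash_class_def, simp add: free_alg_ring_def)
  show "smash_class q x \<otimes>\<^bsub>smash_alg q\<^esub> smash_class q y = smash_class q (x * y)"
    using ideal.rcoset_mult_add[OF ideal_smash_ideal c c, of q x y]
    by (simp add: smash_alg_def FactRing_def smash_class_def, simp add: free_alg_ring_def)
  show "\<one>\<^bsub>smash_alg q\<^esub> = smash_class q 1" "\<zero>\<^bsub>smash_alg q\<^esub> = smash_class q 0"
    unfolding zero by (simp_all add: smash_alg_def FactRing_def smash_class_def, simp add: free_alg_ring_def)
qed

lemma subring_smash_sub: "subring (smash_sub q) (smash_alg q)"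
  unfolding smash_sub_def
  by (rule ring.generate_ring_is_subring[OF ring_smash_alg]) (auto simp: smash_class_closed)

lemma smash_sub_mult:
  "smash_class q x \<in> smash_sub q \<Longrightarrow> smash_class q y \<in> smash_sub q \<Longrightarrow> smash_class q (x * y) \<in> smash_sub q"
  unfolding smash_class_mult[symmetric] using subringE(6)[OF subring_smash_sub] by blast

lemma smash_sub_generators:
  assumes "x \<in> range fscal \<union> {fK, fKi, fX, fY, phi q, psi q}"
  shows "smash_class q x \<in> smash_sub q"
  unfolding smash_sub_def by (rule generate_ring.incl[OF imageI[OF assms]])

text \<open>The operators are linear over the Laurent polynomials, so the coefficients of the inner
  factor can be pulled out.\<close>

lemma op_span_comp:
  assumes "S \<in> op_span q" "T \<in> op_span q"
  shows "(\<lambda>v. S (T v)) \<in> op_span q"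
  using assms(1)
proof induction
  case (base x)
  show ?case using assms(2)
  proof induction
    case (base y)
    have "(\<lambda>v. act q x (act q y v)) = act q (x * y)" by (intro ext) (simp add: act_mult)
    then show ?case using smash_sub_mult[OF \<open>smash_class q x \<in> smash_sub q\<close> base] by (simp add: op_span.base)
  next
    case (lin S T c d)
    have "(\<lambda>v. act q x (\<lambda>a b. c * S v a b + d * T v a b)) =
        (\<lambda>v a b. c * act q x (S v) a b + d * act q x (T v) a b)"
      by (intro ext) (rule lin_opD(1)[OF lin_op_act])
    then show ?case using op_span.lin[OF lin.IH, of c d] by simp
  qed
next
  case (lin S S' c d)
  then show ?case using op_span.lin[OF lin.IH, of c d] by simp
qed

text \<open>The choice of a representative does not matter, since the ideal acts by zero.\<close>

definition quot_matrix :: "'k::field \<Rightarrow> nat \<Rightarrow> (gens, 'k) free_alg set \<Rightarrow> int \<times> int \<Rightarrow> int \<times> int \<Rightarrow> 'k laurent"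
  where "quot_matrix q l c = op_matrix l (act q (SOME x. smash_class q x = c))"

context
  fixes q :: "'k::field" and l :: nat
  assumes l: "l \<ge> 3" and prim: "primitive_root_of_unity l q"
begin

section \<open>Powers of \<open>q\<close>, periodicity of the action and its matrices\<close>

lemma q_nonzero: "q \<noteq> 0"
  using prim l by (auto simp: primitive_root_of_unity_def power_0_left)

lemma q_square: "q\<^sup>2 \<noteq> 1"
  using prim l by (auto simp: primitive_root_of_unity_def)

lemma power_int_eq_1_iff: "q powi n = 1 \<longleftrightarrow> int l dvd n"
proof -
  have "q powi n = q powi (int l * (n div int l) + n mod int l)" by simp
  also have "\<dots> = q powi (int l * (n div int l)) * q powi (n mod int l)"
    using q_nonzero by (intro power_int_add) simp
  also have "q powi (int l * (n div int l)) = 1"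
    using prim by (simp add: power_int_mult primitive_root_of_unity_def)
  also have "q powi (n mod int l) = q ^ nat (n mod int l)"
    using l by (simp add: power_int_def)
  finally have eq: "q powi n = q ^ nat (n mod int l)" by simp
  have "nat (n mod int l) < l" using l by (simp add: nat_less_iff)
  then have "q ^ nat (n mod int l) = 1 \<longleftrightarrow> nat (n mod int l) = 0"
    using prim unfolding primitive_root_of_unity_def by (metis neq0_conv power_0)
  also have "\<dots> \<longleftrightarrow> n mod int l = 0"
    using pos_mod_sign[of "int l" n] l by (simp add: order_antisym_conv)
  finally show ?thesis unfolding eq by (simp only: dvd_eq_mod_eq_0)
qed

lemma power_int_eq_iff: "q powi a = q powi b \<longleftrightarrow> int l dvd a - b"
proof -
  have "q powi a = q powi (a - b) * q powi b" using q_nonzero by (simp flip: power_int_add)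
  then show ?thesis using q_nonzero by (simp flip: power_int_eq_1_iff)
qed

lemma lm_cong: "int l dvd n - n' \<Longrightarrow> lm q x k t u z n = lm q x k t u z n'"
  using power_int_eq_iff[of n n'] by (simp add: lm_def)

text \<open>The variables enter the coefficients only through \<open>q^a\<close> and
  \<open>q^(2 b)\<close>, so the orders of \<open>q\<close> and of \<open>q^2\<close> serve as
  periods.\<close>

lemma periodic_gen_act:
  assumes v: "periodic l v"
  shows "periodic l (gen_act q g v)"
proof -
  let ?m = "int (half_order l)"
  have va: "v (a + int l + c) b = v (a + c) b" "v (a + int l - c) b = v (a - c) b" for a b c
    using v[unfolded periodic_def, rule_format, of "a + c" b] v[unfolded periodic_def, rule_format, of "a - c" b]
    by (simp_all add: algebra_simps)
  have vb: "v a (b + ?m + c) = v a (b + c)" "v a (b + ?m - c) = v a (b - c)" for a b c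
    using v[unfolded periodic_def, rule_format, of a "b + c"] v[unfolded periodic_def, rule_format, of a "b - c"]
    by (simp_all add: algebra_simps)
  have v0: "v (a + int l) b = v a b" "v a (b + ?m) = v a b" for a b
    using v by (simp_all add: periodic_def)
  have m: "int l dvd 2 * ?m" by (simp add: dvd_double_iff_half_order)
  have la: "lm q x k t u z (a + int l) = lm q x k t u z a"
    "lm q x k t u z (- (a + int l)) = lm q x k t u z (- a)"
    "lm q x k t u z (2 * b - (a + int l)) = lm q x k t u z (2 * b - a)"
    "lm q x k t u z (a + int l - 2 * b) = lm q x k t u z (a - 2 * b)"
    "lm q x k t u z (2 * b - 2 * (a + int l) - 1) = lm q x k t u z (2 * b - 2 * a - 1)" for x k t u z a b
    by (rule lm_cong; simp add: algebra_simps)+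
  have lb: "lm q x k t u z (2 * (b + ?m) - a) = lm q x k t u z (2 * b - a)"
    "lm q x k t u z (a - 2 * (b + ?m)) = lm q x k t u z (a - 2 * b)"
    "lm q x k t u z (2 * (b + ?m) + 3) = lm q x k t u z (2 * b + 3)"
    "lm q x k t u z (2 * (b + ?m) - 2 * a - 1) = lm q x k t u z (2 * b - 2 * a - 1)" for x k t u z a b
    by (rule lm_cong; use m in \<open>simp add: algebra_simps\<close>)+
  show ?thesis
    unfolding periodic_def
  proof (intro allI conjI)
    fix a b
    show "gen_act q g v (a + int l) b = gen_act q g v a b"
      by (cases g; simp only: gen_act.simps va v0 la)
    show "gen_act q g v a (b + ?m) = gen_act q g v a b"
      by (cases g; simp only: gen_act.simps vb v0 lb)
  qed
qed

lemma periodic_act: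
  assumes "periodic l v"
  shows "periodic l (act q x v)"
proof -
  have "periodic l (foldr (gen_act q) ws v)" for ws
    by (induction ws) (simp_all add: assms periodic_gen_act)
  then have "periodic l (word_act q w v)" for w by (simp add: word_act_def)
  then show ?thesis by (simp add: periodic_def act_def)
qed

lemma op_matrix_act_mult:
  "op_matrix l (act q (x * y)) p r = (\<Sum>s\<in>vec_index l. op_matrix l (act q x) p s * op_matrix l (act q y) s r)"
proof -
  have fin: "finite (vec_index l)" by (simp add: vec_index_def)
  have "act q y (delta l r) = (\<lambda>a b. \<Sum>s\<in>vec_index l. act q y (delta l r) (fst s) (snd s) * delta l s a b)"
    by (rule periodic_expand[OF periodic_act[OF periodic_delta] l])
  then have "act q x (act q y (delta l r)) (fst p) (snd p) =
      act q x (\<lambda>a b. \<Sum>s\<in>vec_index l. act q y (delta l r) (fst s) (snd s) * delta l s a b) (fst p) (snd p)"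
    by simp
  also have "\<dots> = (\<Sum>s\<in>vec_index l. act q y (delta l r) (fst s) (snd s) * act q x (delta l s) (fst p) (snd p))"
    by (rule lin_op_sum[OF lin_op_act fin])
  finally show ?thesis by (simp add: op_matrix_def act_mult mult.commute)
qed

text \<open>The constant function is periodic, so the test of faithfulness on that single vector
  survives the restriction to periodic functions.\<close>

lemma op_matrix_faithful:
  assumes "\<And>p r. p \<in> vec_index l \<Longrightarrow> r \<in> vec_index l \<Longrightarrow> op_matrix l (act q x) p r = 0"
  shows "x \<in> smash_ideal q"
proof (rule act_faithful[OF q_nonzero q_square])
  have fin: "finite (vec_index l)" by (simp add: vec_index_def)
  have "half_order l > 0" using l by (auto simp: half_order_def)
  then have 0: "(0, 0) \<in> vec_index l" using l by (auto simp: vec_index_def)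
  have "periodic l (\<lambda>a b. 1 :: 'k laurent)" by (simp add: periodic_def)
  from periodic_expand[OF this l]
  have "act q x (\<lambda>a b. 1) 0 0 = act q x (\<lambda>a b. \<Sum>p\<in>vec_index l. 1 * delta l p a b) 0 0" by simp
  also have "\<dots> = (\<Sum>p\<in>vec_index l. 1 * act q x (delta l p) 0 0)"
    by (rule lin_op_sum[OF lin_op_act fin])
  also have "\<dots> = 0" using assms[OF 0] by (simp add: op_matrix_def)
  finally show "act q x (\<lambda>a b. 1) 0 0 = 0" .
qed

lemma quot_matrix_class: "quot_matrix q l (smash_class q x) = op_matrix l (act q x)"
proof -
  define y where "y = (SOME y. smash_class q y = smash_class q x)"
  have "smash_class q y = smash_class q x" unfolding y_def by (rule someI[of _ x]) simp
  then have "act q (y - x) v a b = 0" for v a b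
    by (intro act_smash_ideal[OF q_nonzero q_square] smash_class_eqD)
  then have "act q y = act q x" by (intro ext) (simp add: act_diff)
  then show ?thesis by (simp add: quot_matrix_def y_def)
qed

lemma op_span_matrix:
  assumes "T \<in> op_span q"
  shows "op_matrix l T \<in> mat_span (quot_matrix q l ` smash_sub q)"
  using assms
proof induction
  case (base x)
  have "op_matrix l (act q x) = quot_matrix q l (smash_class q x)" by (simp add: quot_matrix_class)
  then show ?case using base by (auto intro: mat_span.base)
next
  case (lin S T c d)
  have "op_matrix l (\<lambda>v a b. c * S v a b + d * T v a b) =
      (\<lambda>p r. c * op_matrix l S p r + d * op_matrix l T p r)"
    by (intro ext) (simp add: op_matrix_def)
  then show ?case using mat_span.lin[OF lin.IH, of c d] by simp
qed

section \<open>Matrix units in the span of the subalgebra\<close>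

lemma op_span_id: "(\<lambda>v. v) \<in> op_span q"
proof -
  have "act q 1 = (\<lambda>v. v)" by (intro ext) (simp add: act_1)
  moreover have "smash_class q (fscal 1) \<in> smash_sub q" by (rule smash_sub_generators) blast
  ultimately show ?thesis using op_span.base[of q 1] by simp
qed

text \<open>Multiplying by the inverse monomial removes the indeterminate and leaves the bare shift;
  the same is done for the other torus generators.\<close>

lemma op_span_X: "(\<lambda>v a b. v (a - 1) b) \<in> op_span q"
proof -
  have "act q fX \<in> op_span q" by (intro op_span.base smash_sub_generators) blast
  from op_span_scale[OF this, of "lm q (-1) 0 0 0 0 0"] show ?thesis
    by (simp add: act_fgen lm_mult_left[OF q_nonzero]) (simp add: lm_def)
qed

lemma op_span_phi: "(\<lambda>v a b. v (a - 1) (b - 1)) \<in> op_span q"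
proof -
  have "act q (phi q) \<in> op_span q" by (intro op_span.base smash_sub_generators) blast
  from op_span_scale[OF this, of "lm q (-1) 0 0 (-1) 0 0"] show ?thesis
    by (simp add: act_phi[OF q_nonzero q_square] lm_mult_left[OF q_nonzero]) (simp add: lm_def)
qed

lemma op_span_K: "(\<lambda>v a b. lc (q powi a) * v a b) \<in> op_span q"
proof -
  have "act q fK \<in> op_span q" by (intro op_span.base smash_sub_generators) blast
  from op_span_scale[OF this, of "lm q 0 (-1) 0 0 0 0"] show ?thesis
    by (simp add: act_fgen lm_mult_left[OF q_nonzero]) (simp add: lm_def lc_def)
qed

text \<open>The product \<open>Y X K\<close> is the diagonal generator \<open>t\<close>; it
  separates the values of the second variable as \<open>K\<close> separates those of the
  first.\<close>

lemma op_span_YXK: "(\<lambda>v a b. lc (q powi (2 * b)) * v a b) \<in> op_span q"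
proof -
  have "act q (fY * fX * fK) \<in> op_span q"
    by (intro op_span.base smash_sub_mult; intro smash_sub_generators; blast)
  from op_span_scale[OF this, of "lm q 0 0 (-1) 0 0 0"] show ?thesis
    by (simp add: act_mult act_fgen lm_mult_left[OF q_nonzero]) (simp add: lm_def lc_def)
qed

text \<open>This is Lagrange interpolation with a diagonal operator: the product kills all places
  where \<open>f\<close> takes one of the values \<open>g s\<close>.\<close>

lemma op_span_prod_diff:
  assumes D: "(\<lambda>v a b. f a b * v a b) \<in> op_span q" and "finite S"
  shows "(\<lambda>v a b. (\<Prod>s\<in>S. f a b - g s) * v a b) \<in> op_span q"
  using assms(2)
proof (induction S rule: finite_induct)
  case empty
  then show ?case using op_span_id by simp
next
  case (insert s S)
  have "(\<lambda>v a b. 1 * (f a b * v a b) + (- g s) * v a b) \<in> op_span q"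
    by (rule op_span.lin[OF D op_span_id])
  from op_span_comp[OF this insert.IH] show ?case
    using insert by (simp add: algebra_simps)
qed

lemma op_span_shift: "(\<lambda>v a b. v (a - int i - int j) (b - int i)) \<in> op_span q"
proof -
  have "(\<lambda>v a b. v (a - int j) b) \<in> op_span q"
  proof (induction j)
    case (Suc j)
    show ?case using op_span_comp[OF Suc op_span_X] by (simp add: algebra_simps)
  qed (simp add: op_span_id)
  moreover have "(\<lambda>v a b. v (a - int i) (b - int i)) \<in> op_span q"
  proof (induction i)
    case (Suc i)
    show ?case using op_span_comp[OF Suc op_span_phi] by (simp add: algebra_simps)
  qed (simp add: op_span_id)
  ultimately show ?thesis using op_span_comp by fastforce
qed

lemma dvd_diff_iff_eq:
  fixes n x y :: int
  assumes "0 \<le> x" "x < n" "0 \<le> y" "y < n"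
  shows "n dvd x - y \<longleftrightarrow> x = y"
  using assms by (simp add: mod_eq_dvd_iff[symmetric])

text \<open>Interpolation in both variables projects onto the column index \<open>r\<close>, and a
  product of shifts then carries \<open>r\<close> to the row index \<open>p\<close>.\<close>

lemma matrix_unit_in_span:
  assumes "p \<in> vec_index l" "r \<in> vec_index l"
  shows "\<exists>M\<in>mat_span (quot_matrix q l ` smash_sub q). \<exists>c. c \<noteq> 0 \<and>
     (\<forall>k\<in>vec_index l. \<forall>n\<in>vec_index l. M k n = (if k = p \<and> n = r then c else 0))"
proof -
  let ?m = "int (half_order l)"
  have m: "half_order l > 0" using l by (auto simp: half_order_def)
  obtain a0 b0 a1 b1 where p: "p = (a0, b0)" and r: "r = (a1, b1)" by (metis surj_pair)
  have rng: "0 \<le> a0" "a0 < int l" "0 \<le> b0" "b0 < ?m" "0 \<le> a1" "a1 < int l" "0 \<le> b1" "b1 < ?m"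
    using assms by (auto simp: p r vec_index_def)
  \<comment> \<open>\<open>P\<close> and \<open>Q\<close> are the numerators of the Lagrange
    polynomials for the residues \<open>a1\<close> and \<open>b1\<close>. They are left
    unnormalised, as a nonzero multiple of the matrix unit is enough.\<close>
  define P where "P a = (\<Prod>s\<in>{0..<int l} - {a1}. lc (q powi a) - lc (q powi s))" for a
  define Q where "Q b = (\<Prod>s\<in>{0..<?m} - {b1}. lc (q powi (2 * b)) - lc (q powi (2 * s)))" for b
  have lc_eq: "lc x = lc y \<longleftrightarrow> x = y" for x y :: 'k
    by (auto simp: lc_def dest: arg_cong[of _ _ "\<lambda>f. Poly_Mapping.lookup f 0"])
  have P: "P a = (if a mod int l = a1 then P a1 else 0)" for a
  proof -
    have red: "q powi a = q powi (a mod int l)"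
      by (simp add: power_int_eq_iff minus_mod_eq_mult_div)
    show ?thesis
    proof (cases "a mod int l = a1")
      case False
      then have "a mod int l \<in> {0..<int l} - {a1}" using l by auto
      then show ?thesis using False red unfolding P_def by (auto intro!: prod_zero)
    qed (simp add: P_def red)
  qed
  have P1: "P a1 \<noteq> 0"
  proof -
    have "\<not> int l dvd a1 - s" if "0 \<le> s" "s < int l" "s \<noteq> a1" for s
      using that rng by (simp add: dvd_diff_iff_eq)
    then show ?thesis unfolding P_def by (auto simp: lc_eq power_int_eq_iff)
  qed
  have Q: "Q b = (if b mod ?m = b1 then Q b1 else 0)" for b
  proof -
    have red: "q powi (2 * b) = q powi (2 * (b mod ?m))"
      unfolding power_int_eq_iff right_diff_distrib[symmetric] dvd_double_iff_half_order
      by (simp add: minus_mod_eq_mult_div)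
    show ?thesis
    proof (cases "b mod ?m = b1")
      case False
      then have "b mod ?m \<in> {0..<?m} - {b1}" using m by auto
      then show ?thesis using False red unfolding Q_def by (auto intro!: prod_zero)
    qed (simp add: Q_def red)
  qed
  have Q1: "Q b1 \<noteq> 0"
  proof -
    have "lc (q powi (2 * b1)) - lc (q powi (2 * s)) \<noteq> 0" if "s \<in> {0..<?m} - {b1}" for s
    proof -
      have "\<not> ?m dvd b1 - s" using that rng by (auto simp: dvd_diff_iff_eq)
      then have "\<not> int l dvd 2 * b1 - 2 * s"
        unfolding right_diff_distrib[symmetric] dvd_double_iff_half_order .
      then show ?thesis by (simp add: lc_eq power_int_eq_iff)
    qed
    then show ?thesis unfolding Q_def by (simp add: prod_zero_iff)
  qed
  \<comment> \<open>The shifts must make \<open>(a0 - i - j, b0 - i)\<close> congruent to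
    \<open>(a1, b1)\<close>. As \<open>phi\<close> moves both variables, \<open>i\<close> is
    determined by the second one and \<open>j\<close> corrects the first by powers of
    \<open>X\<close>.\<close>
  define i where "i = nat ((b0 - b1) mod ?m)"
  define j where "j = nat ((a0 - a1 - int i) mod int l)"
  have i: "int i = (b0 - b1) mod ?m" using m by (simp add: i_def)
  have j: "int j = (a0 - a1 - int i) mod int l" using l by (simp add: j_def)
  have bb: "(b - int i) mod ?m = b1 \<longleftrightarrow> b = b0" if "0 \<le> b" "b < ?m" for b
  proof -
    have "(b - int i) mod ?m = (b - b0 + b1) mod ?m" unfolding i by (simp add: mod_simps algebra_simps)
    then have "(b - int i) mod ?m = b1 \<longleftrightarrow> (b - b0 + b1) mod ?m = b1 mod ?m" using rng by simp
    also have "\<dots> \<longleftrightarrow> ?m dvd b - b0" by (simp add: mod_eq_dvd_iff)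
    also have "\<dots> \<longleftrightarrow> b = b0" using that rng by (simp add: dvd_diff_iff_eq)
    finally show ?thesis .
  qed
  have aa: "(a - int i - int j) mod int l = a1 \<longleftrightarrow> a = a0" if "0 \<le> a" "a < int l" for a
  proof -
    have "(a - int i - int j) mod int l = (a - a0 + a1) mod int l" unfolding j mod_diff_right_eq by (simp add: algebra_simps)
    then have "(a - int i - int j) mod int l = a1 \<longleftrightarrow> (a - a0 + a1) mod int l = a1 mod int l" using rng by simp
    also have "\<dots> \<longleftrightarrow> int l dvd a - a0" by (simp add: mod_eq_dvd_iff)
    also have "\<dots> \<longleftrightarrow> a = a0" using that rng by (simp add: dvd_diff_iff_eq)
    finally show ?thesis .
  qed
  define W where "W v a b = P (a - int i - int j) * (Q (b - int i) * v (a - int i - int j) (b - int i))"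
    for v :: "'k vec" and a b
  have "(\<lambda>v a b. Q b * v a b) \<in> op_span q"
    unfolding Q_def by (rule op_span_prod_diff[OF op_span_YXK]) simp
  moreover have "(\<lambda>v a b. P a * v a b) \<in> op_span q"
    unfolding P_def by (rule op_span_prod_diff[OF op_span_K]) simp
  ultimately have "(\<lambda>v a b. P a * (Q b * v a b)) \<in> op_span q"
    using op_span_comp by fastforce
  from op_span_comp[OF op_span_shift[of i j] this] have "W \<in> op_span q"
    by (simp add: W_def[abs_def])
  then have "op_matrix l W \<in> mat_span (quot_matrix q l ` smash_sub q)" by (rule op_span_matrix)
  moreover have "op_matrix l W k n = (if k = p \<and> n = r then P a1 * Q b1 else 0)"
    if k_index: "k \<in> vec_index l" for k n
  proof -
    obtain a b where k: "k = (a, b)" "0 \<le> a" "a < int l" "0 \<le> b" "b < ?m"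
      using k_index by (auto simp: vec_index_def)
    have Pa: "P (a - int i - int j) = (if a = a0 then P a1 else 0)"
      by (subst P) (simp only: aa[OF k(2,3)])
    have Qb: "Q (b - int i) = (if b = b0 then Q b1 else 0)"
      by (subst Q) (simp only: bb[OF k(4,5)])
    have val: "op_matrix l W k n =
        P (a - int i - int j) * (Q (b - int i) * delta l n (a - int i - int j) (b - int i))"
      by (simp add: op_matrix_def W_def k(1))
    show ?thesis
    proof (cases "a = a0 \<and> b = b0")
      case True
      then have "(a - int i - int j) mod int l = a1" "(b - int i) mod ?m = b1"
        using aa[OF k(2,3)] bb[OF k(4,5)] by simp_all
      then have dl: "delta l n (a - int i - int j) (b - int i) = (if n = r then 1 else 0)"
        by (cases n) (simp add: delta_def r eq_commute)
      show ?thesis unfolding val Pa Qb dl using True by (simp add: k(1) p)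
    next
      case False
      then show ?thesis unfolding val Pa Qb by (auto simp: k(1) p)
    qed
  qed
  ultimately show ?thesis using P1 Q1 by (intro bexI[of _ "op_matrix l W"] exI[of _ "P a1 * Q b1"]) auto
qed

lemma quot_matrix_add:
  assumes "c \<in> carrier (smash_alg q)" "d \<in> carrier (smash_alg q)"
  shows "quot_matrix q l (c \<oplus>\<^bsub>smash_alg q\<^esub> d) p r = quot_matrix q l c p r + quot_matrix q l d p r"
  using assms unfolding carrier_smash_alg
  by (auto simp: smash_class_add quot_matrix_class op_matrix_def act_add)

lemma quot_matrix_mult:
  assumes "c \<in> carrier (smash_alg q)" "d \<in> carrier (smash_alg q)"
  shows "quot_matrix q l (c \<otimes>\<^bsub>smash_alg q\<^esub> d) p r =
    (\<Sum>s\<in>vec_index l. quot_matrix q l c p s * quot_matrix q l d s r)"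
  using assms unfolding carrier_smash_alg
  by (auto simp: smash_class_mult quot_matrix_class op_matrix_act_mult)

lemma quot_matrix_one:
  assumes "p \<in> vec_index l" "r \<in> vec_index l"
  shows "quot_matrix q l \<one>\<^bsub>smash_alg q\<^esub> p r = (if p = r then 1 else 0)"
  using assms by (auto simp: smash_class_one quot_matrix_class op_matrix_def act_1 delta_def vec_index_def)

lemma quot_matrix_faithful:
  assumes "c \<in> carrier (smash_alg q)"
    and "\<And>p r. p \<in> vec_index l \<Longrightarrow> r \<in> vec_index l \<Longrightarrow> quot_matrix q l c p r = 0"
  shows "c = \<zero>\<^bsub>smash_alg q\<^esub>"
proof -
  obtain x where x: "c = smash_class q x" using assms(1) unfolding carrier_smash_alg by blast
  have "x \<in> smash_ideal q"
    by (rule op_matrix_faithful) (use assms(2) in \<open>simp add: x quot_matrix_class\<close>)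
  then show ?thesis by (simp add: x smash_class_zero smash_class_eqI)
qed

lemma mat_span_mono: "M \<in> mat_span G \<Longrightarrow> G \<subseteq> G' \<Longrightarrow> M \<in> mat_span G'"
  by (induction rule: mat_span.induct) (auto intro: mat_span.intros)

lemma vec_index_nonempty: "vec_index l \<noteq> {}"
  using l by (auto simp: vec_index_def half_order_def)

lemma spanning_smash_subalg: "spanning_matrix_ring (smash_subalg q) (vec_index l) (quot_matrix q l)"
proof -
  interpret ring "smash_subalg q" by (rule ring_smash_subalg)
  have sub: "smash_sub q \<subseteq> carrier (smash_alg q)" using subringE(1)[OF subring_smash_sub] .
  show ?thesis
  proof (unfold_locales, goal_cases)
    case 1
    show ?case by (simp add: vec_index_def)
  next
    case 2
    show ?case by (rule vec_index_nonempty)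
  next
    case (3 x y i j)
    then show ?case using sub by (auto simp: smash_subalg_def intro: quot_matrix_add)
  next
    case (4 x y i j)
    then show ?case using sub by (auto simp: smash_subalg_def intro: quot_matrix_mult)
  next
    case (5 i j)
    then show ?case by (simp add: smash_subalg_def quot_matrix_one)
  next
    case (6 x)
    then show ?case using sub quot_matrix_faithful[of x] by (auto simp: smash_subalg_def)
  next
    case (7 p r)
    then show ?case using matrix_unit_in_span[of p r] by (simp add: smash_subalg_def)
  qed
qed

text \<open>Spanning is inherited from the subalgebra, whose image is contained in that of the whole
  algebra. So both use the same index set, which is why their PI degrees agree.\<close>

lemma spanning_smash_alg: "spanning_matrix_ring (smash_alg q) (vec_index l) (quot_matrix q l)"
proof -
  interpret ring "smash_alg q" by (rule ring_smash_alg)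
  have sub: "smash_sub q \<subseteq> carrier (smash_alg q)" using subringE(1)[OF subring_smash_sub] .
  show ?thesis
  proof (unfold_locales, goal_cases)
    case 1
    show ?case by (simp add: vec_index_def)
  next
    case 2
    show ?case by (rule vec_index_nonempty)
  next
    case (3 x y i j)
    show ?case by (rule quot_matrix_add[OF 3(1,2)])
  next
    case (4 x y i j)
    show ?case by (rule quot_matrix_mult[OF 4(1,2)])
  next
    case (5 i j)
    then show ?case by (rule quot_matrix_one)
  next
    case (6 x)
    then show ?case by (rule quot_matrix_faithful)
  next
    case (7 p r)
    then show ?case using matrix_unit_in_span[of p r] mat_span_mono[OF _ image_mono[OF sub]] by blast
  qed
qed

lemma card_vec_index: "card (vec_index l) = (if odd l then l\<^sup>2 else l\<^sup>2 div 2)"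
  by (simp add: vec_index_def half_order_def power2_eq_square div_mult_swap)

end

theorem mainTheorem4:
  fixes q :: "'k::alg_closed_field" and l :: nat
  assumes "l \<ge> 3"
    and "primitive_root_of_unity l q"
  shows "prime_ring (smash_alg q) \<and> PI_ring (smash_alg q)
    \<and> prime_ring (smash_subalg q) \<and> PI_ring (smash_subalg q)
    \<and> PI_degree (smash_alg q) = PI_degree (smash_subalg q)
    \<and> PI_degree (smash_alg q) = (if odd l then l\<^sup>2 else l\<^sup>2 div 2)"
proof -
  interpret A: spanning_matrix_ring "smash_alg q" "vec_index l" "quot_matrix q l"
    by (rule spanning_smash_alg[OF assms])
  interpret B: spanning_matrix_ring "smash_subalg q" "vec_index l" "quot_matrix q l"
    by (rule spanning_smash_subalg[OF assms])
  show ?thesis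
    using A.prime_ring A.PI_ring A.PI_degree_eq_card B.prime_ring B.PI_ring B.PI_degree_eq_card
    by (simp add: card_vec_index[OF assms])
qed

end
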